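(* There exist universal constants $c$ and $\gamma_0$ such that for any $0<p<1/2$, any $\gamma>\gamma_0$, and any $d\ge d_0(\gamma)$ (where $d_0(\gamma)$ is a constant depending on $\gamma$), for $A\sim\mathrm{ABC}_p(n,\gamma,d)$, with probability $1-o(1)$ as $n\to\infty$: (1) For all $k$, all minimal dependencies of $k$ columns of $A$ are in $\mathcal{T}_k\cup\mathcal{T}_k^+\cup\mathcal{T}_k^C$. (2) The number of columns involved in linear dependencies of $A$ satisfies $$\left|\bigcup_{x:\,Ax=0}\operatorname{supp}(x)\right|\ \le\ n\,p^{\,\gamma d+c\log_p(\gamma d)}.$$
   Context: $\mathrm{ABC}(n,\gamma,d)$ is the distribution on matrices $A_0\in\{0,1\}^{\gamma n\times n}$ obtained as follows: create $\gamma n$ row-nodes with $d$ half-edges each and $n$ column-nodes with $\gamma d$ half-edges each; pair the $\gamma dn$ row half-edges with the $\gamma dn$ column half-edges by a uniformly random permutation; set $(A_0)_{ij}=1$ iff there is at least one edge from row-node $i$ to column-node $j$. $\mathrm{ABC}_p(n,\gamma,d)$ is the distribution of the submatrix $A$ of $A_0\sim\mathrm{ABC}(n,\gamma,d)$ consisting of its first $\gamma n(1-p)$ rows. (Parameters are such that these quantities are integers; $p,\gamma,d$ are fixed.) A minimal dependency of $k$ columns of $A$ is a submatrix $A_S$ (columns indexed by $S$, $|S|=k$) that is a minimal linear dependency: $M\in\mathbb{R}^{m\times k}$ is a minimal linear dependency if there exists $x\in\mathbb{R}^k$ with $Mx=0$ and $\operatorname{supp}(x)=[k]$, and $\operatorname{rank}(M)=k-1$.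 In the following, incidence matrices have rows indexed by edges and columns by vertices. $\mathcal{T}_k$: matrices $M\in\bigcup_m\{0,1\}^{m\times k}$ with exactly $2k-2$ ones whose non-zero rows form the edge-vertex incidence matrix of a tree on $k$ vertices. $\mathcal{T}_k^+$: matrices $M\in\bigcup_m\{0,1\}^{m\times k}$ with exactly $2k-1$ ones such that (i) $M$ has $k-1$ non-zero rows, $k-2$ of them supported on two entries and one supported on three entries; (ii) the submatrix of rows of support $2$ is the edge-vertex incidence matrix of a forest $F$ on the $k$ vertices with two connected components $F_1,F_2$; (iii) the row of support three has ones at column indices $a,b,c$ where $a,b\in F_i$ are connected by an even-length path and $c\in F_j$, with $\{i,j\}=\{1,2\}$. $\mathcal{T}_k^C$: matrices $M\in\bigcup_m\{0,1\}^{m\times k}$ with $2k$ ones whose non-zero rows form the edge-vertex incidence matrix of a tree on $k$ vertices together with one added edge between two vertices at odd distance from each other in the tree (the added edge may create a multi-edge). *)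

theory Defs
  imports
    "HOL-Probability.Probability"
    "Jordan_Normal_Form.DL_Rank"
    "Jordan_Normal_Form.DL_Submatrix"
    "Jordan_Normal_Form.Matrix_Kernel"
begin

section \<open>The random matrix model\<close>

text \<open>
  With \<open>m = \<gamma> n\<close> rows and \<open>D = \<gamma> d\<close>, the \<open>m d = n D\<close> row half-edges and
  column half-edges are both numbered \<open>0, \<dots>, m d - 1\<close>; row half-edge \<open>h\<close> is attached to
  row-node \<open>h div d\<close>, column half-edge \<open>h\<close> to column-node \<open>h div D\<close>, and the permutation
  \<open>\<sigma>\<close> joins row half-edge \<open>h\<close> to column half-edge \<open>\<sigma> h\<close>.
\<close>

definition pairing_matrix :: "nat \<Rightarrow> nat \<Rightarrow> nat \<Rightarrow> nat \<Rightarrow> (nat \<Rightarrow> nat) \<Rightarrow> real mat" where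
  "pairing_matrix m n d D \<sigma> =
     mat m n (\<lambda>(i, j). if \<exists>h < m * d. h div d = i \<and> \<sigma> h div D = j then 1 else 0)"

text \<open>
  The floors are exact whenever \<open>\<gamma> n\<close>, \<open>\<gamma> d\<close> and \<open>\<gamma> n (1 - p)\<close> are natural numbers, which
  is the only case in which the distributions are meant to be used.
\<close>

definition ABC0 :: "nat \<Rightarrow> real \<Rightarrow> nat \<Rightarrow> real mat pmf" where
  "ABC0 n \<gamma> d =
     (let m = nat \<lfloor>\<gamma> * real n\<rfloor>; D = nat \<lfloor>\<gamma> * real d\<rfloor>
      in map_pmf (pairing_matrix m n d D) (pmf_of_set {\<sigma>. \<sigma> permutes {..<m * d}}))"

definition ABC :: "real \<Rightarrow> nat \<Rightarrow> real \<Rightarrow> nat \<Rightarrow> real mat pmf" where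
  "ABC p n \<gamma> d =
     map_pmf (\<lambda>A0. submatrix A0 {..<nat \<lfloor>\<gamma> * real n * (1 - p)\<rfloor>} UNIV) (ABC0 n \<gamma> d)"

section \<open>Linear dependencies\<close>

definition supp_vec :: "real vec \<Rightarrow> nat set" where
  "supp_vec x = {j. j < dim_vec x \<and> x $ j \<noteq> 0}"

text \<open>
  The rank condition is written without subtraction, so that a matrix without columns is
  not a minimal dependency.
\<close>

definition minimal_dependency :: "real mat \<Rightarrow> bool" where
  "minimal_dependency M \<longleftrightarrow>
     (\<exists>x \<in> mat_kernel M. supp_vec x = {..<dim_col M}) \<and>
     vec_space.rank (dim_row M) M + 1 = dim_col M"

section \<open>Simple graphs\<close>

text \<open>
  A simple graph is a vertex set \<open>V\<close> with a set \<open>E\<close> of two-element subsets of \<open>V\<close>. (The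
  forests and trees of the AFP entry Graph-Theory are digraphs without directed cycles,
  which is a different notion.)
\<close>

definition simple_graph :: "'a set \<Rightarrow> 'a set set \<Rightarrow> bool" where
  "simple_graph V E \<longleftrightarrow> finite V \<and> (\<forall>e \<in> E. e \<subseteq> V \<and> card e = 2)"

definition path_betw :: "'a set \<Rightarrow> 'a set set \<Rightarrow> 'a \<Rightarrow> 'a list \<Rightarrow> 'a \<Rightarrow> bool" where
  "path_betw V E u vs v \<longleftrightarrow>
     vs \<noteq> [] \<and> hd vs = u \<and> last vs = v \<and> set vs \<subseteq> V \<and> distinct vs \<and>
     successively (\<lambda>x y. {x, y} \<in> E) vs"

abbreviation path_length :: "'a list \<Rightarrow> nat" where
  "path_length vs \<equiv> length vs - 1"

definition graph_dist :: "'a set \<Rightarrow> 'a set set \<Rightarrow> 'a \<Rightarrow> 'a \<Rightarrow> nat" where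
  "graph_dist V E u v = (LEAST l. \<exists>vs. path_betw V E u vs v \<and> path_length vs = l)"

definition graph_cycle :: "'a set set \<Rightarrow> 'a list \<Rightarrow> bool" where
  "graph_cycle E vs \<longleftrightarrow>
     length vs \<ge> 3 \<and> distinct vs \<and>
     successively (\<lambda>x y. {x, y} \<in> E) vs \<and> {last vs, hd vs} \<in> E"

definition components :: "'a set \<Rightarrow> 'a set set \<Rightarrow> 'a set set" where
  "components V E = (\<lambda>u. {v \<in> V. \<exists>vs. path_betw V E u vs v}) ` V"

definition is_forest :: "'a set \<Rightarrow> 'a set set \<Rightarrow> bool" where
  "is_forest V E \<longleftrightarrow> simple_graph V E \<and> (\<nexists>vs. graph_cycle E vs)"

definition is_tree :: "'a set \<Rightarrow> 'a set set \<Rightarrow> bool" where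
  "is_tree V E \<longleftrightarrow> is_forest V E \<and> V \<noteq> {} \<and>
     (\<forall>u \<in> V. \<forall>v \<in> V. \<exists>vs. path_betw V E u vs v)"

section \<open>The families of dependencies\<close>

definition zero_one_mats :: "nat \<Rightarrow> real mat set" where
  "zero_one_mats k = {M. dim_col M = k \<and> elements_mat M \<subseteq> {0, 1}}"

definition num_ones :: "real mat \<Rightarrow> nat" where
  "num_ones M = card {(i, j). i < dim_row M \<and> j < dim_col M \<and> M $$ (i, j) = 1}"

definition row_supp :: "real mat \<Rightarrow> nat \<Rightarrow> nat set" where
  "row_supp M i = {j. j < dim_col M \<and> M $$ (i, j) \<noteq> 0}"

definition nonzero_rows :: "real mat \<Rightarrow> nat set" where
  "nonzero_rows M = {i. i < dim_row M \<and> row_supp M i \<noteq> {}}"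

definition rows_of_supp :: "real mat \<Rightarrow> nat \<Rightarrow> nat set" where
  "rows_of_supp M s = {i. i < dim_row M \<and> card (row_supp M i) = s}"

text \<open>
  The rows with indices in \<open>I\<close> of the 0/1 matrix \<open>M\<close> form the edge-vertex incidence matrix
  of the multigraph with edge multiset \<open>E\<close>: each edge is the support of as many of these
  rows as its multiplicity, and there are no further rows.
\<close>

definition incidence_rows :: "real mat \<Rightarrow> nat set \<Rightarrow> nat set multiset \<Rightarrow> bool" where
  "incidence_rows M I E \<longleftrightarrow> image_mset (row_supp M) (mset_set I) = E"

text \<open>
  In all three families the numerical conditions are again written without subtraction on
  the natural numbers.
\<close>

definition T_tree :: "nat \<Rightarrow> real mat set" where
  "T_tree k = {M \<in> zero_one_mats k. num_ones M + 2 = 2 * k \<and>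
     (\<exists>E. is_tree {..<k} E \<and> incidence_rows M (nonzero_rows M) (mset_set E))}"

definition T_plus :: "nat \<Rightarrow> real mat set" where
  "T_plus k = {M \<in> zero_one_mats k. num_ones M + 1 = 2 * k \<and>
     card (nonzero_rows M) + 1 = k \<and>
     card (rows_of_supp M 2) + 2 = k \<and>
     card (rows_of_supp M 3) = 1 \<and>
     (\<exists>E F1 F2. is_forest {..<k} E \<and> components {..<k} E = {F1, F2} \<and> F1 \<noteq> F2 \<and>
        incidence_rows M (rows_of_supp M 2) (mset_set E) \<and>
        (\<exists>r a b c. r \<in> rows_of_supp M 3 \<and> row_supp M r = {a, b, c} \<and>
           a \<in> F1 \<and> b \<in> F1 \<and> c \<in> F2 \<and>
           (\<exists>vs. path_betw {..<k} E a vs b \<and> even (path_length vs))))}"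

definition T_cycle :: "nat \<Rightarrow> real mat set" where
  "T_cycle k = {M \<in> zero_one_mats k. num_ones M = 2 * k \<and>
     (\<exists>E u v. is_tree {..<k} E \<and> u < k \<and> v < k \<and> odd (graph_dist {..<k} E u v) \<and>
        incidence_rows M (nonzero_rows M) (add_mset {u, v} (mset_set E)))}"

end

theory Submission
  imports Defs "HOL-Real_Asymp.Real_Asymp"
begin

text \<open>
  Fix a set \<open>S\<close> of \<open>k\<close> columns that supports a kernel vector of \<open>A\<close>; no row of \<open>A\<close> then has exactly
  one entry in \<open>S\<close>. There are two regimes.

  If \<open>k d \<le> n / 800\<close>, reveal the partners of the half-edges of \<open>S\<close> one by one. Of the \<open>\<ell>\<close> half-edges
  that land in kept rows at least half land in a row that was hit before, which costs a factor of
  order \<open>k d / n\<close> each, while each of the other \<open>k D - \<ell>\<close> half-edges costs a factor \<open>p\<close>. A union bound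
  excludes every such \<open>S\<close> with \<open>k \<ge> n p\<^sup>D D\<close>, and also every smaller one for which more than \<open>k\<close>
  half-edges repeat a row. In the surviving case the number of ones exceeds the number of non-zero
  rows by at most \<open>k\<close>, and a minimal dependency of this kind is, by linear algebra on signed paths,
  a tree, a forest with a triple row, or a tree with an extra edge.

  If \<open>k d > n / 800\<close>, some \<open>k\<close> rows already determine all equations on \<open>S\<close>, so that a kernel vector
  \<open>x\<close> can be read off from these rows. Reveal a small constant proportion of the other rows. Unless
  more than half of the half-edges of \<open>S\<close> are used up, which is exponentially unlikely, each new row
  annihilates \<open>x\<close> with conditional probability at most a universal constant below 1. For large \<open>\<gamma>\<close>
  this beats the number of choices of \<open>S\<close> and of the determining rows.

  As the union of all supports of kernel vectors is itself such a support, the second assertion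
  follows from the same exclusions, with \<open>c = 1\<close>.
\<close>

section \<open>Revealing a uniformly random permutation\<close>

text \<open>Neither regime extends to the other. A repetition costs a factor \<beta> = 2 k d / n,
  which gains nothing once k d is of order n; and a row misses a very sparse support with
  probability close to 1, so annihilation by many rows gains too little there. In the dense regime a
  further obstacle is that kernel vectors form a continuum: reading the vector off from few revealed
  rows leaves a single one to test.

  The threshold n p^D D, with D = \<gamma> d, is where the union bound over (e n / k)^k sets starts
  to converge against (p + s)^(k D), where s = 2 sqrt \<beta>. If s <= p / D, then (p + s)^D <= e
  p^D, and k >= n p^D D leaves (e^2 / D)^k. As p to the power log_p D is D, the threshold has the
  required form.

  For more than k repetitions the factor \<beta>^(k + 1) absorbs n^k and still leaves order 1/n, so
  that all sizes up to n / (800 d) are covered at once.\<close>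

definition perm_class :: "'a set \<Rightarrow> 'a set \<Rightarrow> ('a \<Rightarrow> 'a) \<Rightarrow> ('a \<Rightarrow> 'a) set" where
  "perm_class N U \<pi> = {\<tau>. \<tau> permutes N \<and> (\<forall>u \<in> U. \<tau> u = \<pi> u)}"

text \<open>Measurability with respect to the revealed values: among the permutations of
  \<open>N\<close>, such an \<open>E\<close> is a union of classes
  \<open>perm_class N U \<pi>\<close>.\<close>

definition determined_on :: "'a set \<Rightarrow> 'a set \<Rightarrow> ('a \<Rightarrow> 'a) set \<Rightarrow> bool" where
  "determined_on N U E \<longleftrightarrow>
     (\<forall>\<pi> \<tau>. \<pi> permutes N \<and> \<tau> permutes N \<and> (\<forall>u \<in> U. \<tau> u = \<pi> u) \<and> \<pi> \<in> E \<longrightarrow> \<tau> \<in> E)"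

lemma finite_perm_class: "finite N \<Longrightarrow> finite (perm_class N U \<pi>)"
  by (rule finite_subset[OF _ finite_permutations[of N]]) (auto simp: perm_class_def)

text \<open>Composition with \<open>\<pi>\<close> is a bijection from the permutations of
  \<open>N - U\<close> onto the class.\<close>

lemma card_perm_class:
  assumes "finite N" "U \<subseteq> N" "\<pi> permutes N"
  shows "card (perm_class N U \<pi>) = fact (card N - card U)"
proof -
  have fixes_U: "\<tau>' permutes (N - U)" if "\<tau>' permutes N" "\<forall>u \<in> U. \<tau>' u = u" for \<tau>'
    using that unfolding permutes_def by auto
  have "bij_betw (\<lambda>\<tau>. \<pi> \<circ> \<tau>) {\<tau>. \<tau> permutes (N - U)} (perm_class N U \<pi>)"
  proof (rule bij_betwI[where g = "\<lambda>\<tau>. inv_into UNIV \<pi> \<circ> \<tau>"], goal_cases)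
    case 1
    show ?case
    proof
      fix \<tau> assume "\<tau> \<in> {\<tau>. \<tau> permutes (N - U)}"
      then have \<tau>: "\<tau> permutes (N - U)" by simp
      then have "\<tau> permutes N" by (rule permutes_subset) auto
      then have "\<pi> \<circ> \<tau> permutes N" using assms(3) by (rule permutes_compose)
      moreover have "\<forall>u\<in>U. \<tau> u = u" using \<tau> by (auto simp: permutes_def)
      ultimately show "\<pi> \<circ> \<tau> \<in> perm_class N U \<pi>" by (auto simp: perm_class_def)
    qed
  next
    case 2
    show ?case
    proof
      fix \<tau> assume t: "\<tau> \<in> perm_class N U \<pi>"
      then have "\<tau> permutes N" by (simp add: perm_class_def)
      then have "inv_into UNIV \<pi> \<circ> \<tau> permutes N"
        using permutes_compose permutes_inv assms(3) by blast
      moreover have "\<forall>u \<in> U. (inv_into UNIV \<pi> \<circ> \<tau>) u = u"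
        using t by (auto simp: perm_class_def permutes_inverses[OF assms(3)])
      ultimately show "inv_into UNIV \<pi> \<circ> \<tau> \<in> {\<tau>. \<tau> permutes (N - U)}" using fixes_U by simp
    qed
  next
    case 3
    then show ?case by (simp add: permutes_inv_o[OF assms(3)] flip: comp_assoc)
  next
    case 4
    then show ?case by (simp add: permutes_inv_o[OF assms(3)] flip: comp_assoc)
  qed
  then have "card (perm_class N U \<pi>) = card {\<tau>. \<tau> permutes (N - U)}"
    by (simp add: bij_betw_same_card)
  also have "\<dots> = fact (card (N - U))" by (rule card_permutations) (use assms in auto)
  finally show ?thesis using assms by (simp add: card_Diff_subset finite_subset)
qed

text \<open>The law of total probability in counting form: the classes inside \<open>E\<close> are
  the possible outcomes of revealing \<open>U\<close>, and \<open>ratio\<close> bounds the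
  conditional probability of \<open>G\<close> given each of them.\<close>

lemma permutes_card_partition:
  fixes \<rho> :: real
  assumes "finite N" "determined_on N U E" "E \<subseteq> {\<pi>. \<pi> permutes N}" "\<rho> \<ge> 0"
    and ratio: "\<And>\<pi>. \<pi> \<in> E \<Longrightarrow> real (card (perm_class N U \<pi> \<inter> G)) \<le> \<rho> * card (perm_class N U \<pi>)"
  shows "real (card (E \<inter> G)) \<le> \<rho> * card E"
proof -
  define P where "P = perm_class N U ` E"
  have finE: "finite E" using assms(1,3) finite_permutations finite_subset by blast
  have sub: "perm_class N U \<pi> \<subseteq> E" if "\<pi> \<in> E" for \<pi>
    using assms(2,3) that unfolding perm_class_def determined_on_def by blast
  have self: "\<pi> \<in> perm_class N U \<pi>" if "\<pi> \<in> E" for \<pi>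
    using assms(3) that unfolding perm_class_def by blast
  have eq: "perm_class N U \<pi> = perm_class N U \<tau>" if "perm_class N U \<pi> \<inter> perm_class N U \<tau> \<noteq> {}" for \<pi> \<tau>
  proof -
    have "\<forall>u\<in>U. \<pi> u = \<tau> u" using that unfolding perm_class_def by force
    then show ?thesis unfolding perm_class_def by auto
  qed
  have un: "E = \<Union> P" using sub self unfolding P_def by blast
  have disj: "pairwise disjnt P"
    unfolding pairwise_def disjnt_def P_def using eq by (metis (no_types, lifting) imageE)
  have finP: "finite P" using finE by (simp add: P_def)
  have fin: "\<And>A. A \<in> P \<Longrightarrow> finite A" using finite_perm_class[OF assms(1)] by (auto simp: P_def)
  have "card E = (\<Sum>A\<in>P. card A)" using un disj fin by (metis card_Union_disjoint)
  moreover have "card (E \<inter> G) = (\<Sum>A\<in>P. card (A \<inter> G))"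
  proof -
    have "card (\<Union>A\<in>P. A \<inter> G) = (\<Sum>A\<in>P. card (A \<inter> G))"
    proof (rule card_UN_disjoint[OF finP])
      show "\<forall>A\<in>P. finite (A \<inter> G)" using fin by blast
      show "\<forall>A\<in>P. \<forall>B\<in>P. A \<noteq> B \<longrightarrow> A \<inter> G \<inter> (B \<inter> G) = {}"
        using disj unfolding pairwise_def disjnt_def by fast
    qed
    moreover have "E \<inter> G = (\<Union>A\<in>P. A \<inter> G)" using un by blast
    ultimately show ?thesis by simp
  qed
  moreover have "real (card (A \<inter> G)) \<le> \<rho> * card A" if "A \<in> P" for A
    using that ratio by (auto simp: P_def)
  ultimately show ?thesis
    by (simp add: sum_distrib_left sum_mono)
qed

text \<open>Prescribing the values on \<open>bs\<close> as well turns the class into one for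
  \<open>U \<union> set bs\<close>, whose size is known; a prescription that no member meets
  contributes nothing.\<close>

lemma card_perm_class_lists:
  assumes "finite N" "U \<subseteq> N" "\<pi> permutes N" "distinct bs" "set bs \<subseteq> N - U"
    and L: "L \<subseteq> {ys. length ys = length bs \<and> distinct ys \<and> set ys \<subseteq> N - \<pi> ` U}"
  shows "card {\<tau> \<in> perm_class N U \<pi>. map \<tau> bs \<in> L} \<le>
    card L * fact (card N - card U - length bs)"
proof -
  have finL: "finite L"
    by (rule finite_subset[OF L], rule finite_subset[OF _ finite_lists_length_eq[of N "length bs"]])
      (use assms in auto)
  have "{\<tau> \<in> perm_class N U \<pi>. map \<tau> bs \<in> L} = (\<Union>ys\<in>L. {\<tau> \<in> perm_class N U \<pi>. map \<tau> bs = ys})"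
    by auto
  also have "card \<dots> \<le> (\<Sum>ys\<in>L. card {\<tau> \<in> perm_class N U \<pi>. map \<tau> bs = ys})"
    by (rule card_UN_le[OF finL])
  also have "\<dots> \<le> (\<Sum>ys\<in>L. fact (card N - card U - length bs))"
  proof (rule sum_mono)
    fix ys
    show "card {\<tau> \<in> perm_class N U \<pi>. map \<tau> bs = ys} \<le> fact (card N - card U - length bs)"
    proof (cases "{\<tau> \<in> perm_class N U \<pi>. map \<tau> bs = ys} = {}")
      case True
      show ?thesis unfolding True by simp
    next
      case False
      then obtain \<tau>0 where t0: "\<tau>0 \<in> perm_class N U \<pi>" "map \<tau>0 bs = ys" by blast
      have "{\<tau> \<in> perm_class N U \<pi>. map \<tau> bs = ys} = perm_class N (U \<union> set bs) \<tau>0"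
        using t0 by (auto simp: perm_class_def)
      moreover have "card (U \<union> set bs) = card U + length bs"
        using assms(1,2,4,5) by (subst card_Un_disjoint) (auto simp: distinct_card finite_subset)
      moreover have "card (perm_class N (U \<union> set bs) \<tau>0) = fact (card N - card (U \<union> set bs))"
        by (rule card_perm_class) (use assms t0 in \<open>auto simp: perm_class_def\<close>)
      ultimately show ?thesis by simp
    qed
  qed
  finally show ?thesis by simp
qed

lemma fact_eq_card_lists:
  assumes "finite Q" "k \<le> card Q"
  shows "fact (card Q) = card {ys. length ys = k \<and> distinct ys \<and> set ys \<subseteq> Q} * fact (card Q - k)"
proof -
  have "fact (card Q) = \<Prod>{1..card Q}" by (simp add: fact_prod)
  also have "{1..card Q} = {1..card Q - k} \<union> {card Q - k + 1..card Q}" by auto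
  also have "\<Prod>\<dots> = \<Prod>{1..card Q - k} * \<Prod>{card Q - k + 1..card Q}"
    by (rule prod.union_disjoint) auto
  also have "\<Prod>{card Q - k + 1..card Q} = card {ys. length ys = k \<and> distinct ys \<and> set ys \<subseteq> Q}"
    by (rule card_lists_distinct_length_eq[symmetric]) (use assms in auto)
  finally show ?thesis by (simp add: fact_prod mult.commute)
qed

lemma permutes_reveal_list:
  fixes \<rho> :: real
  assumes "finite N" "determined_on N U E" "E \<subseteq> {\<pi>. \<pi> permutes N}" "\<rho> \<ge> 0" "U \<subseteq> N"
    and bs: "distinct bs" "set bs \<subseteq> N - U"
    and ratio: "\<And>\<pi>. \<pi> \<in> E \<Longrightarrow>
      real (card {ys \<in> L \<pi>. length ys = length bs \<and> distinct ys \<and> set ys \<subseteq> N - \<pi> ` U})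
        \<le> \<rho> * card {ys. length ys = length bs \<and> distinct ys \<and> set ys \<subseteq> N - \<pi> ` U}"
    and L: "\<And>\<pi> \<tau>. \<pi> \<in> E \<Longrightarrow> \<tau> \<in> perm_class N U \<pi> \<Longrightarrow> \<tau> \<in> G \<Longrightarrow> map \<tau> bs \<in> L \<pi>"
  shows "real (card (E \<inter> G)) \<le> \<rho> * card E"
proof (rule permutes_card_partition[OF assms(1-4)])
  fix \<pi> assume pE: "\<pi> \<in> E"
  then have p: "\<pi> permutes N" using assms(3) by blast
  let ?L = "{ys \<in> L \<pi>. length ys = length bs \<and> distinct ys \<and> set ys \<subseteq> N - \<pi> ` U}"
  let ?A = "{ys. length ys = length bs \<and> distinct ys \<and> set ys \<subseteq> N - \<pi> ` U}"
  have finU: "finite U" using assms(1,5) finite_subset by blast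
  have img: "\<pi> ` U \<subseteq> N" using assms(5) p by (metis image_mono permutes_image)
  have cardimg: "card (\<pi> ` U) = card U"
    by (rule card_image) (metis p permutes_inj inj_on_subset subset_UNIV)
  have cQ: "card (N - \<pi> ` U) = card N - card U"
    using img cardimg finU by (simp add: card_Diff_subset)
  have le: "length bs \<le> card (N - \<pi> ` U)"
  proof -
    have "length bs = card (set bs)" using bs by (simp add: distinct_card)
    also have "\<dots> \<le> card (N - U)" by (rule card_mono) (use bs assms(1) in auto)
    also have "\<dots> = card (N - \<pi> ` U)" using cQ assms(5) finU by (simp add: card_Diff_subset)
    finally show ?thesis .
  qed
  have "perm_class N U \<pi> \<inter> G \<subseteq> {\<tau> \<in> perm_class N U \<pi>. map \<tau> bs \<in> ?L}"
  proof
    fix \<tau> assume t: "\<tau> \<in> perm_class N U \<pi> \<inter> G"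
    then have tp: "\<tau> permutes N" by (simp add: perm_class_def)
    have inj: "inj \<tau>" using tp by (rule permutes_inj)
    have "\<tau> ` set bs \<subseteq> N" using tp bs by (metis Diff_subset image_mono permutes_image subset_trans)
    moreover have "\<pi> ` U = \<tau> ` U" using t by (auto simp: perm_class_def)
    moreover have "\<tau> ` set bs \<inter> \<tau> ` U = {}" using bs inj by (auto simp: inj_eq)
    ultimately have "set (map \<tau> bs) \<subseteq> N - \<pi> ` U" by auto
    moreover have "distinct (map \<tau> bs)" using bs(1) inj_on_subset[OF inj] by (simp add: distinct_map)
    ultimately show "\<tau> \<in> {\<tau> \<in> perm_class N U \<pi>. map \<tau> bs \<in> ?L}"
      using t L[OF pE, of \<tau>] by simp
  qed
  then have "card (perm_class N U \<pi> \<inter> G) \<le> card {\<tau> \<in> perm_class N U \<pi>. map \<tau> bs \<in> ?L}"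
    by (rule card_mono[rotated]) (simp add: finite_perm_class[OF assms(1)])
  also have "\<dots> \<le> card ?L * fact (card N - card U - length bs)"
    by (rule card_perm_class_lists) (use assms p in auto)
  finally have "card (perm_class N U \<pi> \<inter> G) \<le> card ?L * fact (card N - card U - length bs)" .
  from of_nat_mono[OF this, where 'a = real]
  have "real (card (perm_class N U \<pi> \<inter> G)) \<le> real (card ?L) * fact (card N - card U - length bs)"
    by (simp only: of_nat_mult of_nat_fact)
  also have "\<dots> \<le> \<rho> * card ?A * fact (card N - card U - length bs)"
    using ratio[OF pE] by (intro mult_right_mono) auto
  finally have le2: "real (card (perm_class N U \<pi> \<inter> G)) \<le> \<rho> * (real (card ?A) * fact (card N - card U - length bs))"
    by (simp only: mult.assoc)
  have "real (card ?A) * fact (card N - card U - length bs) = card (perm_class N U \<pi>)"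
  proof -
    have "fact (card (N - \<pi> ` U)) = card ?A * fact (card (N - \<pi> ` U) - length bs)"
      by (rule fact_eq_card_lists) (use assms le in auto)
    then have "card (perm_class N U \<pi>) = card ?A * fact (card N - card U - length bs)"
      using card_perm_class[OF assms(1,5) p] by (simp add: cQ)
    then show ?thesis by simp
  qed
  with le2 show "real (card (perm_class N U \<pi> \<inter> G)) \<le> \<rho> * real (card (perm_class N U \<pi>))"
    by (simp only:)
qed

lemma permutes_reveal_point:
  fixes \<rho> :: real
  assumes "finite N" "determined_on N U E" "E \<subseteq> {\<pi>. \<pi> permutes N}" "\<rho> \<ge> 0" "U \<subseteq> N" "z \<in> N - U"
    and ratio: "\<And>\<pi>. \<pi> \<in> E \<Longrightarrow> real (card (C \<pi> \<inter> N - \<pi> ` U)) \<le> \<rho> * (real (card N) - card U)"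
    and C: "\<And>\<pi> \<tau>. \<pi> \<in> E \<Longrightarrow> \<tau> \<in> perm_class N U \<pi> \<Longrightarrow> \<tau> \<in> G \<Longrightarrow> \<tau> z \<in> C \<pi>"
  shows "real (card (E \<inter> G)) \<le> \<rho> * card E"
proof (rule permutes_reveal_list[where bs = "[z]" and L = "\<lambda>\<pi>. {ys. hd ys \<in> C \<pi>}", OF assms(1-5)])
  fix \<pi> assume pE: "\<pi> \<in> E"
  then have p: "\<pi> permutes N" using assms(3) by blast
  have finU: "finite U" using assms(1,5) finite_subset by blast
  have img: "\<pi> ` U \<subseteq> N" using assms(5) p by (metis image_mono permutes_image)
  have cardimg: "card (\<pi> ` U) = card U"
    by (rule card_image) (metis p permutes_inj inj_on_subset subset_UNIV)
  have cQ: "card (N - \<pi> ` U) = card N - card U"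
    using img cardimg finU by (simp add: card_Diff_subset)
  have single: "card {ys. length ys = length [z] \<and> distinct ys \<and> set ys \<subseteq> A} = card A" for A :: "'a set"
  proof -
    have "{ys. length ys = length [z] \<and> distinct ys \<and> set ys \<subseteq> A} = (\<lambda>y. [y]) ` A"
      by (auto simp: length_Suc_conv)
    then show ?thesis by (simp add: card_image inj_on_def)
  qed
  have "{ys \<in> {ys. hd ys \<in> C \<pi>}. length ys = length [z] \<and> distinct ys \<and> set ys \<subseteq> N - \<pi> ` U} =
    {ys. length ys = length [z] \<and> distinct ys \<and> set ys \<subseteq> C \<pi> \<inter> N - \<pi> ` U}"
    by (auto simp: length_Suc_conv)
  then show "real (card {ys \<in> {ys. hd ys \<in> C \<pi>}. length ys = length [z] \<and> distinct ys \<and> set ys \<subseteq> N - \<pi> ` U})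
     \<le> \<rho> * card {ys. length ys = length [z] \<and> distinct ys \<and> set ys \<subseteq> N - \<pi> ` U}"
    using ratio[OF pE] card_mono[OF assms(1,5)] by (simp only: single cQ of_nat_diff)
qed (use assms in auto)

text \<open>Revealing the points of \<open>Z\<close> one by one uses up values in \<open>T\<close>;
  since t <= 1, the remaining proportion (|T| - |Z|) / (|N| - |Z|) is still at most t.\<close>

lemma card_permutes_into:
  fixes t :: real
  assumes "finite N" "Z \<subseteq> N" "real (card T) \<le> t * card N" "0 \<le> t" "t \<le> 1" "finite T"
  shows "real (card {\<pi>. \<pi> permutes N \<and> (\<forall>z \<in> Z. \<pi> z \<in> T)}) \<le> t ^ card Z * fact (card N)"
proof -
  have "finite Z" using assms(1,2) finite_subset by blast
  then show ?thesis using assms(2)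
  proof (induction Z rule: finite_induct)
    case empty
    then show ?case by (simp add: card_permutations assms(1))
  next
    case (insert z Z)
    let ?E = "{\<pi>. \<pi> permutes N \<and> (\<forall>z \<in> Z. \<pi> z \<in> T)}"
    have "real (card (?E \<inter> {\<pi>. \<pi> z \<in> T})) \<le> t * card ?E"
    proof (rule permutes_reveal_point[where U = Z and z = z and C = "\<lambda>_. T"])
      show "determined_on N Z ?E" unfolding determined_on_def by auto
      show "z \<in> N - Z" using insert by auto
      fix \<pi> assume p: "\<pi> \<in> ?E"
      then have "inj \<pi>" using permutes_inj by blast
      then have c: "card (\<pi> ` Z) = card Z" by (meson card_image inj_on_subset subset_UNIV)
      have "\<pi> ` Z \<subseteq> T" using p by auto
      then have le: "card Z \<le> card T" using c assms(6) by (metis card_mono)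
      have ZN: "card Z \<le> card N" by (rule card_mono) (use insert assms in auto)
      have "card (T \<inter> N - \<pi> ` Z) \<le> card (T - \<pi> ` Z)"
        by (rule card_mono) (use assms(6) in auto)
      also have "\<dots> = card T - card Z"
        using \<open>\<pi> ` Z \<subseteq> T\<close> c insert.hyps by (simp add: card_Diff_subset)
      finally have "real (card (T \<inter> N - \<pi> ` Z)) \<le> real (card T) - real (card Z)"
        using le by linarith
      also have "\<dots> \<le> t * card N - t * card Z"
        using assms(3,5) mult_right_mono[of t 1 "real (card Z)"] by simp
      finally show "real (card (T \<inter> N - \<pi> ` Z)) \<le> t * (real (card N) - card Z)"
        by (simp add: right_diff_distrib)
    qed (use assms insert in auto)
    also have "\<dots> \<le> t * (t ^ card Z * fact (card N))"
      using insert assms(4) by (intro mult_left_mono) auto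
    also have "?E \<inter> {\<pi>. \<pi> z \<in> T} = {\<pi>. \<pi> permutes N \<and> (\<forall>z \<in> insert z Z. \<pi> z \<in> T)}" by auto
    finally show ?case using insert by (simp add: mult.assoc)
  qed
qed

text \<open>After \<open>Z\<close>, the points of \<open>W\<close> are revealed in increasing order.
  A point of \<open>R\<close> must then land in one of at most \<open>card W\<close> fibres of
  \<open>r\<close>, each of size at most d, while at least \<open>card N - card Z - card W\<close>
  values are free; points of \<open>W - R\<close> are unconstrained and cost nothing.\<close>

lemma card_permutes_repeated:
  fixes t \<beta> :: real and r :: "nat \<Rightarrow> 'b"
  assumes "finite N" "Z \<subseteq> N" "real (card T) \<le> t * card N" "0 \<le> t" "t \<le> 1" "finite T"
    and W: "W \<subseteq> N - Z" "R \<subseteq> W"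
    and fib: "\<And>i. card {y \<in> N. r y = i} \<le> d"
    and \<beta>: "0 \<le> \<beta>" "real (card W) * real d \<le> \<beta> * (real (card N) - card Z - card W)"
  shows "real (card {\<pi>. \<pi> permutes N \<and> (\<forall>z \<in> Z. \<pi> z \<in> T) \<and>
      (\<forall>h \<in> R. \<exists>h' \<in> W. h' < h \<and> r (\<pi> h') = r (\<pi> h))}) \<le> t ^ card Z * \<beta> ^ card R * fact (card N)"
proof -
  define E where "E q = {\<pi>. \<pi> permutes N \<and> (\<forall>z \<in> Z. \<pi> z \<in> T) \<and>
      (\<forall>h \<in> R \<inter> {..<q}. \<exists>h' \<in> W. h' < h \<and> r (\<pi> h') = r (\<pi> h))}" for q
  have finW: "finite W" and finZ: "finite Z" using assms finite_subset by (blast, blast)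
  have finR: "finite R" using W finW finite_subset by blast
  have bound: "real (card (E q)) \<le> t ^ card Z * \<beta> ^ card (R \<inter> {..<q}) * fact (card N)" for q
  proof (induction q)
    case 0
    then show ?case using card_permutes_into[OF assms(1-6)] by (simp add: E_def)
  next
    case (Suc q)
    show ?case
    proof (cases "q \<in> R")
      case False
      then have "R \<inter> {..<Suc q} = R \<inter> {..<q}" by (auto simp: less_Suc_eq)
      then show ?thesis using Suc by (simp add: E_def)
    next
      case True
      then have ins: "R \<inter> {..<Suc q} = insert q (R \<inter> {..<q})" by (auto simp: less_Suc_eq)
      define U where "U = Z \<union> (W \<inter> {..<q})"
      let ?C = "\<lambda>\<pi>. {y \<in> N. \<exists>h' \<in> W \<inter> {..<q}. r (\<pi> h') = r y}"
      have cU: "card U \<le> card Z + card W"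
        unfolding U_def using card_Un_le[of Z "W \<inter> {..<q}"] card_mono[OF finW, of "W \<inter> {..<q}"] by simp
      have "real (card (E q \<inter> {\<pi>. \<exists>h' \<in> W. h' < q \<and> r (\<pi> h') = r (\<pi> q)})) \<le> \<beta> * card (E q)"
      proof (rule permutes_reveal_point[where U = U and z = q and C = ?C])
        show "determined_on N U (E q)"
          unfolding determined_on_def
        proof (intro allI impI, elim conjE)
          fix \<pi> \<tau> assume t: "\<tau> permutes N" "\<forall>u\<in>U. \<tau> u = \<pi> u" and p: "\<pi> \<in> E q"
          have "\<exists>h' \<in> W. h' < h \<and> r (\<tau> h') = r (\<tau> h)" if h: "h \<in> R \<inter> {..<q}" for h
          proof -
            obtain h' where h': "h' \<in> W" "h' < h" "r (\<pi> h') = r (\<pi> h)" using p h by (auto simp: E_def)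
            have "\<tau> h = \<pi> h" "\<tau> h' = \<pi> h'" using t(2) h h' W(2) by (auto simp: U_def)
            then show ?thesis using h' by auto
          qed
          moreover have "\<tau> z \<in> T" if "z \<in> Z" for z using p t(2) that by (simp add: E_def U_def)
          ultimately show "\<tau> \<in> E q" using t(1) by (simp add: E_def)
        qed
        show "q \<in> N - U" using True W by (auto simp: U_def)
        show "U \<subseteq> N" using assms(2) W by (auto simp: U_def)
        fix \<pi>
        have "?C \<pi> = (\<Union>h' \<in> W \<inter> {..<q}. {y \<in> N. r y = r (\<pi> h')})" by auto
        also have "card \<dots> \<le> (\<Sum>h' \<in> W \<inter> {..<q}. card {y \<in> N. r y = r (\<pi> h')})"
          by (rule card_UN_le) (use finW in auto)
        also have "\<dots> \<le> (\<Sum>h' \<in> W \<inter> {..<q}. d)" by (rule sum_mono) (rule fib)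
        also have "\<dots> \<le> card W * d" using card_mono[OF finW, of "W \<inter> {..<q}"] by simp
        finally have "real (card (?C \<pi>)) \<le> real (card W) * d" by (metis of_nat_le_iff of_nat_mult)
        moreover have "card (?C \<pi> \<inter> N - \<pi> ` U) \<le> card (?C \<pi>)"
          by (rule card_mono) (use assms(1) in auto)
        ultimately have "real (card (?C \<pi> \<inter> N - \<pi> ` U)) \<le> \<beta> * (real (card N) - card Z - card W)"
          using \<beta>(2) by linarith
        also have "\<dots> \<le> \<beta> * (real (card N) - card U)"
          using cU \<beta>(1) by (intro mult_left_mono) auto
        finally show "real (card (?C \<pi> \<inter> N - \<pi> ` U)) \<le> \<beta> * (real (card N) - card U)" .
      next
        fix \<pi> \<tau>
        assume t: "\<tau> \<in> perm_class N U \<pi>" "\<tau> \<in> {\<pi>. \<exists>h' \<in> W. h' < q \<and> r (\<pi> h') = r (\<pi> q)}"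
        have "\<tau> q \<in> N" using t(1) True W permutes_in_image[of \<tau> N] by (auto simp: perm_class_def)
        moreover obtain h' where "h' \<in> W" "h' < q" "r (\<tau> h') = r (\<tau> q)" using t(2) by auto
        moreover from this have "\<tau> h' = \<pi> h'" using t(1) by (simp add: perm_class_def U_def)
        ultimately show "\<tau> q \<in> ?C \<pi>" by auto
      qed (use assms in \<open>auto simp: E_def\<close>)
      also have "E q \<inter> {\<pi>. \<exists>h' \<in> W. h' < q \<and> r (\<pi> h') = r (\<pi> q)} = E (Suc q)"
        unfolding E_def ins by auto
      finally have "real (card (E (Suc q))) \<le> \<beta> * card (E q)" .
      also have "\<dots> \<le> \<beta> * (t ^ card Z * \<beta> ^ card (R \<inter> {..<q}) * fact (card N))"
        using Suc \<beta>(1) by (intro mult_left_mono)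
      also have "\<dots> = t ^ card Z * \<beta> ^ card (R \<inter> {..<Suc q}) * fact (card N)"
        unfolding ins using finR by simp
      finally show ?thesis .
    qed
  qed
  obtain q where "\<forall>h\<in>R. h < q" using finR finite_nat_set_iff_bounded by blast
  then have "R \<inter> {..<q} = R" by auto
  then show ?thesis using bound[of q] by (simp add: E_def)
qed

section \<open>Rows that annihilate a fixed vector\<close>

text \<open>Lists with repetition model independent sampling. The partners of a row are sampled
  without replacement; \<open>card_zero_row\<close> compares the two.\<close>

definition lists_of :: "'a set \<Rightarrow> nat \<Rightarrow> 'a list set" where
  "lists_of Q d = {ys. length ys = d \<and> set ys \<subseteq> Q}"

lemma finite_lists_of [simp]: "finite Q \<Longrightarrow> finite (lists_of Q d)"
  using finite_lists_length_eq[of Q d] by (simp add: lists_of_def conj_commute)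

lemma card_lists_of: "finite Q \<Longrightarrow> card (lists_of Q d) = card Q ^ d"
  using card_lists_length_eq[of Q d] by (simp add: lists_of_def conj_commute)

lemma lists_of_Suc: "{ys \<in> lists_of Q (Suc d). P ys} = (\<Union>y\<in>Q. (#) y ` {ys \<in> lists_of Q d. P (y # ys)})"
  by (auto simp: lists_of_def length_Suc_conv image_iff)

lemma card_lists_of_Suc:
  assumes "finite Q"
  shows "card {ys \<in> lists_of Q (Suc d). P ys} = (\<Sum>y\<in>Q. card {ys \<in> lists_of Q d. P (y # ys)})"
proof -
  have "card (\<Union>y\<in>Q. (#) y ` {ys \<in> lists_of Q d. P (y # ys)}) =
    (\<Sum>y\<in>Q. card ((#) y ` {ys \<in> lists_of Q d. P (y # ys)}))"
    by (rule card_UN_disjoint) (use assms in auto)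
  also have "\<dots> = (\<Sum>y\<in>Q. card {ys \<in> lists_of Q d. P (y # ys)})"
    by (intro sum.cong refl card_image) (auto simp: inj_on_def)
  finally show ?thesis by (simp only: lists_of_Suc)
qed

text \<open>
  If \<open>f y \<noteq> f z\<close>, the lists that complete \<open>y\<close> to the sum \<open>s\<close> are disjoint from those that complete
  \<open>z\<close>; averaging over all pairs \<open>(y, z)\<close> gives the induction step.
\<close>

lemma anticoncentration:
  fixes f :: "'a \<Rightarrow> real" and \<alpha> :: real
  assumes "finite Q" "Q \<noteq> {}" "0 \<le> \<alpha>"
    and fib: "\<And>v. real (card {y \<in> Q. f y = v}) \<le> \<alpha> * card Q"
  shows "2 * real (card {ys \<in> lists_of Q d. sum_list (map f ys) = s}) \<le>
    real (card Q) ^ d + (\<alpha> * card Q) ^ d"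
proof (induction d arbitrary: s)
  case 0
  have "card {ys \<in> lists_of Q 0. sum_list (map f ys) = s} \<le> card {[] :: 'a list}"
    by (rule card_mono) (auto simp: lists_of_def)
  then show ?case by simp
next
  case (Suc d)
  define n where "n s = card {ys \<in> lists_of Q d. sum_list (map f ys) = s}" for s
  let ?q = "real (card Q)"
  let ?g = "(\<alpha> * card Q) ^ d"
  have two: "real (n a) + real (n b) \<le> ?q ^ d" if "a \<noteq> b" for a b
  proof -
    have "n a + n b = card ({ys \<in> lists_of Q d. sum_list (map f ys) = a} \<union>
       {ys \<in> lists_of Q d. sum_list (map f ys) = b})"
      unfolding n_def by (rule card_Un_disjoint[symmetric]) (use that assms in auto)
    also have "\<dots> \<le> card (lists_of Q d)" by (rule card_mono) (use assms in auto)
    finally show ?thesis using card_lists_of[OF assms(1), of d]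
      by (metis of_nat_add of_nat_le_iff of_nat_power)
  qed
  have rec: "card {ys \<in> lists_of Q (Suc d). sum_list (map f ys) = s} = (\<Sum>y\<in>Q. n (s - f y))"
    unfolding n_def by (subst card_lists_of_Suc[OF assms(1)]) (simp add: algebra_simps)
  have "?q * (2 * (\<Sum>y\<in>Q. real (n (s - f y)))) =
     (\<Sum>y\<in>Q. \<Sum>z\<in>Q. real (n (s - f y)) + real (n (s - f z)))"
    by (simp add: sum.distrib sum_distrib_left mult.left_commute)
  also have "\<dots> \<le> (\<Sum>y\<in>Q. \<Sum>z\<in>Q. ?q ^ d + (if f z = f y then ?g else 0))"
  proof (intro sum_mono)
    fix y z
    show "real (n (s - f y)) + real (n (s - f z)) \<le> ?q ^ d + (if f z = f y then ?g else 0)"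
      using two[of "s - f y" "s - f z"] Suc.IH[of "s - f y"] by (auto simp: n_def)
  qed
  also have "\<dots> = (\<Sum>y\<in>Q. ?q * ?q ^ d + ?g * card {z \<in> Q. f z = f y})"
    by (intro sum.cong refl) (simp add: sum.distrib sum.If_cases assms(1) Int_def Collect_conj_eq[symmetric] conj_commute mult.commute)
  also have "\<dots> \<le> (\<Sum>y\<in>Q. ?q * ?q ^ d + ?g * (\<alpha> * ?q))"
    using fib assms(3) by (intro sum_mono add_mono mult_left_mono) auto
  also have "\<dots> = ?q * (?q ^ Suc d + (\<alpha> * ?q) ^ Suc d)"
    by (simp add: algebra_simps)
  finally have "2 * (\<Sum>y\<in>Q. real (n (s - f y))) \<le> ?q ^ Suc d + (\<alpha> * ?q) ^ Suc d"
    using assms(1,2) by (metis card_gt_0_iff mult_le_cancel_left_pos of_nat_0_less_iff)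
  then show ?case by (simp add: rec)
qed

text \<open>The hypothesis only limits the value 0, so two cases arise. If some value v has more
  than the proportion 1 - \<epsilon>/d, it is non-zero, and the lists that are constantly v have sum
  d v and fill a proportion of at least 1 - \<epsilon>. Otherwise no value dominates, and
  \<open>anticoncentration\<close> applies with \<alpha> = 1 - \<epsilon>/d.\<close>

lemma card_zero_sum_lists:
  fixes f :: "'a \<Rightarrow> real" and \<epsilon> :: real
  assumes "finite Q" "d > 0" "0 < \<epsilon>" "\<epsilon> \<le> 1 / 2"
    and zero: "real (card {y \<in> Q. f y = 0}) \<le> (1 - \<epsilon> / d) * card Q"
  shows "real (card {ys \<in> lists_of Q d. sum_list (map f ys) = 0}) \<le> (1 + exp (- \<epsilon>)) / 2 * card Q ^ d"
proof (cases "Q = {}")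
  case True
  then have "{ys \<in> lists_of Q d. sum_list (map f ys) = 0} = {}"
    using assms(2) by (auto simp: lists_of_def)
  then show ?thesis by (simp only: card.empty) (simp add: add_nonneg_nonneg)
next
  case False
  let ?q = "real (card Q)"
  have ed: "0 \<le> 1 - \<epsilon> / d" "\<epsilon> / d \<le> 1" using assms by (auto simp: field_simps)
  show ?thesis
  proof (cases "\<exists>v. real (card {y \<in> Q. f y = v}) > (1 - \<epsilon> / d) * card Q")
    case True
    then obtain v where v: "real (card {y \<in> Q. f y = v}) > (1 - \<epsilon> / d) * card Q" by blast
    then have "v \<noteq> 0" using zero by auto
    have disj: "{ys \<in> lists_of Q d. sum_list (map f ys) = 0} \<inter> lists_of {y \<in> Q. f y = v} d = {}"
    proof -
      have "sum_list (map f ys) \<noteq> 0" if "ys \<in> lists_of {y \<in> Q. f y = v} d" for ys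
      proof -
        have "map f ys = replicate d v"
          using that by (auto simp: lists_of_def intro!: replicate_eqI)
        then show ?thesis using \<open>v \<noteq> 0\<close> assms(2) by (simp add: sum_list_replicate)
      qed
      then show ?thesis by blast
    qed
    have "card {ys \<in> lists_of Q d. sum_list (map f ys) = 0} + card (lists_of {y \<in> Q. f y = v} d) =
       card ({ys \<in> lists_of Q d. sum_list (map f ys) = 0} \<union> lists_of {y \<in> Q. f y = v} d)"
      by (rule card_Un_disjoint[symmetric]) (use disj assms in auto)
    also have "\<dots> \<le> card (lists_of Q d)"
    proof (rule card_mono)
      show "{ys \<in> lists_of Q d. sum_list (map f ys) = 0} \<union> lists_of {y \<in> Q. f y = v} d \<subseteq> lists_of Q d"
        by (auto simp: lists_of_def)
    qed (simp add: assms)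
    finally have "card {ys \<in> lists_of Q d. sum_list (map f ys) = 0} + card {y \<in> Q. f y = v} ^ d \<le> card Q ^ d"
      using assms(1) by (simp add: card_lists_of)
    from of_nat_mono[OF this, where 'a = real]
    have "real (card {ys \<in> lists_of Q d. sum_list (map f ys) = 0}) \<le> ?q ^ d - real (card {y \<in> Q. f y = v}) ^ d"
      by simp
    also have "\<dots> \<le> ?q ^ d - ((1 - \<epsilon> / d) * ?q) ^ d"
      using v ed by (intro diff_left_mono power_mono) auto
    also have "\<dots> = (1 - (1 - \<epsilon> / d) ^ d) * ?q ^ d"
      by (simp only: power_mult_distrib left_diff_distrib[of 1 "(1 - \<epsilon> / d) ^ d"] mult_1)
    also have "\<dots> \<le> \<epsilon> * ?q ^ d"
    proof (rule mult_right_mono)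
      have "1 + real d * (- (\<epsilon> / d)) \<le> (1 + (- (\<epsilon> / d))) ^ d"
        by (rule Bernoulli_inequality) (use ed in auto)
      then show "1 - (1 - \<epsilon> / d) ^ d \<le> \<epsilon>" using assms(2) by simp
    qed simp
    also have "\<dots> \<le> (1 + exp (- \<epsilon>)) / 2 * ?q ^ d"
    proof (rule mult_right_mono)
      show "\<epsilon> \<le> (1 + exp (- \<epsilon>)) / 2"
      proof -
        have "1 / 2 \<le> (1 + e) / 2" if "0 < e" for e :: real using that by simp
        from order_trans[OF assms(4) this[OF exp_gt_zero]] show ?thesis .
      qed
    qed simp
    finally show ?thesis by simp
  next
    case nex: False
    have "2 * real (card {ys \<in> lists_of Q d. sum_list (map f ys) = 0}) \<le>
        ?q ^ d + ((1 - \<epsilon> / d) * ?q) ^ d"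
      by (rule anticoncentration) (use assms False ed nex in \<open>auto simp: not_less\<close>)
    also have "\<dots> = (1 + (1 - \<epsilon> / d) ^ d) * ?q ^ d"
      by (simp only: power_mult_distrib distrib_right mult_1)
    also have "\<dots> \<le> (1 + exp (- \<epsilon>)) * ?q ^ d"
    proof (intro mult_right_mono add_left_mono)
      have "(1 - \<epsilon> / d) ^ d \<le> exp (- \<epsilon> / d) ^ d"
        using exp_ge_add_one_self[of "- \<epsilon> / d"] ed by (intro power_mono) auto
      also have "\<dots> = exp (- \<epsilon>)"
        using assms(2) by (simp flip: exp_of_nat_mult)
      finally show "(1 - \<epsilon> / d) ^ d \<le> exp (- \<epsilon>)" .
    qed simp
    finally show ?thesis by simp
  qed
qed

text \<open>A birthday estimate: a new entry collides with one of at most d earlier ones, each of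
  which blocks at most c elements. The factor \<open>card Q\<close> on the left replaces a
  division.\<close>

lemma card_nondistinct_lists:
  assumes "finite Q" and fib: "\<And>v. card {y \<in> Q. g y = v} \<le> c"
  shows "card {ys \<in> lists_of Q d. \<not> distinct (map g ys)} * card Q \<le> d\<^sup>2 * c * card Q ^ d"
proof (induction d)
  case 0
  have "{ys \<in> lists_of Q 0. \<not> distinct (map g ys)} = {}" by (auto simp: lists_of_def)
  then show ?case by (simp only: card.empty)
next
  case (Suc d)
  let ?n = "card {ys \<in> lists_of Q d. \<not> distinct (map g ys)}"
  let ?M = "{ys \<in> lists_of Q (Suc d). \<not> distinct (map g (tl ys))}"
  let ?H = "(\<lambda>(ys, y). y # ys) ` (SIGMA ys:lists_of Q d. {y \<in> Q. g y \<in> g ` set ys})"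
  have "{ys \<in> lists_of Q (Suc d). \<not> distinct (map g ys)} \<subseteq> ?M \<union> ?H"
    by (auto simp: lists_of_def length_Suc_conv image_iff Bex_def)
  then have "card {ys \<in> lists_of Q (Suc d). \<not> distinct (map g ys)} \<le> card (?M \<union> ?H)"
    by (rule card_mono[rotated]) (use assms(1) in auto)
  also have "\<dots> \<le> card ?M + card ?H" by (rule card_Un_le)
  also have "card ?M = card Q * ?n"
    by (subst card_lists_of_Suc[OF assms(1)]) simp
  also have "card ?H \<le> card (SIGMA ys:lists_of Q d. {y \<in> Q. g y \<in> g ` set ys})"
    by (rule card_image_le) (use assms(1) in auto)
  also have "\<dots> = (\<Sum>ys\<in>lists_of Q d. card {y \<in> Q. g y \<in> g ` set ys})"
    by (rule card_SigmaI) (use assms(1) in auto)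
  also have "\<dots> \<le> (\<Sum>ys\<in>lists_of Q d. d * c)"
  proof (rule sum_mono)
    fix ys assume ys: "ys \<in> lists_of Q d"
    have "{y \<in> Q. g y \<in> g ` set ys} = (\<Union>v\<in>g ` set ys. {y \<in> Q. g y = v})" by auto
    also have "card \<dots> \<le> (\<Sum>v\<in>g ` set ys. card {y \<in> Q. g y = v})"
      by (rule card_UN_le) auto
    also have "\<dots> \<le> (\<Sum>v\<in>g ` set ys. c)" by (rule sum_mono) (rule fib)
    also have "\<dots> \<le> d * c"
      using card_image_le[of "set ys" g] card_length[of ys] ys by (simp add: lists_of_def)
    finally show "card {y \<in> Q. g y \<in> g ` set ys} \<le> d * c" .
  qed
  also have "\<dots> = card Q ^ d * (d * c)" by (simp add: card_lists_of[OF assms(1)])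
  finally have le: "card {ys \<in> lists_of Q (Suc d). \<not> distinct (map g ys)} \<le> card Q * ?n + card Q ^ d * (d * c)"
    by simp
  have "card {ys \<in> lists_of Q (Suc d). \<not> distinct (map g ys)} * card Q \<le>
     (card Q * ?n + card Q ^ d * (d * c)) * card Q" using le by (rule mult_right_mono) simp
  also have "\<dots> = card Q * (?n * card Q) + card Q ^ Suc d * (d * c)" by (simp add: algebra_simps)
  also have "\<dots> \<le> card Q * (d\<^sup>2 * c * card Q ^ d) + card Q ^ Suc d * (d * c)"
    using Suc by (intro add_right_mono mult_left_mono) auto
  also have "\<dots> = (d\<^sup>2 + d) * c * card Q ^ Suc d" by (simp add: algebra_simps)
  also have "\<dots> \<le> (Suc d)\<^sup>2 * c * card Q ^ Suc d"
    by (intro mult_right_mono) (auto simp: power2_eq_square)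
  finally show ?case .
qed

text \<open>Two defects separate a row from d independent samples: a column hit twice counts only
  once, and half-edges are not reused. Both are birthday collisions, of proportion at most (1 -
  \<rho>)/4 each, and are absorbed by weakening \<open>\<rho>\<close> to
  \<open>(1 + \<rho>) / 2\<close>.\<close>

lemma card_zero_row:
  fixes x :: "'b \<Rightarrow> real" and g :: "'a \<Rightarrow> 'b" and \<epsilon> \<rho> :: real
  defines "\<rho> \<equiv> (1 + exp (- \<epsilon>)) / 2"
  assumes "finite Q" "d > 0" "0 < \<epsilon>" "\<epsilon> \<le> 1 / 2"
    and zero: "real (card {y \<in> Q. x (g y) = 0}) \<le> (1 - \<epsilon> / d) * card Q"
    and fib: "\<And>v. card {y \<in> Q. g y = v} \<le> c" "c > 0"
    and large: "4 * (real d)\<^sup>2 * c \<le> (1 - \<rho>) * card Q"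
  shows "real (card {ys \<in> {ys. (\<Sum>j \<in> g ` set ys. x j) = 0}. length ys = d \<and> distinct ys \<and> set ys \<subseteq> Q})
    \<le> (1 + \<rho>) / 2 * card {ys. length ys = d \<and> distinct ys \<and> set ys \<subseteq> Q}"
proof -
  let ?q = "real (card Q)"
  let ?D = "{ys. length ys = d \<and> distinct ys \<and> set ys \<subseteq> Q}"
  have \<rho>: "0 < \<rho>" "\<rho> < 1" using assms(4) by (auto simp: \<rho>_def add_pos_pos)
  have q: "?q > 0"
  proof (rule ccontr)
    assume "\<not> ?q > 0"
    then have "card Q = 0" by simp
    with large fib(2) assms(3) show False by (simp add: mult_le_0_iff)
  qed
  define \<delta> where "\<delta> = (1 - \<rho>) / 4"
  \<comment> \<open>Used for \<open>g\<close>, where a collision is a double column, and for the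
    identity, where it is a reused half-edge.\<close>
  have nd: "real (card {ys \<in> lists_of Q d. \<not> distinct (map h ys)}) \<le> \<delta> * ?q ^ d"
    if h: "\<And>v. card {y \<in> Q. h y = v} \<le> c" for h :: "'a \<Rightarrow> 'd"
  proof -
    have "real (card {ys \<in> lists_of Q d. \<not> distinct (map h ys)} * card Q) \<le> real (d\<^sup>2 * c * card Q ^ d)"
      by (rule of_nat_mono, rule card_nondistinct_lists) (use assms(2) h in auto)
    then have "real (card {ys \<in> lists_of Q d. \<not> distinct (map h ys)}) * ?q \<le> ((real d)\<^sup>2 * c) * ?q ^ d"
      by simp
    also have "\<dots> \<le> (\<delta> * ?q) * ?q ^ d"
      using large by (intro mult_right_mono) (auto simp: \<delta>_def)
    finally have "?q * real (card {ys \<in> lists_of Q d. \<not> distinct (map h ys)}) \<le> ?q * (\<delta> * ?q ^ d)"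
      by (simp only: mult_ac)
    then show ?thesis using q by (simp only: mult_le_cancel_left_pos)
  qed
  have "{ys \<in> {ys. (\<Sum>j \<in> g ` set ys. x j) = 0}. length ys = d \<and> distinct ys \<and> set ys \<subseteq> Q} \<subseteq>
     {ys \<in> lists_of Q d. sum_list (map (x \<circ> g) ys) = 0} \<union> {ys \<in> lists_of Q d. \<not> distinct (map g ys)}"
  proof
    fix ys assume ys: "ys \<in> {ys \<in> {ys. (\<Sum>j \<in> g ` set ys. x j) = 0}. length ys = d \<and> distinct ys \<and> set ys \<subseteq> Q}"
    then have l: "ys \<in> lists_of Q d" by (simp add: lists_of_def)
    show "ys \<in> {ys \<in> lists_of Q d. sum_list (map (x \<circ> g) ys) = 0} \<union> {ys \<in> lists_of Q d. \<not> distinct (map g ys)}"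
    proof (cases "distinct (map g ys)")
      case True
      have "sum_list (map (x \<circ> g) ys) = sum_list (map x (map g ys))" by simp
      also have "\<dots> = (\<Sum>j \<in> set (map g ys). x j)"
        using True by (rule sum_list_distinct_conv_sum_set)
      finally show ?thesis using ys l by simp
    qed (use l in simp)
  qed
  then have "card {ys \<in> {ys. (\<Sum>j \<in> g ` set ys. x j) = 0}. length ys = d \<and> distinct ys \<and> set ys \<subseteq> Q} \<le>
     card ({ys \<in> lists_of Q d. sum_list (map (x \<circ> g) ys) = 0} \<union> {ys \<in> lists_of Q d. \<not> distinct (map g ys)})"
    by (rule card_mono[rotated]) (use assms(2) in auto)
  also have "\<dots> \<le> card {ys \<in> lists_of Q d. sum_list (map (x \<circ> g) ys) = 0} +
     card {ys \<in> lists_of Q d. \<not> distinct (map g ys)}" by (rule card_Un_le)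
  finally have "real (card {ys \<in> {ys. (\<Sum>j \<in> g ` set ys. x j) = 0}. length ys = d \<and> distinct ys \<and> set ys \<subseteq> Q}) \<le>
     real (card {ys \<in> lists_of Q d. sum_list (map (x \<circ> g) ys) = 0}) +
     real (card {ys \<in> lists_of Q d. \<not> distinct (map g ys)})" by linarith
  also have "\<dots> \<le> \<rho> * ?q ^ d + \<delta> * ?q ^ d"
    unfolding \<rho>_def using nd[OF fib(1)] card_zero_sum_lists[OF assms(2-5), of "x \<circ> g"] zero
    by (intro add_mono) auto
  also have "\<dots> = (\<rho> + \<delta>) * ?q ^ d" by (simp add: algebra_simps)
  also have "\<dots> \<le> ((1 + \<rho>) / 2 * (1 - \<delta>)) * ?q ^ d"
  proof (rule mult_right_mono)
    \<comment> \<open>The right side of the goal exceeds the left side by (1 - \<rho>)^2 /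
      8.\<close>
    have "(1 + \<rho>) * (1 - \<rho>) \<ge> 0" "(1 - \<rho>) * (1 - \<rho>) \<ge> 0" using \<rho> by auto
    then show "\<rho> + \<delta> \<le> (1 + \<rho>) / 2 * (1 - \<delta>)"
      unfolding \<delta>_def using \<rho> by (simp add: field_simps)
  qed simp
  also have "\<dots> = (1 + \<rho>) / 2 * (?q ^ d - \<delta> * ?q ^ d)"
    by (simp only: left_diff_distrib mult_1 mult.assoc)
  also have "\<dots> \<le> (1 + \<rho>) / 2 * card ?D"
  proof (rule mult_left_mono)
    have one: "card {y \<in> Q. y = v} \<le> c" for v
    proof -
      have "card {y \<in> Q. y = v} \<le> card {v}" by (rule card_mono) auto
      then show ?thesis using fib(2) by simp
    qed
    have "lists_of Q d = ?D \<union> {ys \<in> lists_of Q d. \<not> distinct (map (\<lambda>y. y) ys)}"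
      by (auto simp: lists_of_def)
    then have "card (lists_of Q d) = card (?D \<union> {ys \<in> lists_of Q d. \<not> distinct (map (\<lambda>y. y) ys)})"
      by (rule arg_cong)
    also have "\<dots> \<le> card ?D + card {ys \<in> lists_of Q d. \<not> distinct (map (\<lambda>y. y) ys)}"
      by (rule card_Un_le)
    finally have "card Q ^ d \<le> card ?D + card {ys \<in> lists_of Q d. \<not> distinct (map (\<lambda>y. y) ys)}"
      by (simp only: card_lists_of[OF assms(2)])
    from of_nat_mono[OF this, where 'a = real]
    have "?q ^ d \<le> real (card ?D) + real (card {ys \<in> lists_of Q d. \<not> distinct (map (\<lambda>y. y) ys)})"
      by (simp only: of_nat_add of_nat_power)
    then show "?q ^ d - \<delta> * ?q ^ d \<le> card ?D" using nd[of "\<lambda>y. y", OF one] by linarith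
  qed (use \<rho> in simp)
  finally show ?thesis .
qed

section \<open>Homogeneous linear systems\<close>

text \<open>Gaussian elimination, one column at a time: a pivot row with a non-zero entry in column
  \<open>s\<close> eliminates that column from the others, so at most one row is spent per
  column.\<close>

lemma row_basis_exists:
  fixes a :: "'r \<Rightarrow> 'b \<Rightarrow> real"
  assumes "finite S"
  shows "\<exists>I \<subseteq> R. finite I \<and> card I \<le> card S \<and>
    (\<forall>y. (\<forall>i \<in> I. (\<Sum>j\<in>S. a i j * y j) = 0) \<longrightarrow> (\<forall>i \<in> R. (\<Sum>j\<in>S. a i j * y j) = 0))"
  using assms
proof (induction S arbitrary: a rule: finite_induct)
  case empty
  show ?case by (rule exI[of _ "{}"]) simp
next
  case (insert s S)
  show ?case
  proof (cases "\<forall>i \<in> R. a i s = 0")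
    case True
    obtain I where I: "I \<subseteq> R" "finite I" "card I \<le> card S"
      "\<And>y. \<forall>i \<in> I. (\<Sum>j\<in>S. a i j * y j) = 0 \<Longrightarrow> \<forall>i \<in> R. (\<Sum>j\<in>S. a i j * y j) = 0"
      using insert.IH[of a] by auto
    have "(\<Sum>j\<in>insert s S. a i j * y j) = (\<Sum>j\<in>S. a i j * y j)" if "i \<in> R" for i and y :: "'b \<Rightarrow> real"
      using that True insert.hyps by simp
    moreover have "card I \<le> card (insert s S)" using I(3) insert.hyps by simp
    ultimately show ?thesis using I(1,2,4) by (intro exI[of _ I]) (simp add: subset_iff)
  next
    case False
    then obtain p where p: "p \<in> R" "a p s \<noteq> 0" by blast
    define b where "b i j = a i j - a i s / a p s * a p j" for i j
    obtain I where I: "I \<subseteq> R" "finite I" "card I \<le> card S"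
      "\<And>y. \<forall>i \<in> I. (\<Sum>j\<in>S. b i j * y j) = 0 \<Longrightarrow> \<forall>i \<in> R. (\<Sum>j\<in>S. b i j * y j) = 0"
      using insert.IH[of b] by auto
    have b: "(\<Sum>j\<in>S. b i j * y j) =
        (\<Sum>j\<in>insert s S. a i j * y j) - a i s / a p s * (\<Sum>j\<in>insert s S. a p j * y j)"
      for i and y :: "'b \<Rightarrow> real"
      using insert.hyps p
      by (simp add: b_def left_diff_distrib sum_subtractf sum_distrib_left distrib_left mult.assoc)
    show ?thesis
    proof (intro exI[of _ "insert p I"] conjI allI impI)
      show "card (insert p I) \<le> card (insert s S)"
        using insert.hyps I(2,3) card_insert_le_m1 by (simp add: card_insert_if)
    next
      fix y assume y: "\<forall>i \<in> insert p I. (\<Sum>j\<in>insert s S. a i j * y j) = 0"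
      then have "\<forall>i \<in> I. (\<Sum>j\<in>S. b i j * y j) = 0" by (subst b) simp
      then have "\<forall>i \<in> R. (\<Sum>j\<in>S. b i j * y j) = 0" by (rule I(4))
      then show "\<forall>i \<in> R. (\<Sum>j\<in>insert s S. a i j * y j) = 0" using y by (subst (asm) b) simp
    qed (use I p in auto)
  qed
qed

text \<open>The same elimination, where each column uses up at most one equation, so that some
  unknown is left free.\<close>

lemma nontrivial_solution_exists:
  fixes a :: "'r \<Rightarrow> 'b \<Rightarrow> real"
  assumes "finite S" "finite R" "card R < card S"
  shows "\<exists>y. (\<exists>j \<in> S. y j \<noteq> 0) \<and> (\<forall>i \<in> R. (\<Sum>j\<in>S. a i j * y j) = 0)"
  using assms
proof (induction S arbitrary: a R rule: finite_induct)
  case empty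
  then show ?case by simp
next
  case (insert s S)
  show ?case
  proof (cases "\<forall>i \<in> R. a i s = 0")
    case True
    then show ?thesis using insert.hyps
      by (intro exI[of _ "\<lambda>j. if j = s then 1 else 0"]) (auto intro!: sum.neutral)
  next
    case False
    then obtain p where p: "p \<in> R" "a p s \<noteq> 0" by blast
    define b where "b i j = a i j - a i s / a p s * a p j" for i j
    have "card (R - {p}) < card S" using insert.prems insert.hyps card_Suc_Diff1[OF insert.prems(1) p(1)] by simp
    then obtain y where y: "\<exists>j \<in> S. y j \<noteq> 0" "\<forall>i \<in> R - {p}. (\<Sum>j\<in>S. b i j * y j) = 0"
      using insert.IH[of "R - {p}" b] insert.prems by auto
    \<comment> \<open>Back substitution: the entry at \<open>s\<close> is chosen so that the pivot
      row holds.\<close>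
    define z where "z j = (if j = s then - (\<Sum>j\<in>S. a p j * y j) / a p s else y j)" for j
    have zS: "(\<Sum>j\<in>S. c j * z j) = (\<Sum>j\<in>S. c j * y j)" for c
      by (rule sum.cong) (use insert.hyps in \<open>auto simp: z_def\<close>)
    have p0: "(\<Sum>j\<in>insert s S. a p j * z j) = 0"
      using insert.hyps p by (simp add: zS) (simp add: z_def)
    have "(\<Sum>j\<in>insert s S. a i j * z j) = 0" if "i \<in> R" for i
    proof (cases "i = p")
      case False
      have "0 = (\<Sum>j\<in>S. b i j * y j)" using y(2) that False by simp
      also have "\<dots> = (\<Sum>j\<in>insert s S. a i j * z j)"
        using insert.hyps p
        by (simp add: zS, simp add: b_def z_def left_diff_distrib sum_subtractf sum_distrib_left mult.assoc sum_divide_distrib)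
      finally show ?thesis by simp
    qed (use p0 in simp)
    moreover have "\<exists>j \<in> insert s S. z j \<noteq> 0" using y(1) insert.hyps by (auto simp: z_def)
    ultimately show ?thesis by blast
  qed
qed

section \<open>Kernels of matrices and uniqueness of the dependency\<close>

lemma mat_kernel_iff:
  fixes A :: "real mat"
  shows "v \<in> mat_kernel A \<longleftrightarrow> dim_vec v = dim_col A \<and>
    (\<forall>i < dim_row A. (\<Sum>j<dim_col A. A $$ (i, j) * v $ j) = 0)"
proof -
  have "v \<in> mat_kernel A \<longleftrightarrow> v \<in> carrier_vec (dim_col A) \<and> A *\<^sub>v v = 0\<^sub>v (dim_row A)"
    by (simp add: mat_kernel_def)
  also have "\<dots> \<longleftrightarrow> dim_vec v = dim_col A \<and>
    (\<forall>i < dim_row A. (\<Sum>j<dim_col A. A $$ (i, j) * v $ j) = 0)"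
    by (auto simp: vec_eq_iff scalar_prod_def atLeast0LessThan intro!: carrier_vecI)
  finally show ?thesis .
qed

text \<open>Rank k - 1 gives k - 1 linearly independent columns. A kernel vector that vanishes at
  the index \<open>j0\<close> left over is a relation among these, hence zero; subtracting a
  suitable multiple of \<open>x\<close> reduces every kernel vector to this case.\<close>

lemma minimal_dependency_unique:
  assumes "minimal_dependency M"
  obtains x :: "nat \<Rightarrow> real" where
    "dim_col M > 0" "\<And>j. j < dim_col M \<Longrightarrow> x j \<noteq> 0"
    "\<And>i. i < dim_row M \<Longrightarrow> (\<Sum>j<dim_col M. M $$ (i, j) * x j) = 0"
    "\<And>y. (\<And>i. i < dim_row M \<Longrightarrow> (\<Sum>j<dim_col M. M $$ (i, j) * y j) = 0) \<Longrightarrow>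
       \<exists>c. \<forall>j < dim_col M. y j = c * x j"
proof -
  let ?k = "dim_col M" and ?r = "dim_row M"
  interpret vec_space "TYPE(real)" ?r .
  obtain v where v: "v \<in> mat_kernel M" "supp_vec v = {..<?k}" and rk: "rank M + 1 = ?k"
    using assms by (auto simp: minimal_dependency_def)
  define x where "x j = v $ j" for j
  have dimv: "dim_vec v = ?k" using v(1) by (simp add: mat_kernel_iff)
  have M: "M \<in> carrier_mat ?r ?k" by simp
  have x1: "x j \<noteq> 0" if "j < ?k" for j
    using v(2) that by (auto simp: supp_vec_def x_def)
  have x2: "(\<Sum>j<?k. M $$ (i, j) * x j) = 0" if "i < ?r" for i
    using v(1) that by (simp add: mat_kernel_iff x_def)
  obtain B where B: "maximal B (\<lambda>T. T \<subseteq> set (cols M) \<and> lin_indpt T)"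
    using maximal_exists_superset[of "set (cols M)" "\<lambda>T. T \<subseteq> set (cols M) \<and> lin_indpt T" "{}"]
    by (meson List.finite_set empty_subsetI finite_lin_indpt2 finite.emptyI empty_iff)
  then have cB: "card B + 1 = ?k" using rank_card_indpt[OF M B] rk by simp
  have B1: "B \<subseteq> set (cols M)" "lin_indpt B" using B by (auto simp: maximal_def)
  have "B \<subseteq> col M ` {..<?k}" using B1(1) by (auto simp: cols_def)
  \<comment> \<open>\<open>B\<close> is a set of vectors and does not see repeated columns;
    \<open>T\<close> selects one index for each of its members.\<close>
  then obtain T where T: "T \<subseteq> {..<?k}" "inj_on (col M) T" "col M ` T = B"
    unfolding subset_image_inj by blast
  have finT: "finite T" using T(1) finite_subset by blast
  have cT: "card T + 1 = ?k" using cB T by (metis card_image)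
  obtain j0 where j0: "j0 < ?k" "{..<?k} = insert j0 T" "j0 \<notin> T"
  proof -
    have "card ({..<?k} - T) = 1" using cT T(1) finT by (simp add: card_Diff_subset)
    then obtain j where "{..<?k} - T = {j}" using card_1_singletonE by blast
    then show ?thesis using T(1) that[of j] by auto
  qed
  have uniq0: "y j = 0" if y: "\<And>i. i < ?r \<Longrightarrow> (\<Sum>j<?k. M $$ (i, j) * y j) = 0" "y j0 = 0" and j: "j < ?k" for y :: "nat \<Rightarrow> real" and j
  proof -
    define g where "g = (\<lambda>w. y (the_inv_into T (col M) w))"
    have g: "g (col M j) = y j" if "j \<in> T" for j
      unfolding g_def using T(2) that by (simp add: the_inv_into_f_f)
    have Bc: "B \<subseteq> carrier_vec ?r" using T(3) by auto
    have "lincomb g B = 0\<^sub>v ?r"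
    proof (rule eq_vecI)
      fix i assume "i < dim_vec (0\<^sub>v ?r :: real vec)"
      then have i: "i < ?r" by simp
      have "lincomb g B $ i = (\<Sum>w\<in>B. g w * w $ i)" by (rule lincomb_index[OF i Bc])
      also have "\<dots> = (\<Sum>j\<in>T. g (col M j) * col M j $ i)"
        unfolding T(3)[symmetric] using T(2) by (simp add: sum.reindex)
      also have "\<dots> = (\<Sum>j\<in>T. M $$ (i, j) * y j)"
        by (rule sum.cong) (use g i T(1) in auto)
      also have "\<dots> = (\<Sum>j<?k. M $$ (i, j) * y j)" using j0 finT y(2) by simp
      also have "\<dots> = 0" by (rule y(1)[OF i])
      finally show "lincomb g B $ i = 0\<^sub>v ?r $ i" using i by simp
    next
      show "dim_vec (lincomb g B) = dim_vec (0\<^sub>v ?r)"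
        using lincomb_dim[of B g] Bc finT T(3) by auto
    qed
    moreover have "finite B" using finT T(3) by blast
    ultimately have "\<forall>w\<in>B. g w = 0"
      using B1(2) lin_dep_crit[of B B _ g] by (auto simp: class_ring_simps)
    then have "y w = 0" if "w \<in> T" for w using g that T(3) by force
    moreover have "j \<in> insert j0 T" using j unfolding j0(2)[symmetric] by simp
    ultimately show "y j = 0" using y(2) by auto
  qed
  show ?thesis
  proof (rule that[of x])
    fix y :: "nat \<Rightarrow> real" assume y: "\<And>i. i < ?r \<Longrightarrow> (\<Sum>j<?k. M $$ (i, j) * y j) = 0"
    define c where "c = y j0 / x j0"
    define z where "z = (\<lambda>j. y j - c * x j)"
    have "z j = 0" if "j < ?k" for j
    proof (rule uniq0)
      fix i assume i: "i < ?r"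
      have "(\<Sum>j<?k. M $$ (i, j) * (y j - c * x j)) =
        (\<Sum>j<?k. M $$ (i, j) * y j) - c * (\<Sum>j<?k. M $$ (i, j) * x j)"
        by (simp add: right_diff_distrib sum_subtractf sum_distrib_left mult_ac)
      then show "(\<Sum>j<?k. M $$ (i, j) * z j) = 0" using x2[OF i] y[OF i] by (simp add: z_def)
    next
      show "z j0 = 0" using x1[OF j0(1)] by (simp add: c_def z_def)
    qed (rule that)
    then show "\<exists>c. \<forall>j < ?k. y j = c * x j" by (intro exI[of _ c]) (auto simp: z_def)
  qed (use rk x1 x2 in auto)
qed

section \<open>Minimal dependencies with few ones\<close>

lemma path_betw_refl: "u \<in> V \<Longrightarrow> path_betw V E u [u] u"
  by (simp add: path_betw_def)

text \<open>Paths have distinct vertices, so if \<open>w\<close> already lies on the path, the path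
  is cut off at \<open>w\<close> instead of prolonged.\<close>

lemma path_betw_extend:
  assumes "path_betw V E u vs v" "{v, w} \<in> E" "w \<in> V"
  shows "\<exists>ws. path_betw V E u ws w"
proof (cases "w \<in> set vs")
  case False
  with assms show ?thesis
    by (intro exI[of _ "vs @ [w]"]) (auto simp: path_betw_def successively_append_iff)
next
  case True
  then obtain as bs where vs: "vs = as @ w # bs" by (meson split_list)
  have "vs = (as @ [w]) @ bs" by (simp add: vs)
  then have "successively (\<lambda>x y. {x, y} \<in> E) (as @ [w])"
    using assms(1) unfolding path_betw_def by (metis successively_append_iff)
  moreover have "hd (as @ [w]) = u" using assms(1) vs by (cases as) (auto simp: path_betw_def)
  ultimately show ?thesis using assms(1)
    by (intro exI[of _ "as @ [w]"]) (auto simp: path_betw_def vs)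
qed

lemma successively_alternating:
  fixes y :: "'a \<Rightarrow> real"
  assumes "successively (\<lambda>a b. y a + y b = 0) vs" "vs \<noteq> []"
  shows "y (last vs) = (- 1) ^ (length vs - 1) * y (hd vs)"
  using assms
proof (induction vs rule: rev_induct)
  case (snoc v vs)
  show ?case
  proof (cases "vs = []")
    case False
    then have "y (last vs) + y v = 0" "y (last vs) = (- 1) ^ (length vs - 1) * y (hd vs)"
      using snoc by (auto simp: successively_append_iff)
    moreover have "length vs = Suc (length vs - 1)" using False by simp
    ultimately have "y v = (- 1) ^ length vs * y (hd vs)"
      by (metis add.inverse_unique minus_mult_left mult_minus1 power_Suc add.commute)
    then show ?thesis using False by simp
  qed simp
qed simp

lemma path_betw_alternating:
  fixes y :: "'a \<Rightarrow> real"
  assumes "path_betw V E u vs v" "\<And>a b. {a, b} \<in> E \<Longrightarrow> y a + y b = 0"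
  shows "y v = (- 1) ^ path_length vs * y u"
proof -
  have "successively (\<lambda>a b. y a + y b = 0) vs"
    using assms by (auto simp: path_betw_def intro: successively_mono)
  then show ?thesis using successively_alternating[of y vs] assms(1) by (auto simp: path_betw_def)
qed

text \<open>Alternation of \<open>x\<close> around the cycle, with
  \<open>x (hd vs) \<noteq> 0\<close>, forces its length to be even. On an even cycle the equations
  of the other edges make \<open>y\<close> alternate, and the equation of the closing edge
  follows.\<close>

lemma cycle_edge_redundant:
  fixes x y :: "'a \<Rightarrow> real"
  assumes "graph_cycle E vs"
    and x: "\<And>a b. {a, b} \<in> E \<Longrightarrow> x a + x b = 0" "x (hd vs) \<noteq> 0"
    and y: "\<And>a b. {a, b} \<in> E - {{last vs, hd vs}} \<Longrightarrow> y a + y b = 0"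
  shows "y (last vs) + y (hd vs) = 0"
proof -
  have vs: "length vs \<ge> 3" "distinct vs" "successively (\<lambda>a b. {a, b} \<in> E) vs" "{last vs, hd vs} \<in> E"
    using assms(1) by (auto simp: graph_cycle_def)
  have ne: "vs \<noteq> []" using vs(1) by auto
  have "successively (\<lambda>a b. x a + x b = 0) vs"
    by (rule successively_mono[OF vs(3)]) (rule x(1))
  then have "x (last vs) = (- 1) ^ (length vs - 1) * x (hd vs)"
    using ne by (rule successively_alternating)
  moreover have "x (last vs) + x (hd vs) = 0" by (rule x(1)[OF vs(4)])
  ultimately have "((- 1) ^ (length vs - 1) + 1) * x (hd vs) = 0" by (simp add: algebra_simps)
  then have sign: "(- 1 :: real) ^ (length vs - 1) = - 1" using x(2) by simp
  have "successively (\<lambda>a b. y a + y b = 0) vs"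
    unfolding successively_conv_nth
  proof (intro allI impI)
    fix i assume i: "Suc i < length vs"
    \<comment> \<open>Distinct vertices and length at least 3 keep the closing edge from recurring
      along the path.\<close>
    have "{vs ! i, vs ! Suc i} \<noteq> {last vs, hd vs}"
    proof
      assume "{vs ! i, vs ! Suc i} = {last vs, hd vs}"
      then have "vs ! i = last vs \<and> vs ! Suc i = hd vs \<or> vs ! i = hd vs \<and> vs ! Suc i = last vs"
        by (auto simp: doubleton_eq_iff)
      moreover have "last vs = vs ! (length vs - 1)" "hd vs = vs ! 0"
        using ne by (simp_all add: last_conv_nth hd_conv_nth)
      ultimately have "i = length vs - 1 \<and> Suc i = 0 \<or> i = 0 \<and> Suc i = length vs - 1"
        using i ne nth_eq_iff_index_eq[OF vs(2), of i "length vs - 1"]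
          nth_eq_iff_index_eq[OF vs(2), of "Suc i" 0] nth_eq_iff_index_eq[OF vs(2), of i 0]
          nth_eq_iff_index_eq[OF vs(2), of "Suc i" "length vs - 1"] by auto
      then show False using vs(1) by auto
    qed
    then show "y (vs ! i) + y (vs ! Suc i) = 0"
      using vs(3) i by (intro y) (auto simp: successively_conv_nth)
  qed
  then have "y (last vs) = (- 1) ^ (length vs - 1) * y (hd vs)"
    using ne by (rule successively_alternating)
  then show ?thesis unfolding sign by simp
qed

definition reach :: "'a set \<Rightarrow> 'a set set \<Rightarrow> 'a \<Rightarrow> 'a set" where
  "reach V E u = {v \<in> V. \<exists>vs. path_betw V E u vs v}"

lemma components_eq_reach: "components V E = reach V E ` V"
  by (simp add: components_def reach_def)

lemma reach_refl: "u \<in> V \<Longrightarrow> u \<in> reach V E u"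
  using path_betw_refl by (fastforce simp: reach_def)

lemma reach_closed:
  assumes "{v, w} \<in> E" "v \<in> V" "w \<in> V"
  shows "v \<in> reach V E u \<longleftrightarrow> w \<in> reach V E u"
  using assms path_betw_extend[of V E u] by (fastforce simp: reach_def insert_commute)

text \<open>Symmetry and transitivity are obtained without reversing or concatenating paths: by
  \<open>inv\<close>, both ends of a walk lie in a given class or neither does.\<close>

lemma reach_eq:
  assumes "simple_graph V E" "v \<in> reach V E u"
  shows "reach V E v = reach V E u"
proof -
  have inv: "set ws \<subseteq> V \<Longrightarrow> successively (\<lambda>a b. {a, b} \<in> E) ws \<Longrightarrow> ws \<noteq> [] \<Longrightarrow>
    hd ws \<in> reach V E t \<longleftrightarrow> last ws \<in> reach V E t" for ws t
  proof (induction ws)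
    case (Cons w ws)
    then show ?case using reach_closed[of w "hd ws" E V t] by (cases ws) auto
  qed simp
  have *: "z \<in> reach V E t" if zs: "z \<in> reach V E s" "s \<in> reach V E t" for z s t
  proof -
    obtain ws where "path_betw V E s ws z" using zs(1) by (auto simp: reach_def)
    then show ?thesis using inv[of ws t] zs(2) by (simp add: path_betw_def)
  qed
  obtain vs where vs: "path_betw V E u vs v" using assms(2) by (auto simp: reach_def)
  have uV: "u \<in> V" using vs by (auto simp: path_betw_def)
  have "u \<in> reach V E v"
  proof -
    have "v \<in> V" using assms(2) by (simp add: reach_def)
    then have "v \<in> reach V E v" by (rule reach_refl)
    then show ?thesis using inv[of vs v] vs by (auto simp: path_betw_def)
  qed
  then show ?thesis using * assms(2) by blast
qed

text \<open>The sets \<open>s i\<close> are the supports of the rows of a 0/1 matrix with \<open>k\<close> columns.\<close>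

locale unique_dependency =
  fixes k :: nat and R :: "nat set" and s :: "nat \<Rightarrow> nat set" and x :: "nat \<Rightarrow> real"
  assumes fin: "finite R" and pos: "k > 0"
    and sub: "i \<in> R \<Longrightarrow> s i \<subseteq> {..<k}"
    and nz: "j < k \<Longrightarrow> x j \<noteq> 0"
    and sol: "i \<in> R \<Longrightarrow> sum x (s i) = 0"
    and unique: "(\<And>i. i \<in> R \<Longrightarrow> sum y (s i) = 0) \<Longrightarrow> \<exists>c. \<forall>j < k. y j = c * x j"
begin

lemma sum_conv:
  fixes y :: "nat \<Rightarrow> real"
  assumes "i \<in> R" "S \<subseteq> {..<k}" "\<And>j. j < k \<Longrightarrow> j \<notin> S \<Longrightarrow> y j = 0"
  shows "sum y (s i) = (\<Sum>j\<in>S. (if j \<in> s i then 1 else 0) * y j)"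
proof -
  have "finite S" using assms(2) finite_subset by blast
  have "(\<Sum>j\<in>S. (if j \<in> s i then 1 else 0) * y j) = (\<Sum>j\<in>S. if j \<in> s i then y j else 0)"
    by (rule sum.cong) auto
  also have "\<dots> = sum y (S \<inter> s i)"
    using \<open>finite S\<close> by (rule sum.inter_restrict[symmetric])
  also have "\<dots> = sum y (s i)"
    by (rule sum.mono_neutral_left)
      (use sub[OF assms(1)] assms(3) finite_subset[OF sub[OF assms(1)]] in auto)
  finally show ?thesis by simp
qed

lemma unique_zero:
  fixes y :: "nat \<Rightarrow> real"
  assumes "\<And>i. i \<in> R \<Longrightarrow> sum y (s i) = 0" "j < k" "y j = 0" "l < k"
  shows "y l = 0"
proof -
  obtain c where c: "\<forall>j < k. y j = c * x j" using unique[of y] assms(1) by blast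
  then have "c = 0" using assms(2,3) nz[of j] by auto
  then show ?thesis using c assms(4) by simp
qed

text \<open>With fewer than k - 1 generating rows, fixing the last coordinate to 0 would leave more
  unknowns than equations, and a non-trivial solution vanishing at \<open>k - 1\<close> contradicts
  uniqueness.\<close>

lemma card_generating_ge:
  assumes "I \<subseteq> R" "\<And>y :: nat \<Rightarrow> real. \<forall>i \<in> I. sum y (s i) = 0 \<Longrightarrow> \<forall>i \<in> R. sum y (s i) = 0"
  shows "k \<le> card I + 1"
proof (rule ccontr)
  assume "\<not> k \<le> card I + 1"
  then have "card I < card {..<k - 1}" by simp
  then obtain y :: "nat \<Rightarrow> real" where y: "\<exists>j\<in>{..<k - 1}. y j \<noteq> 0"
    "\<forall>i\<in>I. (\<Sum>j<k - 1. (if j \<in> s i then 1 else 0) * y j) = 0"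
    using nontrivial_solution_exists[of "{..<k - 1}" I "\<lambda>i j. if j \<in> s i then 1 else 0"]
      finite_subset[OF assms(1) fin] by blast
  define z where "z j = (if j < k - 1 then y j else 0)" for j
  have "sum z (s i) = 0" if "i \<in> I" for i
  proof -
    have "sum z (s i) = (\<Sum>j<k - 1. (if j \<in> s i then 1 else 0) * z j)"
      by (rule sum_conv) (use that assms(1) in \<open>auto simp: z_def\<close>)
    also have "\<dots> = (\<Sum>j<k - 1. (if j \<in> s i then 1 else 0) * y j)"
      by (rule sum.cong) (auto simp: z_def)
    finally show ?thesis using y(2) that by simp
  qed
  then have "\<forall>i \<in> R. sum z (s i) = 0" using assms(2) by blast
  then have "z j = 0" if "j < k" for j
    using unique_zero[of z "k - 1" j] pos that by (simp add: z_def)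
  moreover obtain j where "j < k - 1" "y j \<noteq> 0" using y(1) by auto
  moreover from this have "z j = y j" "j < k" by (auto simp: z_def)
  ultimately show False by force
qed

text \<open>Elimination runs over the first k - 1 columns only: subtracting a multiple of
  \<open>x\<close> normalises the last coordinate to 0. This is why k - 1 rows suffice.\<close>

lemma basis_exists:
  obtains I where "I \<subseteq> R" "card I + 1 = k" "unique_dependency k I s x"
proof -
  obtain I where I: "I \<subseteq> R" "finite I" "card I \<le> card {..<k - 1}"
    "\<And>y. \<forall>i\<in>I. (\<Sum>j<k - 1. (if j \<in> s i then 1 else 0) * y j :: real) = 0 \<Longrightarrow>
       \<forall>i\<in>R. (\<Sum>j<k - 1. (if j \<in> s i then 1 else 0) * y j) = 0"
    using row_basis_exists[of "{..<k - 1}" R "\<lambda>i j. if j \<in> s i then 1 else 0"] by auto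
  have u: "\<exists>c. \<forall>j < k. y j = c * x j" if y: "\<And>i. i \<in> I \<Longrightarrow> sum y (s i) = 0" for y :: "nat \<Rightarrow> real"
  proof -
    define c where "c = y (k - 1) / x (k - 1)"
    define z where "z j = y j - c * x j" for j
    have z0: "z (k - 1) = 0" using nz[of "k - 1"] pos by (simp add: z_def c_def)
    have zout: "z j = 0" if "j < k" "j \<notin> {..<k - 1}" for j
      using that z0 by (metis Suc_pred' lessThan_iff less_antisym pos)
    have conv: "sum z (s i) = (\<Sum>j<k - 1. (if j \<in> s i then 1 else 0) * z j)" if "i \<in> R" for i
      by (rule sum_conv[OF that]) (use zout in auto)
    have "sum z (s i) = 0" if "i \<in> I" for i
    proof -
      have "sum z (s i) = sum y (s i) - c * sum x (s i)"
        by (simp add: z_def sum_subtractf sum_distrib_left)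
      then show ?thesis using y[OF that] sol[of i] I(1) that by auto
    qed
    then have "\<forall>i\<in>I. (\<Sum>j<k - 1. (if j \<in> s i then 1 else 0) * z j) = 0"
      using conv I(1) by (simp add: subset_iff)
    then have "\<forall>i\<in>R. (\<Sum>j<k - 1. (if j \<in> s i then 1 else 0) * z j) = 0" by (rule I(4))
    then have "\<forall>i\<in>R. sum z (s i) = 0" using conv by simp
    then have "z j = 0" if "j < k" for j using unique_zero[of z "k - 1" j] z0 pos that by simp
    then show ?thesis by (auto simp: z_def intro!: exI[of _ c])
  qed
  have ud: "unique_dependency k I s x"
    by unfold_locales (use I(1,2) pos sub nz sol u in blast)+
  have "k \<le> card I + 1"
  proof (rule card_generating_ge[OF I(1)])
    fix y :: "nat \<Rightarrow> real" assume "\<forall>i\<in>I. sum y (s i) = 0"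
    then obtain c where c: "\<forall>j < k. y j = c * x j" using u by blast
    have "sum y (s i) = c * sum x (s i)" if "i \<in> R" for i
      unfolding sum_distrib_left by (rule sum.cong) (use c sub[OF that] in auto)
    then show "\<forall>i\<in>R. sum y (s i) = 0" using sol by simp
  qed
  then show ?thesis using that[OF I(1) _ ud] I(3) pos by simp
qed

lemma no_redundant_row:
  assumes "card R + 1 = k" "r \<in> R"
  obtains y :: "nat \<Rightarrow> real" where "\<And>i. i \<in> R - {r} \<Longrightarrow> sum y (s i) = 0" "sum y (s r) \<noteq> 0"
proof (rule ccontr)
  note obtainI = that
  assume neg: "\<not> thesis"
  have "\<forall>i \<in> R. sum y (s i) = 0" if y: "\<forall>i \<in> R - {r}. sum y (s i) = 0" for y :: "nat \<Rightarrow> real"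
  proof -
    have "sum y (s r) = 0"
    proof (rule ccontr)
      assume "sum y (s r) \<noteq> 0"
      then have thesis using y by (intro obtainI[of y]) auto
      then show False using neg by contradiction
    qed
    then show ?thesis using y by blast
  qed
  then have "k \<le> card (R - {r}) + 1" by (intro card_generating_ge) auto
  moreover have "card (R - {r}) < card R" using fin assms(2) by (rule card_Diff1_less)
  ultimately show False using assms(1) by simp
qed

text \<open>One of two equal rows would be redundant. Hence no edge is doubled in a generating set
  of k - 1 rows, and its multiset of edges is a set.\<close>

lemma inj_on_supports:
  assumes "card R + 1 = k"
  shows "inj_on s R"
proof (rule inj_onI, rule ccontr)
  fix i i' assume i: "i \<in> R" "i' \<in> R" "s i = s i'" "i \<noteq> i'"
  obtain y :: "nat \<Rightarrow> real" where "\<And>l. l \<in> R - {i} \<Longrightarrow> sum y (s l) = 0" "sum y (s i) \<noteq> 0"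
    using no_redundant_row[OF assms i(1)] by blast
  then show False using i by auto
qed

lemma edge_alternating:
  assumes "i \<in> R" "s i = {a, b}" "card (s i) = 2"
  shows "sum y (s i) = y a + (y b :: real)"
  using assms by (cases "a = b") auto

lemma support_edges_alternating:
  assumes "F \<subseteq> R" "\<And>i. i \<in> F \<Longrightarrow> card (s i) = 2" "{a, b} \<in> s ` F"
  shows "x a + x b = 0"
proof -
  obtain i where i: "i \<in> F" "s i = {a, b}" using assms(3) by force
  then have "i \<in> R" "card (s i) = 2" using assms(1) assms(2)[OF i(1)] by blast+
  then show ?thesis using edge_alternating[OF _ i(2), of x] sol[of i] by simp
qed

text \<open>By \<open>cycle_edge_redundant\<close> the closing edge of a cycle would follow from the
  other rows, whereas among k - 1 rows none is redundant.\<close>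

lemma forest:
  assumes "card R + 1 = k" "F \<subseteq> R" "\<And>i. i \<in> F \<Longrightarrow> card (s i) = 2"
  shows "is_forest {..<k} (s ` F)"
  unfolding is_forest_def
proof
  show "simple_graph {..<k} (s ` F)"
    using sub assms(2,3) by (auto simp: simple_graph_def)
  show "\<nexists>vs. graph_cycle (s ` F) vs"
  proof
    assume "\<exists>vs. graph_cycle (s ` F) vs"
    then obtain vs where vs: "graph_cycle (s ` F) vs" by blast
    then obtain r where r: "r \<in> F" "s r = {last vs, hd vs}" by (force simp: graph_cycle_def)
    then have rR: "r \<in> R" using assms(2) by blast
    obtain y :: "nat \<Rightarrow> real" where y: "\<And>i. i \<in> R - {r} \<Longrightarrow> sum y (s i) = 0" "sum y (s r) \<noteq> 0"
      using no_redundant_row[OF assms(1) rR] by blast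
    have "y (last vs) + y (hd vs) = 0"
    proof (rule cycle_edge_redundant[OF vs])
      show "x a + x b = 0" if "{a, b} \<in> s ` F" for a b
        using support_edges_alternating[OF assms(2,3) that] by blast
      show "x (hd vs) \<noteq> 0" using nz[of "hd vs"] sub[OF rR] r(2) by auto
      fix a b assume "{a, b} \<in> s ` F - {{last vs, hd vs}}"
      then obtain i where i: "i \<in> F" "s i = {a, b}" "i \<noteq> r" using r(2) by force
      then have "i \<in> R" "card (s i) = 2" using assms(2) assms(3)[OF i(1)] by blast+
      then show "y a + y b = 0" using edge_alternating[OF _ i(2), of y] y(1)[of i] i(3) by simp
    qed
    then show False using y(2) edge_alternating[OF rR r(2), of y] assms(3)[OF r(1)] by simp
  qed
qed

text \<open>The source of competing solutions: multiplying \<open>x\<close> by a function that is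
  constant on components preserves all edge equations.\<close>

lemma edges_respect_reach:
  assumes "F \<subseteq> R" "\<And>i. i \<in> F \<Longrightarrow> card (s i) = 2" "i \<in> F"
    and c: "\<And>v w. v < k \<Longrightarrow> w < k \<Longrightarrow> w \<in> reach {..<k} (s ` F) v \<Longrightarrow> c v = c w"
  shows "(\<Sum>v\<in>s i. c v * x v :: real) = 0"
proof -
  obtain a b where ab: "s i = {a, b}" "a \<noteq> b" using assms(2)[OF assms(3)] by (meson card_2_iff)
  have k: "a < k" "b < k" using sub[of i] assms(1,3) ab by auto
  have "{a, b} \<in> s ` F" using ab assms(3) by force
  then have "b \<in> reach {..<k} (s ` F) a"
    using reach_closed[of a b "s ` F" "{..<k}" a] reach_refl[of a "{..<k}" "s ` F"] k by auto
  then have "c a = c b" using c k by blast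
  then have "(\<Sum>v\<in>s i. c v * x v) = c a * (x a + x b)" using ab by (simp add: algebra_simps)
  also have "x a + x b = sum x (s i)" using ab by simp
  finally show ?thesis using sol assms(1,3) by auto
qed

text \<open>Cutting \<open>x\<close> down to the component of \<open>u\<close> gives a solution that
  is non-zero at \<open>u\<close>; by uniqueness it vanishes nowhere, so the component is
  everything.\<close>

lemma tree:
  assumes "card R + 1 = k" "\<And>i. i \<in> R \<Longrightarrow> card (s i) = 2"
  shows "is_tree {..<k} (s ` R)"
  unfolding is_tree_def
proof (intro conjI ballI)
  have F: "is_forest {..<k} (s ` R)" by (rule forest) (use assms in auto)
  then show "is_forest {..<k} (s ` R)" .
  then have sg: "simple_graph {..<k} (s ` R)" by (simp add: is_forest_def)
  show "{..<k} \<noteq> {}" using pos by auto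
  fix u v assume uv: "u \<in> {..<k}" "v \<in> {..<k}"
  define y where "y j = (if j \<in> reach {..<k} (s ` R) u then 1 else 0) * x j" for j
  have "sum y (s i) = 0" if "i \<in> R" for i
    unfolding y_def
  proof (rule edges_respect_reach[of R])
    fix v w assume vw: "v < k" "w < k" "w \<in> reach {..<k} (s ` R) v"
    have "v \<in> reach {..<k} (s ` R) v" "w \<in> reach {..<k} (s ` R) w"
      using vw by (auto intro: reach_refl)
    then have "v \<in> reach {..<k} (s ` R) u \<longleftrightarrow> w \<in> reach {..<k} (s ` R) u"
      using reach_eq[OF sg, of v u] reach_eq[OF sg, of w u] reach_eq[OF sg vw(3)] vw(3) by auto
    then show "(if v \<in> reach {..<k} (s ` R) u then 1 else 0) = (if w \<in> reach {..<k} (s ` R) u then 1 else 0)"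
      by simp
  qed (use assms that in auto)
  moreover have "y u \<noteq> 0" using uv reach_refl[of u "{..<k}"] nz by (simp add: y_def)
  ultimately have "y v \<noteq> 0" using unique_zero[of y v u] uv by blast
  then show "\<exists>vs. path_betw {..<k} (s ` R) u vs v" by (auto simp: y_def reach_def split: if_splits)
qed

text \<open>Within a component \<open>x\<close> is constant up to sign. Three columns in one
  component would add up to an odd multiple of \<open>x a\<close>; three columns in three
  components, or a component that the triple row misses, would admit a solution not proportional to
  \<open>x\<close>. So there are exactly two components, and the row is split two to one.\<close>

lemma triple_row:
  assumes "card R + 1 = k" "r \<in> R" "card (s r) = 3" "\<And>i. i \<in> R - {r} \<Longrightarrow> card (s i) = 2"
  defines "E \<equiv> s ` (R - {r})"
  obtains F1 F2 a b c vs where "components {..<k} E = {F1, F2}" "F1 \<noteq> F2" "s r = {a, b, c}"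
    "a \<in> F1" "b \<in> F1" "c \<in> F2" "path_betw {..<k} E a vs b" "even (path_length vs)"
proof -
  let ?C = "reach {..<k} E"
  have "is_forest {..<k} E" unfolding E_def by (rule forest) (use assms in auto)
  then have sg: "simple_graph {..<k} E" by (simp add: is_forest_def)
  have self: "v \<in> ?C v" if "v < k" for v using that by (auto intro: reach_refl)
  have Ceq: "w \<in> ?C v \<longleftrightarrow> ?C v = ?C w" if "v < k" "w < k" for v w
    using reach_eq[OF sg, of w v] self[OF that(2)] by auto
  have rows: "(\<Sum>v\<in>s i. d v * x v) = 0"
    if d: "i \<in> R - {r}" "\<And>v w. v < k \<Longrightarrow> w < k \<Longrightarrow> ?C v = ?C w \<Longrightarrow> d v = d w" for i and d :: "nat \<Rightarrow> real"
  proof (rule edges_respect_reach[of "R - {r}"])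
    show "card (s i') = 2" if "i' \<in> R - {r}" for i' using assms(4) that .
    show "d v = d w" if vw: "v < k" "w < k" "w \<in> reach {..<k} (s ` (R - {r})) v" for v w
      using Ceq[OF vw(1,2)] vw(3) d(2)[OF vw(1,2)] by (simp add: E_def)
  qed (use d in auto)
  have sr: "s r \<subseteq> {..<k}" using sub assms(2) .
  have path: "\<exists>vs. path_betw {..<k} E u vs v \<and> x v = (- 1) ^ path_length vs * x u"
    if uv: "v \<in> ?C u" for u v
  proof -
    obtain vs where vs: "path_betw {..<k} E u vs v" using uv by (auto simp: reach_def)
    have "x v = (- 1) ^ path_length vs * x u"
      by (rule path_betw_alternating[OF vs])
        (use support_edges_alternating[of "R - {r}"] assms(4) in \<open>auto simp: E_def\<close>)
    then show ?thesis using vs by blast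
  qed
  have sum_r: "sum y (s r) = y a + y b + y c" if "s r = {a, b, c}" for a b c and y :: "nat \<Rightarrow> real"
  proof -
    have "distinct [a, b, c]" using assms(3) that by (intro card_distinct) simp
    then show ?thesis using that by simp
  qed
  have not_same: False if abc: "s r = {a, b, c}" "?C a = ?C b" "?C a = ?C c" for a b c
  proof -
    have k: "a < k" "b < k" "c < k" using sr abc(1) by auto
    obtain l l' where "x b = (- 1) ^ l * x a" "x c = (- 1) ^ l' * x a"
      using path[of b a] path[of c a] Ceq k abc by blast
    then have "x b = x a \<or> x b = - x a" "x c = x a \<or> x c = - x a"
      by (cases "even l"; cases "even l'"; simp)+
    moreover have "x a + x b + x c = 0" using sum_r[OF abc(1), of x] sol[OF assms(2)] by simp
    ultimately show False using nz[OF k(1)] by auto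
  qed
  have not_different: False
    if abc: "s r = {a, b, c}" "?C a \<noteq> ?C b" "?C a \<noteq> ?C c" "?C b \<noteq> ?C c" for a b c
  proof -
    have k: "a < k" "b < k" "c < k" using sr abc(1) by auto
    \<comment> \<open>The weights make the entries at \<open>a\<close>, \<open>b\<close>,
      \<open>c\<close> equal to 1, -1 and 0: the triple row holds, and the solution vanishes at
      \<open>c\<close> but not at \<open>a\<close>.\<close>
    define d where "d v = (if ?C v = ?C a then 1 / x a else if ?C v = ?C b then - 1 / x b else 0)" for v
    have "(\<Sum>v\<in>s i. d v * x v) = 0" if "i \<in> R" for i
    proof (cases "i = r")
      case True
      then show ?thesis using sum_r[OF abc(1), of "\<lambda>v. d v * x v"] abc nz k by (simp add: d_def)
    next
      case False
      then show ?thesis by (intro rows) (use that in \<open>auto simp: d_def\<close>)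
    qed
    then have "d a * x a = 0"
      using unique_zero[of "\<lambda>v. d v * x v" c a] k abc by (simp add: d_def)
    then show False using nz[OF k(1)] by (simp add: d_def)
  qed
  have meets: "\<exists>v \<in> s r. ?C v = ?C w" if w: "w < k" for w
  proof (rule ccontr)
    assume neg: "\<not> (\<exists>v \<in> s r. ?C v = ?C w)"
    define d where "d v = (if ?C v = ?C w then 1 else 0 :: real)" for v
    have "(\<Sum>v\<in>s i. d v * x v) = 0" if "i \<in> R" for i
    proof (cases "i = r")
      case True
      then show ?thesis using neg by (auto simp: d_def intro!: sum.neutral)
    next
      case False
      then show ?thesis by (intro rows) (use that in \<open>auto simp: d_def\<close>)
    qed
    moreover obtain v where v: "v \<in> s r" using assms(3) by fastforce
    ultimately have "d w * x w = 0"
      using unique_zero[of "\<lambda>v. d v * x v" v w] w sr neg by (auto simp: d_def)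
    then show False using nz[OF w] by (simp add: d_def)
  qed
  obtain a b c where abc: "s r = {a, b, c}" "?C a = ?C b" "?C a \<noteq> ?C c"
  proof -
    obtain a b c where 1: "s r = {a, b, c}" using assms(3) by (auto simp: card_3_iff)
    then have 2: "s r = {a, c, b}" "s r = {b, c, a}" by auto
    show ?thesis using not_same[OF 1] not_different[OF 1] that[OF 1] that[OF 2(1)] that[OF 2(2)] by metis
  qed
  have k: "a < k" "b < k" "c < k" using sr abc(1) by auto
  obtain vs where vs: "path_betw {..<k} E a vs b" "x b = (- 1) ^ path_length vs * x a"
    using path[of b a] Ceq[of a b] k abc by blast
  show ?thesis
  proof (rule that[of "?C a" "?C c" a b c vs])
    show "components {..<k} E = {?C a, ?C c}"
    proof
      show "components {..<k} E \<subseteq> {?C a, ?C c}"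
        using meets abc by (fastforce simp: components_eq_reach)
    qed (use k in \<open>auto simp: components_eq_reach\<close>)
    \<comment> \<open>An odd path would give \<open>x a + x b = 0\<close>, and the triple row would
      force \<open>x c = 0\<close>.\<close>
    show "even (path_length vs)"
    proof (rule ccontr)
      assume "odd (path_length vs)"
      then have "x a + x b = 0" using vs(2) by simp
      then show False using sum_r[OF abc(1), of x] sol[OF assms(2)] nz[OF k(3)] by simp
    qed
    show "b \<in> ?C a" using abc(2) self[OF k(2)] by simp
  qed (use vs abc self k in auto)
qed

end

section \<open>Row supports of 0/1 matrices and the three families\<close>

lemma zero_one_entry:
  assumes "M \<in> zero_one_mats k" "i < dim_row M" "j < dim_col M"
  shows "M $$ (i, j) = 0 \<or> M $$ (i, j) = 1"
proof -
  have "M $$ (i, j) \<in> elements_mat M" using assms(2,3) by (rule elements_matI[OF carrier_matI, OF refl refl _ _ refl])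
  then show ?thesis using assms(1) by (auto simp: zero_one_mats_def)
qed

lemma row_sum_zero_one:
  assumes "M \<in> zero_one_mats k" "i < dim_row M"
  shows "(\<Sum>j<dim_col M. M $$ (i, j) * y j) = sum y (row_supp M i)"
proof -
  have "M $$ (i, j) * y j = (if j \<in> row_supp M i then y j else 0)" if "j < dim_col M" for j
    using zero_one_entry[OF assms that] that by (auto simp: row_supp_def)
  then have "(\<Sum>j<dim_col M. M $$ (i, j) * y j) = (\<Sum>j<dim_col M. if j \<in> row_supp M i then y j else 0)"
    by simp
  also have "\<dots> = sum y ({..<dim_col M} \<inter> row_supp M i)" by (rule sum.inter_restrict[symmetric]) simp
  also have "{..<dim_col M} \<inter> row_supp M i = row_supp M i" by (auto simp: row_supp_def)
  finally show ?thesis .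
qed

lemma num_ones_eq_sum:
  assumes "M \<in> zero_one_mats k"
  shows "num_ones M = (\<Sum>i\<in>nonzero_rows M. card (row_supp M i))"
proof -
  have fin: "finite (row_supp M i)" for i by (simp add: row_supp_def)
  have "{(i, j). i < dim_row M \<and> j < dim_col M \<and> M $$ (i, j) = 1} = (SIGMA i:nonzero_rows M. row_supp M i)"
    using zero_one_entry[OF assms] by (fastforce simp: row_supp_def nonzero_rows_def)
  then show ?thesis unfolding num_ones_def by (simp add: card_SigmaI nonzero_rows_def fin)
qed

text \<open>Let r be the number of non-zero rows and t the sum of their support sizes minus 2 each.
  No support is a singleton, so the number of ones is t + 2 r, and \<open>few\<close> reads r + t <=
  k; uniqueness of the dependency gives k <= r + 1. Hence (r, t) is (k - 1, 0), (k - 1, 1) or (k,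
  0), one case per family.\<close>

theorem minimal_dependency_few_ones:
  assumes M: "M \<in> zero_one_mats k" and md: "minimal_dependency M"
    and few: "num_ones M \<le> card (nonzero_rows M) + k"
  shows "M \<in> T_tree k \<union> T_plus k \<union> T_cycle k"
proof -
  let ?R = "nonzero_rows M" and ?s = "row_supp M"
  have k: "dim_col M = k" using M by (simp add: zero_one_mats_def)
  obtain x :: "nat \<Rightarrow> real" where x0: "dim_col M > 0" "\<And>j. j < dim_col M \<Longrightarrow> x j \<noteq> 0"
    "\<And>i. i < dim_row M \<Longrightarrow> (\<Sum>j<dim_col M. M $$ (i, j) * x j) = 0"
    "\<And>y. (\<And>i. i < dim_row M \<Longrightarrow> (\<Sum>j<dim_col M. M $$ (i, j) * y j) = 0) \<Longrightarrow>
       \<exists>c. \<forall>j < dim_col M. y j = c * x j"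
  proof (rule minimal_dependency_unique[OF md], goal_cases)
    case (1 x)
    show ?case by (rule 1(1)[of x]) (fact 1(2-5))+
  qed
  have x: "k > 0" "\<And>j. j < k \<Longrightarrow> x j \<noteq> 0" "\<And>i. i < dim_row M \<Longrightarrow> sum x (?s i) = 0"
    using x0(1-3) row_sum_zero_one[OF M, of _ x] k by auto
  have x4: "\<exists>c. \<forall>j < k. y j = c * x j" if "\<And>i. i < dim_row M \<Longrightarrow> sum y (?s i) = 0" for y
    using x0(4)[of y] that row_sum_zero_one[OF M, of _ y] k by simp
  have finR: "finite ?R" by (simp add: nonzero_rows_def)
  interpret ud: unique_dependency k ?R ?s x
  proof
    fix y :: "nat \<Rightarrow> real" assume "\<And>i. i \<in> ?R \<Longrightarrow> sum y (?s i) = 0"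
    then have "sum y (?s i) = 0" if "i < dim_row M" for i
      using that by (cases "?s i = {}") (auto simp: nonzero_rows_def)
    then show "\<exists>c. \<forall>j < k. y j = c * x j" by (rule x4)
  qed (use x finR k in \<open>auto simp: nonzero_rows_def row_supp_def\<close>)
  have two: "card (?s i) \<ge> 2" if i: "i \<in> ?R" for i
  proof (rule ccontr)
    assume "\<not> card (?s i) \<ge> 2"
    moreover have "card (?s i) > 0" using i by (auto simp: nonzero_rows_def row_supp_def card_gt_0_iff)
    ultimately have "card (?s i) = 1" by linarith
    then obtain j where "?s i = {j}" by (rule card_1_singletonE)
    then show False using ud.sol[OF i] ud.nz[of j] ud.sub[OF i] by auto
  qed
  have ge: "k \<le> card ?R + 1" by (rule ud.card_generating_ge) auto
  have ones: "num_ones M = (\<Sum>i\<in>?R. card (?s i) - 2) + 2 * card ?R"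
  proof -
    have "(\<Sum>i\<in>?R. card (?s i)) = (\<Sum>i\<in>?R. (card (?s i) - 2) + 2)"
      by (rule sum.cong[OF refl], rule le_add_diff_inverse2[symmetric], rule two)
    also have "\<dots> = (\<Sum>i\<in>?R. card (?s i) - 2) + 2 * card ?R"
      by (simp only: sum.distrib sum_constant of_nat_id mult.commute)
    finally show ?thesis by (simp only: num_ones_eq_sum[OF M])
  qed
  have rows2: "rows_of_supp M n = {i \<in> ?R. card (?s i) = n}" if "n > 0" for n
    using that by (auto simp: rows_of_supp_def nonzero_rows_def)
  consider (tree) "card ?R + 1 = k" "(\<Sum>i\<in>?R. card (?s i) - 2) = 0"
    | (plus) "card ?R + 1 = k" "(\<Sum>i\<in>?R. card (?s i) - 2) = 1"
    | (cycle) "card ?R = k" "(\<Sum>i\<in>?R. card (?s i) - 2) = 0"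
    using few ge unfolding ones by linarith
  then show ?thesis
  proof cases
    case tree
    have c2: "card (?s i) = 2" if "i \<in> ?R" for i using tree(2) finR two[OF that] that by auto
    have "is_tree {..<k} (?s ` ?R)" using ud.tree tree(1) c2 by blast
    moreover have "incidence_rows M ?R (mset_set (?s ` ?R))"
      unfolding incidence_rows_def by (rule image_mset_mset_set) (rule ud.inj_on_supports[OF tree(1)])
    ultimately have "M \<in> T_tree k" using M ones tree unfolding T_tree_def by auto
    then show ?thesis by simp
  next
    case plus
    obtain r where r: "r \<in> ?R" "card (?s r) - 2 = 1" "\<And>i. i \<in> ?R - {r} \<Longrightarrow> card (?s i) - 2 = 0"
      using plus(2) unfolding sum_eq_1_iff[OF finR] by auto
    have c3: "card (?s r) = 3" using r(2) by simp
    have c2: "card (?s i) = 2" if "i \<in> ?R - {r}" for i using r(3)[OF that] two[of i] that by simp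
    have R2: "rows_of_supp M 2 = ?R - {r}" and R3: "rows_of_supp M 3 = {r}"
      using c2 c3 r(1) by (fastforce simp: rows2)+
    have inc: "incidence_rows M (?R - {r}) (mset_set (?s ` (?R - {r})))"
      unfolding incidence_rows_def
      by (rule image_mset_mset_set) (rule inj_on_subset[OF ud.inj_on_supports[OF plus(1)]], auto)
    have forest: "is_forest {..<k} (?s ` (?R - {r}))" by (rule ud.forest) (use plus c2 in auto)
    let ?E = "?s ` (?R - {r})"
    obtain F1 F2 a b c vs where F: "components {..<k} ?E = {F1, F2}" "F1 \<noteq> F2"
      and abc: "?s r = {a, b, c}" "a \<in> F1" "b \<in> F1" "c \<in> F2"
      and vs: "path_betw {..<k} ?E a vs b" "even (path_length vs)"
      using ud.triple_row[OF plus(1) r(1) c3 c2] by blast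
    have "\<exists>r a b c. r \<in> rows_of_supp M 3 \<and> ?s r = {a, b, c} \<and> a \<in> F1 \<and> b \<in> F1 \<and> c \<in> F2 \<and>
        (\<exists>vs. path_betw {..<k} ?E a vs b \<and> even (path_length vs))"
      by (rule exI[of _ r], rule exI[of _ a], rule exI[of _ b], rule exI[of _ c])
        (use abc vs R3 in auto)
    then have "\<exists>E F1 F2. is_forest {..<k} E \<and> components {..<k} E = {F1, F2} \<and> F1 \<noteq> F2 \<and>
        incidence_rows M (rows_of_supp M 2) (mset_set E) \<and>
        (\<exists>r a b c. r \<in> rows_of_supp M 3 \<and> row_supp M r = {a, b, c} \<and>
           a \<in> F1 \<and> b \<in> F1 \<and> c \<in> F2 \<and>
           (\<exists>vs. path_betw {..<k} E a vs b \<and> even (path_length vs)))"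
      using F forest inc
      unfolding R2
      by (rule_tac exI[of _ ?E], rule_tac exI[of _ F1], rule_tac exI[of _ F2]) (intro conjI)
    moreover have "card (?R - {r}) + 2 = k" using plus(1) card_Suc_Diff1[OF finR r(1)] by linarith
    then have "card (rows_of_supp M 2) + 2 = k" "card (rows_of_supp M 3) = 1" by (simp_all add: R2 R3)
    moreover have "num_ones M + 1 = 2 * k" using ones plus by simp
    ultimately have "M \<in> T_plus k"
      unfolding T_plus_def mem_Collect_eq using M plus(1) by (intro conjI)
    then show ?thesis by simp
  next
    case cycle
    have c2: "card (?s i) = 2" if "i \<in> ?R" for i using cycle(2) finR two[OF that] that by auto
    \<comment> \<open>There is one row too many: k - 1 generating rows form the tree, and the row
      left over is the added edge, possibly parallel to a tree edge.\<close>
    obtain I where I: "I \<subseteq> ?R" "card I + 1 = k" "unique_dependency k I ?s x"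
      using ud.basis_exists by blast
    interpret I: unique_dependency k I ?s x by (rule I(3))
    have finI: "finite I" using I(1) finR finite_subset by blast
    have "card (?R - I) = 1" using I(1,2) cycle(1) finI by (simp add: card_Diff_subset)
    then obtain r where "?R - I = {r}" by (rule card_1_singletonE)
    then have r: "?R = insert r I" "r \<notin> I" "r \<in> ?R" using I(1) by auto
    obtain u v where uv: "?s r = {u, v}" "u \<noteq> v" using c2[OF r(3)] by (meson card_2_iff)
    have uvk: "u < k" "v < k" using ud.sub[OF r(3)] uv by auto
    have tree: "is_tree {..<k} (?s ` I)" using I.tree I(1,2) c2 by blast
    \<comment> \<open>Along an even path \<open>x u = x v\<close>, against
      \<open>x u + x v = 0\<close> from row \<open>r\<close>. This covers every path, in particular
      a shortest one.\<close>
    have odd_path: "odd (path_length vs)" if "path_betw {..<k} (?s ` I) u vs v" for vs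
    proof
      assume even: "even (path_length vs)"
      have "x v = (- 1) ^ path_length vs * x u"
        by (rule path_betw_alternating[OF that]) (use I.support_edges_alternating[of I] I(1) c2 in blast)
      then have "x u = x v" using even by simp
      then show False using ud.sol[OF r(3)] uv x(2)[OF uvk(1)] by simp
    qed
    have "\<exists>l vs. path_betw {..<k} (?s ` I) u vs v \<and> path_length vs = l"
      using tree uvk by (auto simp: is_tree_def)
    then have "\<exists>vs. path_betw {..<k} (?s ` I) u vs v \<and> path_length vs = graph_dist {..<k} (?s ` I) u v"
      unfolding graph_dist_def by (rule LeastI_ex)
    then have "odd (graph_dist {..<k} (?s ` I) u v)" using odd_path by metis
    moreover have "incidence_rows M ?R (add_mset {u, v} (mset_set (?s ` I)))"
      unfolding incidence_rows_def r(1) using finI r(2) uv(1)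
      by (simp add: image_mset_mset_set[OF I.inj_on_supports[OF I(2)]])
    ultimately have "M \<in> T_cycle k"
      unfolding T_cycle_def mem_Collect_eq using M tree uvk ones cycle by auto
    then show ?thesis by simp
  qed
qed

section \<open>Sparse column sets\<close>

lemma sum_Pow_binomial:
  fixes a b :: real
  assumes "finite H"
  shows "(\<Sum>W\<in>Pow H. a ^ card (H - W) * b ^ card W) = (a + b) ^ card H"
proof -
  have "(\<Prod>i\<in>H. b + a) = (\<Sum>W\<in>Pow H. (\<Prod>i\<in>W. b) * (\<Prod>i\<in>H - W. a))"
    by (rule prod_add[OF assms])
  then show ?thesis by (simp add: add.commute mult.commute)
qed

text \<open>The pairing sends row half-edges to column half-edges, whereas some estimates reveal the
  partners of columns; inversion preserves the uniform distribution.\<close>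

lemma card_inv_permutes_le:
  assumes "finite N"
  shows "card {\<sigma>. \<sigma> permutes N \<and> P (inv_into UNIV \<sigma>)} \<le> card {\<pi>. \<pi> permutes N \<and> P \<pi>}"
proof -
  have "{\<sigma>. \<sigma> permutes N \<and> P (inv_into UNIV \<sigma>)} \<subseteq> inv_into UNIV ` {\<pi>. \<pi> permutes N \<and> P \<pi>}"
  proof
    fix \<sigma> assume "\<sigma> \<in> {\<sigma>. \<sigma> permutes N \<and> P (inv_into UNIV \<sigma>)}"
    then show "\<sigma> \<in> inv_into UNIV ` {\<pi>. \<pi> permutes N \<and> P \<pi>}"
      by (intro image_eqI[where x = "inv_into UNIV \<sigma>"]) (auto simp: permutes_inv permutes_inv_inv)
  qed
  moreover have fin: "finite {\<pi>. \<pi> permutes N \<and> P \<pi>}"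
    using finite_permutations[OF assms] by simp
  ultimately show ?thesis by (rule surj_card_le[rotated])
qed

text \<open>\<open>D\<close>, \<open>m\<close> and \<open>m'\<close> stand for \<gamma> d, \<gamma>
  n and \<gamma> n (1 - p) as natural numbers, so that the counting involves neither \<gamma> nor
  floors.\<close>

locale half_edge_pairing =
  fixes n d D m m' :: nat
  assumes half_edges: "m * d = n * D" and d_pos: "d > 0" and D_pos: "D > 0" and n_pos: "n > 0"
    and kept: "m' \<le> m"
begin

definition N :: "nat set" where "N = {..<m * d}"

definition nbrs :: "(nat \<Rightarrow> nat) \<Rightarrow> nat \<Rightarrow> nat set" where
  "nbrs \<sigma> i = (\<lambda>h. \<sigma> h div D) ` {h. h < m * d \<and> h div d = i}"

definition A :: "(nat \<Rightarrow> nat) \<Rightarrow> real mat" where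
  "A \<sigma> = submatrix (pairing_matrix m n d D \<sigma>) {..<m'} UNIV"

definition H :: "nat set \<Rightarrow> nat set" where
  "H S = {h. h < m * d \<and> h div D \<in> S}"

definition row_of :: "(nat \<Rightarrow> nat) \<Rightarrow> nat \<Rightarrow> nat" where
  "row_of \<sigma> h = inv_into UNIV \<sigma> h div d"

text \<open>
  \<open>W\<close> collects the half-edges of \<open>S\<close> in kept rows, \<open>Rep\<close> those among them whose row is repeated, so
  that \<open>W - Rep\<close> contains exactly one half-edge for each row hit by \<open>S\<close>.
\<close>

definition W :: "(nat \<Rightarrow> nat) \<Rightarrow> nat set \<Rightarrow> nat set" where
  "W \<sigma> S = {h \<in> H S. row_of \<sigma> h < m'}"

definition Rep :: "(nat \<Rightarrow> nat) \<Rightarrow> nat set \<Rightarrow> nat set" where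
  "Rep \<sigma> S = {h \<in> W \<sigma> S. \<exists>h' \<in> W \<sigma> S. h' < h \<and> row_of \<sigma> h' = row_of \<sigma> h}"

text \<open>The combinatorial shadow of supporting a kernel vector: a single entry of a row cannot
  cancel. The sparse regime uses only this about the vector.\<close>

definition single_free :: "(nat \<Rightarrow> nat) \<Rightarrow> nat set \<Rightarrow> bool" where
  "single_free \<sigma> S \<longleftrightarrow> (\<forall>i < m'. card (nbrs \<sigma> i \<inter> S) \<noteq> 1)"

section \<open>Half-edges of a column set and repeated rows\<close>

lemma finite_N [simp]: "finite N" and card_N: "card N = n * D"
  by (simp_all add: N_def half_edges)

lemma card_div_fibre: "card {y. y < a * b \<and> y div b = i} \<le> b"
proof (cases "b = 0")
  case False
  have "{y. y < a * b \<and> y div b = i} \<subseteq> {i * b..<i * b + b}"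
  proof
    fix y assume "y \<in> {y. y < a * b \<and> y div b = i}"
    then have "y = i * b + y mod b" "y mod b < b" using False div_mult_mod_eq[of y b] by auto
    then show "y \<in> {i * b..<i * b + b}" by auto
  qed
  then have "card {y. y < a * b \<and> y div b = i} \<le> card {i * b..<i * b + b}" by (rule card_mono[rotated]) simp
  then show ?thesis by simp
qed simp

lemma H_subset: "H S \<subseteq> N" by (auto simp: H_def N_def)

lemma finite_H [simp]: "finite (H S)" by (rule finite_subset[OF H_subset finite_N])

lemma card_H:
  assumes "S \<subseteq> {..<n}"
  shows "card (H S) = card S * D"
proof -
  have "bij_betw (\<lambda>(j, r). j * D + r) (S \<times> {..<D}) (H S)"
  proof (rule bij_betwI[where g = "\<lambda>h. (h div D, h mod D)"])
    show "(\<lambda>(j, r). j * D + r) \<in> S \<times> {..<D} \<rightarrow> H S"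
    proof clarify
      fix j r assume jr: "j \<in> S" "r < D"
      then have "j + 1 \<le> n" using assms by (auto simp: Suc_le_eq)
      then have "(j + 1) * D \<le> n * D" by (rule mult_le_mono1)
      then have "j * D + r < n * D" using jr by simp
      then show "j * D + r \<in> H S" using jr by (simp add: H_def half_edges)
    qed
    show "(\<lambda>h. (h div D, h mod D)) \<in> H S \<rightarrow> S \<times> {..<D}" using D_pos by (auto simp: H_def)
  qed (use D_pos in auto)
  then have "card (S \<times> {..<D}) = card (H S)" by (rule bij_betw_same_card)
  then show ?thesis by (simp add: card_cartesian_product)
qed

lemma permutes_inv_N:
  assumes "\<sigma> permutes N" "h < m * d"
  shows "inv_into UNIV \<sigma> h < m * d" "\<sigma> (inv_into UNIV \<sigma> h) = h"
  using permutes_in_image[OF permutes_inv[OF assms(1)], of h] permutes_inverses(1)[OF assms(1)] assms(2)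
  by (auto simp: N_def)

lemma nbrs_subset:
  assumes "\<sigma> permutes N"
  shows "nbrs \<sigma> i \<subseteq> {..<n}"
proof
  fix j assume "j \<in> nbrs \<sigma> i"
  then obtain h where h: "h < m * d" "j = \<sigma> h div D" by (auto simp: nbrs_def)
  then have "\<sigma> h < n * D" using permutes_in_image[OF assms, of h] by (simp add: N_def half_edges)
  then show "j \<in> {..<n}" using h D_pos by (simp add: div_less_iff_less_mult)
qed

lemma finite_nbrs [simp]: "finite (nbrs \<sigma> i)" by (simp add: nbrs_def)

text \<open>Row \<open>i\<close> seen from the side of the columns: half-edges of \<open>S\<close>
  look up their row through the inverse permutation.\<close>

lemma nbrs_Int:
  assumes "\<sigma> permutes N" "i < m'"
  shows "nbrs \<sigma> i \<inter> S = (\<lambda>h. h div D) ` {h \<in> W \<sigma> S. row_of \<sigma> h = i}"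
proof (intro equalityI subsetI)
  fix j assume j: "j \<in> nbrs \<sigma> i \<inter> S"
  then obtain h where h: "h < m * d" "h div d = i" "j = \<sigma> h div D" by (auto simp: nbrs_def)
  have "\<sigma> h < m * d" using permutes_in_image[OF assms(1), of h] h(1) by (simp add: N_def)
  moreover have "row_of \<sigma> (\<sigma> h) = i" using h(2) permutes_inverses(2)[OF assms(1)] by (simp add: row_of_def)
  ultimately show "j \<in> (\<lambda>h. h div D) ` {h \<in> W \<sigma> S. row_of \<sigma> h = i}"
    using j h(3) assms(2) by (intro image_eqI[of _ _ "\<sigma> h"]) (auto simp: W_def H_def)
next
  fix j assume "j \<in> (\<lambda>h. h div D) ` {h \<in> W \<sigma> S. row_of \<sigma> h = i}"
  then obtain h where h: "h < m * d" "h div D \<in> S" "row_of \<sigma> h = i" "j = h div D" by (auto simp: W_def H_def)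
  have "j = \<sigma> (inv_into UNIV \<sigma> h) div D" using permutes_inv_N[OF assms(1) h(1)] h(4) by simp
  then have "j \<in> nbrs \<sigma> i"
    unfolding nbrs_def using permutes_inv_N(1)[OF assms(1) h(1)] h(3)
    by (intro image_eqI[of _ _ "inv_into UNIV \<sigma> h"]) (auto simp: row_of_def)
  then show "j \<in> nbrs \<sigma> i \<inter> S" using h by simp
qed

lemma finite_W [simp]: "finite (W \<sigma> S)" by (simp add: W_def)

text \<open>In each row that is hit, the smallest half-edge is the one that is no repetition, so
  these rows correspond to \<open>W \<sigma> S - Rep \<sigma> S\<close>. The second claim is an
  inequality because multiple edges count once in \<open>nbrs\<close>.\<close>

lemma card_W_rows:
  assumes "\<sigma> permutes N"
  shows "card {i. i < m' \<and> nbrs \<sigma> i \<inter> S \<noteq> {}} + card (Rep \<sigma> S) = card (W \<sigma> S)"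
    and "(\<Sum>i<m'. card (nbrs \<sigma> i \<inter> S)) \<le> card (W \<sigma> S)"
proof -
  let ?rows = "{i. i < m' \<and> nbrs \<sigma> i \<inter> S \<noteq> {}}"
  let ?F = "\<lambda>i. {h \<in> W \<sigma> S. row_of \<sigma> h = i}"
  have "bij_betw (row_of \<sigma>) (W \<sigma> S - Rep \<sigma> S) ?rows"
    unfolding bij_betw_def
  proof
    show "inj_on (row_of \<sigma>) (W \<sigma> S - Rep \<sigma> S)"
    proof (rule inj_onI)
      fix a b assume "a \<in> W \<sigma> S - Rep \<sigma> S" "b \<in> W \<sigma> S - Rep \<sigma> S" "row_of \<sigma> a = row_of \<sigma> b"
      then have "\<not> a < b" "\<not> b < a" by (auto simp: Rep_def)
      then show "a = b" by simp
    qed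
    show "row_of \<sigma> ` (W \<sigma> S - Rep \<sigma> S) = ?rows"
    proof (intro equalityI subsetI)
      fix i assume "i \<in> row_of \<sigma> ` (W \<sigma> S - Rep \<sigma> S)"
      then show "i \<in> ?rows" using nbrs_Int[OF assms, of i S] by (auto simp: W_def)
    next
      fix i assume i: "i \<in> ?rows"
      then have ne: "?F i \<noteq> {}" using nbrs_Int[OF assms, of i S] by auto
      have fin: "finite (?F i)" by simp
      have "Min (?F i) \<in> ?F i" using Min_in[OF fin ne] .
      moreover have "Min (?F i) \<notin> Rep \<sigma> S"
      proof
        assume "Min (?F i) \<in> Rep \<sigma> S"
        then obtain h' where "h' \<in> W \<sigma> S" "h' < Min (?F i)" "row_of \<sigma> h' = row_of \<sigma> (Min (?F i))"
          by (auto simp: Rep_def)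
        then have "h' \<in> ?F i" "h' < Min (?F i)" using \<open>Min (?F i) \<in> ?F i\<close> by auto
        then show False using Min_le[OF fin, of h'] by linarith
      qed
      ultimately show "i \<in> row_of \<sigma> ` (W \<sigma> S - Rep \<sigma> S)" by (intro image_eqI[of _ _ "Min (?F i)"]) auto
    qed
  qed
  then have "card (W \<sigma> S - Rep \<sigma> S) = card ?rows" by (rule bij_betw_same_card)
  moreover have sub: "Rep \<sigma> S \<subseteq> W \<sigma> S" by (auto simp: Rep_def)
  then have "card (W \<sigma> S - Rep \<sigma> S) = card (W \<sigma> S) - card (Rep \<sigma> S)"
    using finite_subset[OF sub finite_W] by (intro card_Diff_subset) auto
  moreover have "card (Rep \<sigma> S) \<le> card (W \<sigma> S)" by (rule card_mono[OF finite_W sub])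
  ultimately show "card ?rows + card (Rep \<sigma> S) = card (W \<sigma> S)" by linarith
  have "(\<Sum>i<m'. card (nbrs \<sigma> i \<inter> S)) \<le> (\<Sum>i<m'. card (?F i))"
    by (rule sum_mono) (simp add: nbrs_Int[OF assms] card_image_le)
  also have "\<dots> = card (\<Union>i<m'. ?F i)" by (rule card_UN_disjoint[symmetric]) auto
  also have "\<dots> \<le> card (W \<sigma> S)" by (rule card_mono) auto
  finally show "(\<Sum>i<m'. card (nbrs \<sigma> i \<inter> S)) \<le> card (W \<sigma> S)" .
qed

text \<open>Every row that is hit contains at least two elements of \<open>W \<sigma> S\<close>,
  exactly one of which is no repetition.\<close>

lemma card_W_le_Rep:
  assumes "\<sigma> permutes N" "single_free \<sigma> S"
  shows "card (W \<sigma> S) \<le> 2 * card (Rep \<sigma> S)"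
proof -
  let ?rows = "{i. i < m' \<and> nbrs \<sigma> i \<inter> S \<noteq> {}}"
  have "2 * card ?rows = (\<Sum>i\<in>?rows. 2)" by simp
  also have "\<dots> \<le> (\<Sum>i\<in>?rows. card (nbrs \<sigma> i \<inter> S))"
  proof (rule sum_mono)
    fix i assume i: "i \<in> ?rows"
    then have "card (nbrs \<sigma> i \<inter> S) > 0" "card (nbrs \<sigma> i \<inter> S) \<noteq> 1"
      using assms(2) by (auto simp: single_free_def card_gt_0_iff)
    then show "2 \<le> card (nbrs \<sigma> i \<inter> S)" by linarith
  qed
  also have "\<dots> \<le> (\<Sum>i<m'. card (nbrs \<sigma> i \<inter> S))" by (rule sum_mono2) auto
  also have "\<dots> \<le> card (W \<sigma> S)" by (rule card_W_rows[OF assms(1)])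
  finally show ?thesis using card_W_rows(1)[OF assms(1), of S] by linarith
qed

text \<open>A union over the set \<open>V\<close> of half-edges in kept rows and the set
  \<open>R\<close> of repetitions. As \<open>card V \<le> 2 * card R\<close>, an element of
  \<open>V\<close> costs a square root of \<beta>0, times 2 for the choice of \<open>R\<close>; the
  binomial theorem then sums over \<open>V\<close>. The power of \<beta>/\<beta>0 is kept apart:
  \<beta>0 = \<beta> serves when only the size of \<open>S\<close> matters, a constant \<beta>0 when
  \<open>e\<close> repetitions must yield powers of 1/n.\<close>

lemma card_single_free:
  fixes q \<beta> \<beta>0 :: real
  assumes S: "S \<subseteq> {..<n}" and half: "2 * card S \<le> n"
    and q: "0 \<le> q" "q \<le> 1" "real (m - m') * d \<le> q * (n * D)"
    and \<beta>: "\<beta> = 2 * real (card S) * d / n" "\<beta> \<le> \<beta>0" "\<beta>0 \<le> 1" "0 < \<beta>0"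
  shows "real (card {\<sigma>. \<sigma> permutes N \<and> single_free \<sigma> S \<and> e \<le> card (Rep \<sigma> S)}) \<le>
    (\<beta> / \<beta>0) ^ e * (q + 2 * sqrt \<beta>0) ^ (card S * D) * fact (n * D)"
proof -
  let ?k = "card S"
  let ?Del = "{m' * d..<m * d}"
  define Ev where "Ev V R = {\<pi>. \<pi> permutes N \<and> (\<forall>z \<in> H S - V. \<pi> z \<in> ?Del) \<and>
      (\<forall>h \<in> R. \<exists>h' \<in> V. h' < h \<and> \<pi> h' div d = \<pi> h div d)}" for V R :: "nat set"
  let ?Rs = "\<lambda>V. {R \<in> Pow V. card V \<le> 2 * card R \<and> e \<le> card R}"
  let ?\<gamma> = "\<beta> / \<beta>0"
  have \<beta>0: "0 \<le> \<beta>" using \<beta>(1) by simp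
  have \<gamma>: "0 \<le> ?\<gamma>" "?\<gamma> \<le> 1" using \<beta>(2,4) \<beta>0 by (simp_all add: divide_le_eq_1)
  have finN: "finite {\<pi>. \<pi> permutes N \<and> P \<pi>}" for P using finite_permutations[OF finite_N] by simp
  have Ev_le: "real (card (Ev V R)) \<le> ?\<gamma> ^ e * (q ^ card (H S - V) * sqrt \<beta>0 ^ card V) * fact (n * D)"
    if V: "V \<in> Pow (H S)" "R \<in> ?Rs V" for V R
  proof -
    have finV: "finite V" using V(1) finite_subset[OF _ finite_H, of V S] by blast
    have "card (H S - V) = card (H S) - card V" "card V \<le> card (H S)"
      using V(1) by (auto simp: card_Diff_subset finV card_mono)
    then have cV: "card (H S - V) + card V = ?k * D" using card_H[OF S] by linarith
    have "real (card (Ev V R)) \<le> q ^ card (H S - V) * \<beta> ^ card R * fact (card N)"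
      unfolding Ev_def
    proof (rule card_permutes_repeated[where d = d])
      have "real (card ?Del) = real (m - m') * d" by (simp flip: diff_mult_distrib of_nat_mult)
      then show "real (card ?Del) \<le> q * real (card N)" using q(3) by (simp add: card_N)
      show "card {y \<in> N. y div d = i} \<le> d" for i using card_div_fibre[of m d i] by (simp add: N_def)
      have le: "real (card V) \<le> real ?k * real D"
        using cV by (metis le_add2 of_nat_le_iff of_nat_mult)
      \<comment> \<open>At least half of all half-edges stay free even when all of
        \<open>H S\<close> is revealed; the factor 2 in \<beta> pays for the used ones.\<close>
      define X where "X = real (n * D) - real (card (H S - V)) - real (card V)"
      have "2 * (?k * D) \<le> n * D" using half by simp
      then have "2 * (card (H S - V) + card V) \<le> n * D" by (simp only: cV)
      from of_nat_mono[OF this, where 'a = real] have "real (n * D) \<le> 2 * X"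
        unfolding X_def of_nat_add of_nat_mult of_nat_numeral by argo
      then have "\<beta> * real (n * D) \<le> \<beta> * (2 * X)" by (rule mult_left_mono[OF _ \<beta>0])
      moreover have "\<beta> * real (n * D) = 2 * (real ?k * real D * d)" using n_pos by (simp add: \<beta>(1))
      moreover have "real (card V) * d \<le> real ?k * real D * d" using le by (rule mult_right_mono) simp
      moreover have "\<beta> * (2 * X) = 2 * (\<beta> * X)" by simp
      ultimately have "real (card V) * d \<le> \<beta> * X" by linarith
      then show "real (card V) * real d \<le> \<beta> * (real (card N) - real (card (H S - V)) - real (card V))"
        by (simp only: card_N X_def)
    qed (use V H_subset[of S] q \<beta>0 in auto)
    also have "\<dots> = q ^ card (H S - V) * \<beta> ^ card R * fact (n * D)" by (simp add: card_N)
    also have "\<dots> \<le> q ^ card (H S - V) * (?\<gamma> ^ e * sqrt \<beta>0 ^ card V) * fact (n * D)"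
    proof (intro mult_right_mono mult_left_mono)
      have "\<beta> ^ card R = ?\<gamma> ^ card R * sqrt \<beta>0 ^ (2 * card R)"
        using \<beta>(4) by (simp add: power_mult flip: power_mult_distrib)
      also have "\<dots> \<le> ?\<gamma> ^ e * sqrt \<beta>0 ^ card V"
        using V(2) \<gamma> \<beta>(3,4) by (intro mult_mono power_decreasing) auto
      finally show "\<beta> ^ card R \<le> ?\<gamma> ^ e * sqrt \<beta>0 ^ card V" .
    qed (use q in auto)
    finally show ?thesis by (simp add: mult_ac)
  qed
  have finPow: "finite (Pow (H S))" by simp
  have finRs: "finite (?Rs V)" if "V \<in> Pow (H S)" for V
    using that finite_subset[of V "H S"] by simp
  have "card {\<sigma>. \<sigma> permutes N \<and> single_free \<sigma> S \<and> e \<le> card (Rep \<sigma> S)} \<le>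
    card {\<sigma>. \<sigma> permutes N \<and> (\<exists>V \<in> Pow (H S). \<exists>R \<in> ?Rs V. inv_into UNIV \<sigma> \<in> Ev V R)}"
  proof (rule card_mono[OF finN], clarify)
    fix \<sigma> assume s: "\<sigma> permutes N" "single_free \<sigma> S" "e \<le> card (Rep \<sigma> S)"
    have "inv_into UNIV \<sigma> \<in> Ev (W \<sigma> S) (Rep \<sigma> S)"
      unfolding Ev_def
    proof (intro CollectI conjI ballI)
      show "inv_into UNIV \<sigma> permutes N" by (rule permutes_inv[OF s(1)])
      fix z assume z: "z \<in> H S - W \<sigma> S"
      then have "inv_into UNIV \<sigma> z div d \<ge> m'" by (auto simp: W_def row_of_def)
      then have "m' * d \<le> inv_into UNIV \<sigma> z" using d_pos by (simp add: less_eq_div_iff_mult_less_eq)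
      then show "inv_into UNIV \<sigma> z \<in> ?Del" using permutes_inv_N[OF s(1)] z by (auto simp: H_def)
    next
      fix h assume "h \<in> Rep \<sigma> S"
      then show "\<exists>h' \<in> W \<sigma> S. h' < h \<and> inv_into UNIV \<sigma> h' div d = inv_into UNIV \<sigma> h div d"
        by (auto simp: Rep_def row_of_def)
    qed
    moreover have "W \<sigma> S \<in> Pow (H S)" by (auto simp: W_def)
    moreover have "Rep \<sigma> S \<in> ?Rs (W \<sigma> S)" using card_W_le_Rep[OF s(1,2)] s(3) by (auto simp: Rep_def)
    ultimately show "\<exists>V \<in> Pow (H S). \<exists>R \<in> ?Rs V. inv_into UNIV \<sigma> \<in> Ev V R" by blast
  qed
  also have "\<dots> \<le> card {\<pi>. \<pi> permutes N \<and> (\<exists>V \<in> Pow (H S). \<exists>R \<in> ?Rs V. \<pi> \<in> Ev V R)}"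
    by (rule card_inv_permutes_le) simp
  also have "\<dots> \<le> card (\<Union>V\<in>Pow (H S). \<Union>R\<in>?Rs V. Ev V R)"
  proof (rule card_mono)
    show "finite (\<Union>V\<in>Pow (H S). \<Union>R\<in>?Rs V. Ev V R)"
      using finPow finRs finN by (auto simp: Ev_def)
  qed auto
  also have "\<dots> \<le> (\<Sum>V\<in>Pow (H S). card (\<Union>R\<in>?Rs V. Ev V R))" by (rule card_UN_le[OF finPow])
  also have "\<dots> \<le> (\<Sum>V\<in>Pow (H S). \<Sum>R\<in>?Rs V. card (Ev V R))"
    by (rule sum_mono) (rule card_UN_le, rule finRs)
  finally have "real (card {\<sigma>. \<sigma> permutes N \<and> single_free \<sigma> S \<and> e \<le> card (Rep \<sigma> S)}) \<le>
     (\<Sum>V\<in>Pow (H S). \<Sum>R\<in>?Rs V. real (card (Ev V R)))"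
    by (simp flip: of_nat_sum)
  also have "\<dots> \<le> (\<Sum>V\<in>Pow (H S). \<Sum>R\<in>?Rs V.
     ?\<gamma> ^ e * (q ^ card (H S - V) * sqrt \<beta>0 ^ card V) * fact (n * D))"
    by (intro sum_mono Ev_le)
  also have "\<dots> \<le> (\<Sum>V\<in>Pow (H S). 2 ^ card V * (?\<gamma> ^ e * (q ^ card (H S - V) * sqrt \<beta>0 ^ card V) * fact (n * D)))"
  proof (rule sum_mono)
    fix V assume V: "V \<in> Pow (H S)"
    then have "finite V" using finite_subset[OF _ finite_H, of V S] by blast
    then have "card (?Rs V) \<le> card (Pow V)" by (intro card_mono) auto
    then have "real (card (?Rs V)) \<le> 2 ^ card V" using \<open>finite V\<close> by (simp add: card_Pow flip: of_nat_le_iff)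
    then show "(\<Sum>R\<in>?Rs V. ?\<gamma> ^ e * (q ^ card (H S - V) * sqrt \<beta>0 ^ card V) * fact (n * D)) \<le>
       2 ^ card V * (?\<gamma> ^ e * (q ^ card (H S - V) * sqrt \<beta>0 ^ card V) * fact (n * D))"
      unfolding sum_constant using q \<gamma> \<beta>(4) by (intro mult_right_mono) auto
  qed
  also have "\<dots> = (\<Sum>V\<in>Pow (H S). ?\<gamma> ^ e * fact (n * D) * (q ^ card (H S - V) * (2 * sqrt \<beta>0) ^ card V))"
    by (intro sum.cong refl) (simp add: power_mult_distrib mult_ac)
  also have "\<dots> = ?\<gamma> ^ e * fact (n * D) * (q + 2 * sqrt \<beta>0) ^ (?k * D)"
    unfolding sum_distrib_left[symmetric] sum_Pow_binomial[OF finite_H] card_H[OF S] ..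
  finally show ?thesis by (simp add: mult_ac)
qed

end

section \<open>Large dependencies\<close>

context half_edge_pairing
begin

definition half_edges_of :: "nat set \<Rightarrow> nat set" where
  "half_edges_of I = {h. h < m * d \<and> h div d \<in> I}"

definition row_sum :: "(nat \<Rightarrow> nat) \<Rightarrow> (nat \<Rightarrow> real) \<Rightarrow> nat \<Rightarrow> real" where
  "row_sum \<sigma> x i = sum x (nbrs \<sigma> i)"

definition solves :: "nat set \<Rightarrow> nat set \<Rightarrow> (nat \<Rightarrow> nat) \<Rightarrow> (nat \<Rightarrow> real) \<Rightarrow> bool" where
  "solves S I \<sigma> x \<longleftrightarrow> (\<forall>j. x j \<noteq> 0 \<longleftrightarrow> j \<in> S) \<and> (\<forall>i \<in> I. row_sum \<sigma> x i = 0)"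

text \<open>Meaningful only if a solution exists; it then depends on the partners of the rows in \<open>I\<close> alone.\<close>

definition pick_solution :: "nat set \<Rightarrow> nat set \<Rightarrow> (nat \<Rightarrow> nat) \<Rightarrow> nat \<Rightarrow> real" where
  "pick_solution S I \<sigma> = (SOME x. solves S I \<sigma> x)"

lemma half_edges_of_subset: "half_edges_of I \<subseteq> N" by (auto simp: half_edges_of_def N_def)

lemma finite_half_edges_of [simp]: "finite (half_edges_of I)"
  by (rule finite_subset[OF half_edges_of_subset finite_N])

lemma card_half_edges_of: "finite I \<Longrightarrow> card (half_edges_of I) \<le> card I * d"
proof -
  assume I: "finite I"
  have "half_edges_of I = (\<Union>i\<in>I. {h. h < m * d \<and> h div d = i})" by (auto simp: half_edges_of_def)
  also have "card \<dots> \<le> (\<Sum>i\<in>I. card {h. h < m * d \<and> h div d = i})" by (rule card_UN_le[OF I])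
  also have "\<dots> \<le> (\<Sum>i\<in>I. d)" by (rule sum_mono) (rule card_div_fibre)
  finally show ?thesis by simp
qed

lemma nbrs_cong:
  assumes "\<And>h. h < m * d \<Longrightarrow> h div d = i \<Longrightarrow> \<tau> h = \<sigma> h"
  shows "nbrs \<tau> i = nbrs \<sigma> i"
  unfolding nbrs_def by (rule image_cong) (use assms in auto)

lemma solves_cong:
  assumes "\<And>h. h \<in> half_edges_of I \<Longrightarrow> \<tau> h = \<sigma> h"
  shows "solves S I \<tau> = solves S I \<sigma>"
proof -
  have "nbrs \<tau> i = nbrs \<sigma> i" if "i \<in> I" for i
    by (rule nbrs_cong) (use assms that in \<open>auto simp: half_edges_of_def\<close>)
  then show ?thesis by (auto simp: solves_def row_sum_def fun_eq_iff)
qed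

text \<open>With h = \<open>card S * D\<close>, more than h/2 half-edges of \<open>S\<close> would
  have to fall into \<open>U\<close>, which holds at most 1/16 of all half-edges. There are at most
  2^h such subsets, each of probability at most 16^(- h/2) = 4^(- h).\<close>

lemma card_overloaded:
  assumes S: "S \<subseteq> {..<n}" and U: "U \<subseteq> N" "16 * card U \<le> n * D"
  shows "real (card {\<sigma>. \<sigma> permutes N \<and> card S * D < 2 * card (\<sigma> ` U \<inter> H S)}) \<le>
    (1 / 2) ^ (card S * D) * fact (n * D)"
proof -
  let ?h = "card S * D"
  let ?Vs = "{V \<in> Pow (H S). ?h < 2 * card V}"
  define Ev where "Ev V = {\<pi>. \<pi> permutes N \<and> (\<forall>z \<in> V. \<pi> z \<in> U)}" for V
  have finN: "finite {\<pi>. \<pi> permutes N \<and> P \<pi>}" for P using finite_permutations[OF finite_N] by simp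
  have finU: "finite U" by (rule finite_subset[OF U(1) finite_N])
  have "card {\<sigma>. \<sigma> permutes N \<and> ?h < 2 * card (\<sigma> ` U \<inter> H S)} \<le>
    card {\<sigma>. \<sigma> permutes N \<and> (\<exists>V \<in> ?Vs. inv_into UNIV \<sigma> \<in> Ev V)}"
  proof (rule card_mono[OF finN], clarify)
    fix \<sigma> assume s: "\<sigma> permutes N" "?h < 2 * card (\<sigma> ` U \<inter> H S)"
    have "inv_into UNIV \<sigma> \<in> Ev (\<sigma> ` U \<inter> H S)"
      using permutes_inv[OF s(1)] permutes_inverses(2)[OF s(1)] by (auto simp: Ev_def)
    then show "\<exists>V \<in> ?Vs. inv_into UNIV \<sigma> \<in> Ev V" using s(2) by (intro bexI[of _ "\<sigma> ` U \<inter> H S"]) auto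
  qed
  also have "\<dots> \<le> card {\<pi>. \<pi> permutes N \<and> (\<exists>V \<in> ?Vs. \<pi> \<in> Ev V)}"
    by (rule card_inv_permutes_le) simp
  also have "\<dots> \<le> card (\<Union>V\<in>?Vs. Ev V)"
    by (rule card_mono) (auto simp: Ev_def finN)
  also have "\<dots> \<le> (\<Sum>V\<in>?Vs. card (Ev V))" by (rule card_UN_le) simp
  finally have "real (card {\<sigma>. \<sigma> permutes N \<and> ?h < 2 * card (\<sigma> ` U \<inter> H S)}) \<le> (\<Sum>V\<in>?Vs. real (card (Ev V)))"
    by (simp flip: of_nat_sum)
  also have "\<dots> \<le> (\<Sum>V\<in>?Vs. (1 / 4) ^ ?h * fact (n * D))"
  proof (rule sum_mono)
    fix V assume V: "V \<in> ?Vs"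
    have "real (card (Ev V)) \<le> (1 / 16) ^ card V * fact (card N)"
      unfolding Ev_def
    proof (rule card_permutes_into)
      show "real (card U) \<le> 1 / 16 * real (card N)"
        using of_nat_mono[OF U(2), where 'a = real] by (simp add: card_N)
    qed (use V H_subset[of S] finU in auto)
    also have "(1 / 16 :: real) ^ card V = (1 / 4) ^ (2 * card V)" by (simp add: power_mult power2_eq_square)
    also have "(1 / 4 :: real) ^ (2 * card V) * fact (card N) \<le> (1 / 4) ^ ?h * fact (card N)"
      using V by (intro mult_right_mono power_decreasing) auto
    finally show "real (card (Ev V)) \<le> (1 / 4) ^ ?h * fact (n * D)" by (simp add: card_N)
  qed
  also have "\<dots> = real (card ?Vs) * ((1 / 4) ^ ?h * fact (n * D))" by simp
  also have "\<dots> \<le> 2 ^ ?h * ((1 / 4) ^ ?h * fact (n * D))"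
  proof (rule mult_right_mono)
    have "card ?Vs \<le> card (Pow (H S))" by (rule card_mono) auto
    also have "\<dots> = 2 ^ ?h" by (simp add: card_Pow card_H[OF S])
    finally show "real (card ?Vs) \<le> 2 ^ ?h" by (simp flip: of_nat_le_iff)
  qed simp
  also have "\<dots> = (1 / 2) ^ ?h * fact (n * D)" by (simp add: power_divide field_simps flip: power_mult_distrib)
  finally show ?thesis .
qed

text \<open>The load is measured on all of \<open>I \<union> J\<close>, so that it also bounds what
  is used up at every earlier stage of an induction over \<open>J\<close>.\<close>

definition good_rows :: "nat set \<Rightarrow> nat set \<Rightarrow> nat set \<Rightarrow> (nat \<Rightarrow> nat) set" where
  "good_rows S I J = {\<sigma>. \<sigma> permutes N \<and> 2 * card (\<sigma> ` half_edges_of (I \<union> J) \<inter> H S) \<le> card S * D \<and>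
     (\<exists>x. solves S I \<sigma> x) \<and> (\<forall>i \<in> J. row_sum \<sigma> (pick_solution S I \<sigma>) i = 0)}"

text \<open>Once the rows of \<open>I\<close> are revealed, the picked solution is a fixed vector
  and each row of \<open>J\<close> is a fresh sample. The load condition leaves at least half of the
  half-edges of \<open>S\<close> free, so at least the proportion \<epsilon>/d of the free
  half-edges meets the support, and \<open>card_zero_row\<close> gives the factor for one
  row.\<close>

lemma card_good_rows:
  fixes \<epsilon> \<rho> :: real
  defines "\<rho> \<equiv> (1 + exp (- \<epsilon>)) / 2"
  assumes S: "S \<subseteq> {..<n}" and \<epsilon>: "0 < \<epsilon>" "\<epsilon> \<le> 1 / 2" "2 * \<epsilon> * n \<le> real (card S) * d"
    and fin: "finite I" "finite J" and IJ: "I \<inter> J = {}" "I \<union> J \<subseteq> {..<m}" "16 * card (I \<union> J) \<le> m"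
    and large: "8 * (real d)\<^sup>2 \<le> (1 - \<rho>) * n"
  shows "real (card (good_rows S I J)) \<le> ((1 + \<rho>) / 2) ^ card J * fact (n * D)"
  using fin(2) IJ
proof (induction J rule: finite_induct)
  case empty
  have "card (good_rows S I {}) \<le> card {\<sigma>. \<sigma> permutes N}"
    by (rule card_mono) (auto simp: good_rows_def finite_permutations)
  also have "\<dots> = fact (n * D)" by (simp add: card_permutations card_N)
  finally have "card (good_rows S I {}) \<le> fact (n * D)" .
  from of_nat_mono[OF this, where 'a = real] show ?case by simp
next
  case (insert j J)
  have \<rho>: "0 < \<rho>" "\<rho> < 1" using \<epsilon>(1) by (auto simp: \<rho>_def add_pos_pos)
  let ?U = "half_edges_of (I \<union> J)"
  let ?X = "pick_solution S I"
  let ?bs = "[j * d..<j * d + d]"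
  have jm: "j < m" "j \<notin> I \<union> J" using insert by auto
  have "(j + 1) * d \<le> m * d" using jm(1) by (intro mult_le_mono1) simp
  then have jd: "j * d + d \<le> m * d" by simp
  have block: "{h. h < m * d \<and> h div d = j} = set ?bs"
  proof (intro equalityI subsetI)
    fix h assume "h \<in> {h. h < m * d \<and> h div d = j}"
    then have "h = j * d + h mod d" "h mod d < d" using d_pos div_mult_mod_eq[of h d] by auto
    then show "h \<in> set ?bs" by auto
  next
    fix h assume "h \<in> set ?bs"
    then have "h = j * d + (h - j * d)" "h - j * d < d" "h < m * d" using jd by auto
    moreover have "(j * d + r) div d = j" if "r < d" for r using that by simp
    ultimately have "h div d = j" "h < m * d" by metis+
    then show "h \<in> {h. h < m * d \<and> h div d = j}" by simp
  qed
  have cU: "2 * card ?U \<le> n * D"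
  proof -
    have "card (I \<union> J) \<le> card (I \<union> insert j J)" by (rule card_mono) (use insert fin in auto)
    then have "16 * card (I \<union> J) \<le> m" using insert.prems(3) by linarith
    then have "16 * card (I \<union> J) * d \<le> m * d" by (rule mult_le_mono1)
    moreover have "card ?U \<le> card (I \<union> J) * d" by (rule card_half_edges_of) (use insert fin in auto)
    ultimately show ?thesis using half_edges by linarith
  qed
  \<comment> \<open>The half-edges of \<open>I\<close> are among those of
    \<open>I \<union> J\<close>, so the picked solution is constant on each class.\<close>
  have X_cong: "?X \<tau> = ?X \<sigma>" "(\<exists>x. solves S I \<tau> x) = (\<exists>x. solves S I \<sigma> x)" if "\<forall>u\<in>?U. \<tau> u = \<sigma> u" for \<tau> \<sigma>
  proof -
    have "solves S I \<tau> = solves S I \<sigma>"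
      by (rule solves_cong) (use that in \<open>auto simp: half_edges_of_def\<close>)
    then show "?X \<tau> = ?X \<sigma>" "(\<exists>x. solves S I \<tau> x) = (\<exists>x. solves S I \<sigma> x)" by (simp_all add: pick_solution_def)
  qed
  have "real (card (good_rows S I J \<inter> {\<sigma>. row_sum \<sigma> (?X \<sigma>) j = 0})) \<le> (1 + \<rho>) / 2 * card (good_rows S I J)"
  proof (rule permutes_reveal_list[where N = N and U = ?U and bs = ?bs
        and L = "\<lambda>\<pi>. {ys. (\<Sum>c \<in> (\<lambda>y. y div D) ` set ys. ?X \<pi> c) = 0}"])
    show "determined_on N ?U (good_rows S I J)"
      unfolding determined_on_def
    proof (intro allI impI, elim conjE)
      fix \<pi> \<tau> assume a: "\<tau> permutes N" "\<forall>u\<in>?U. \<tau> u = \<pi> u" "\<pi> \<in> good_rows S I J"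
      have "\<tau> ` ?U = \<pi> ` ?U" by (rule image_cong) (use a in auto)
      moreover have "nbrs \<tau> i = nbrs \<pi> i" if "i \<in> J" for i
        by (rule nbrs_cong) (use a(2) that in \<open>auto simp: half_edges_of_def\<close>)
      then have "row_sum \<tau> x i = row_sum \<pi> x i" if "i \<in> J" for i x using that by (simp add: row_sum_def)
      ultimately show "\<tau> \<in> good_rows S I J"
        using a(1,3) X_cong[OF a(2)] by (simp add: good_rows_def)
    qed
    show "good_rows S I J \<subseteq> {\<pi>. \<pi> permutes N}" by (auto simp: good_rows_def)
    have "set ?bs \<subseteq> N" using jd by (auto simp: N_def)
    moreover have "h \<notin> ?U" if "h \<in> set ?bs" for h
      using that jm(2) unfolding block[symmetric] half_edges_of_def by blast
    ultimately show "set ?bs \<subseteq> N - ?U" by blast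
    show "map \<tau> ?bs \<in> {ys. (\<Sum>c \<in> (\<lambda>y. y div D) ` set ys. ?X \<pi> c) = 0}"
      if "\<tau> \<in> perm_class N ?U \<pi>" "\<tau> \<in> {\<sigma>. row_sum \<sigma> (?X \<sigma>) j = 0}" for \<pi> \<tau>
    proof -
      have "?X \<tau> = ?X \<pi>" by (rule X_cong) (use that(1) in \<open>simp add: perm_class_def\<close>)
      moreover have "nbrs \<tau> j = (\<lambda>y. y div D) ` set (map \<tau> ?bs)"
        unfolding nbrs_def block by (simp add: image_image)
      ultimately show ?thesis using that(2) by (simp add: row_sum_def)
    qed
    fix \<pi> assume p: "\<pi> \<in> good_rows S I J"
    then have pN: "\<pi> permutes N" and load: "2 * card (\<pi> ` ?U \<inter> H S) \<le> card S * D"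
      by (auto simp: good_rows_def)
    let ?Q = "N - \<pi> ` ?U"
    have "\<exists>x. solves S I \<pi> x" using p by (simp add: good_rows_def)
    then have "solves S I \<pi> (?X \<pi>)" unfolding pick_solution_def by (rule someI_ex)
    then have X: "?X \<pi> c = 0 \<longleftrightarrow> c \<notin> S" for c by (auto simp: solves_def)
    have img: "\<pi> ` ?U \<subseteq> N" using image_mono[OF half_edges_of_subset, of \<pi>] permutes_image[OF pN] by simp
    have cimg: "card (\<pi> ` ?U) = card ?U"
      by (rule card_image, rule inj_on_subset[OF permutes_inj[OF pN]]) simp
    have cQ: "card ?Q = n * D - card ?U" using img cimg by (simp add: card_Diff_subset card_N)
    have zset: "{y \<in> ?Q. ?X \<pi> (y div D) = 0} = ?Q - H S" by (auto simp: X H_def N_def)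
    have HQ: "card S * D \<le> 2 * card (?Q \<inter> H S)"
    proof -
      have "H S = (\<pi> ` ?U \<inter> H S) \<union> (?Q \<inter> H S)" using H_subset by blast
      then have "card (H S) = card ((\<pi> ` ?U \<inter> H S) \<union> (?Q \<inter> H S))" by (rule arg_cong)
      also have "\<dots> \<le> card (\<pi> ` ?U \<inter> H S) + card (?Q \<inter> H S)" by (rule card_Un_le)
      finally have "card (H S) \<le> card (\<pi> ` ?U \<inter> H S) + card (?Q \<inter> H S)" .
      then show ?thesis using load card_H[OF S] by linarith
    qed
    have Qle: "card ?Q \<le> n * D" using cQ by simp
    have len: "length ?bs = d" by simp
    show "real (card {ys \<in> {ys. (\<Sum>c \<in> (\<lambda>y. y div D) ` set ys. ?X \<pi> c) = 0}. length ys = length ?bs \<and> distinct ys \<and> set ys \<subseteq> ?Q})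
      \<le> (1 + \<rho>) / 2 * card {ys. length ys = length ?bs \<and> distinct ys \<and> set ys \<subseteq> ?Q}"
      unfolding len \<rho>_def
    proof (rule card_zero_row[where c = D])
      have "card (?Q - H S) + card (?Q \<inter> H S) = card ?Q"
        using card_Diff_subset_Int[of ?Q "H S"] card_mono[of ?Q "?Q \<inter> H S"] by simp
      then have 1: "real (card (?Q - H S)) = real (card ?Q) - real (card (?Q \<inter> H S))" by linarith
      \<comment> \<open>At most n D half-edges are free, among them at least half of the
        \<open>card S * D\<close> ones of \<open>S\<close>; the assumption on 2 \<epsilon> n
        compares these two numbers.\<close>
      have "\<epsilon> / d * card ?Q \<le> \<epsilon> / d * (real n * D)"
        using Qle \<epsilon>(1) by (intro mult_left_mono) (simp_all flip: of_nat_mult)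
      also have "\<dots> = (\<epsilon> * n / d) * D" by simp
      also have "\<dots> \<le> (real (card S) / 2) * D"
        using \<epsilon>(3) d_pos by (intro mult_right_mono) (auto simp: field_simps)
      also have "\<dots> \<le> card (?Q \<inter> H S)" using of_nat_mono[OF HQ, where 'a = real] by simp
      finally have 2: "\<epsilon> / d * card ?Q \<le> card (?Q \<inter> H S)" .
      show "real (card {y \<in> ?Q. ?X \<pi> (y div D) = 0}) \<le> (1 - \<epsilon> / d) * card ?Q"
        unfolding zset 1 left_diff_distrib using 2 by simp
      show "card {y \<in> ?Q. y div D = v} \<le> D" for v
      proof -
        have "card {y \<in> ?Q. y div D = v} \<le> card {y. y < n * D \<and> y div D = v}"
          by (rule card_mono) (auto simp: N_def half_edges)
        also have "\<dots> \<le> D" by (rule card_div_fibre)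
        finally show ?thesis .
      qed
      have "n * D \<le> 2 * card ?Q" using cQ cU by linarith
      from of_nat_mono[OF this, where 'a = real] have nD: "real n * D \<le> 2 * real (card ?Q)" by simp
      have "8 * (real d)\<^sup>2 * D \<le> (1 - \<rho>) * n * D" using large by (rule mult_right_mono) simp
      also have "\<dots> \<le> (1 - \<rho>) * (2 * real (card ?Q))"
        using nD \<rho> by (simp only: mult.assoc) (intro mult_left_mono, auto)
      finally have "8 * (real d)\<^sup>2 * D \<le> 2 * ((1 - \<rho>) * real (card ?Q))" by simp
      then show "4 * (real d)\<^sup>2 * D \<le> (1 - (1 + exp (- \<epsilon>)) / 2) * card ?Q"
        unfolding \<rho>_def[symmetric] by linarith
    qed (use d_pos D_pos \<epsilon> in auto)
  qed (use \<rho> half_edges_of_subset in auto)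
  also have "\<dots> \<le> (1 + \<rho>) / 2 * (((1 + \<rho>) / 2) ^ card J * fact (n * D))"
  proof (rule mult_left_mono)
    have "card (I \<union> J) \<le> card (I \<union> insert j J)" by (rule card_mono) (use insert fin in auto)
    then show "real (card (good_rows S I J)) \<le> ((1 + \<rho>) / 2) ^ card J * fact (n * D)"
      using insert.prems by (intro insert.IH) auto
  qed (use \<rho> in simp)
  finally have le: "real (card (good_rows S I J \<inter> {\<sigma>. row_sum \<sigma> (?X \<sigma>) j = 0})) \<le>
    ((1 + \<rho>) / 2) ^ card (insert j J) * fact (n * D)"
    using insert.hyps by (simp add: mult.assoc)
  have "good_rows S I (insert j J) \<subseteq> good_rows S I J \<inter> {\<sigma>. row_sum \<sigma> (?X \<sigma>) j = 0}"
  proof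
    fix \<sigma> assume s: "\<sigma> \<in> good_rows S I (insert j J)"
    have "card (\<sigma> ` ?U \<inter> H S) \<le> card (\<sigma> ` half_edges_of (I \<union> insert j J) \<inter> H S)"
      by (rule card_mono) (auto simp: half_edges_of_def)
    then show "\<sigma> \<in> good_rows S I J \<inter> {\<sigma>. row_sum \<sigma> (?X \<sigma>) j = 0}"
      using s by (auto simp: good_rows_def)
  qed
  then have "card (good_rows S I (insert j J)) \<le> card (good_rows S I J \<inter> {\<sigma>. row_sum \<sigma> (?X \<sigma>) j = 0})"
    by (rule card_mono[rotated]) (auto simp: good_rows_def finite_permutations)
  then show ?case using le by linarith
qed

definition large_dependency :: "nat set \<Rightarrow> (nat \<Rightarrow> nat) set" where
  "large_dependency S = {\<sigma>. \<sigma> permutes N \<and> (\<exists>x. solves S {..<m'} \<sigma> x)}"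

text \<open>Every vector with support \<open>S\<close> that solves the generating rows
  \<open>I\<close> solves all kept rows, so the picked one does, whichever it is. The m div 32 test
  rows are a function of \<open>I\<close>, so that the union runs over \<open>I\<close> alone;
  \<open>32 * n \<le> m\<close> keeps \<open>I\<close> and the test rows together below m /
  16.\<close>

lemma card_large_dependency:
  fixes \<epsilon> \<rho> :: real
  defines "\<rho> \<equiv> (1 + exp (- \<epsilon>)) / 2"
  assumes S: "S \<subseteq> {..<n}" and \<epsilon>: "0 < \<epsilon>" "\<epsilon> \<le> 1 / 2" "2 * \<epsilon> * n \<le> real (card S) * d"
    and large: "8 * (real d)\<^sup>2 \<le> (1 - \<rho>) * n"
    and mm: "m \<le> 2 * m'" "32 * n \<le> m"
  shows "real (card (large_dependency S)) \<le>
    real (card {I. I \<subseteq> {..<m'} \<and> card I \<le> n}) *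
      (((1 / 2) ^ (card S * D) + ((1 + \<rho>) / 2) ^ (m div 32)) * fact (n * D))"
proof -
  let ?Is = "{I. I \<subseteq> {..<m'} \<and> card I \<le> n}"
  define J where "J I = (SOME J. J \<subseteq> {..<m'} - I \<and> card J = m div 32)" for I
  have J: "J I \<subseteq> {..<m'} - I" "card (J I) = m div 32" if "I \<in> ?Is" for I
  proof -
    have "finite I" using that finite_subset by blast
    then have "card ({..<m'} - I) = m' - card I" using that by (simp add: card_Diff_subset)
    moreover have "32 * (m div 32) \<le> m" "card I \<le> n" using that by simp_all
    ultimately have "m div 32 \<le> card ({..<m'} - I)" using mm by linarith
    then obtain T where "T \<subseteq> {..<m'} - I" "card T = m div 32" by (rule obtain_subset_with_card_n)
    then have "\<exists>J. J \<subseteq> {..<m'} - I \<and> card J = m div 32" by blast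
    then have "J I \<subseteq> {..<m'} - I \<and> card (J I) = m div 32" unfolding J_def by (rule someI_ex)
    then show "J I \<subseteq> {..<m'} - I" "card (J I) = m div 32" by auto
  qed
  let ?U = "\<lambda>I. half_edges_of (I \<union> J I)"
  let ?Ov = "\<lambda>I. {\<sigma>. \<sigma> permutes N \<and> card S * D < 2 * card (\<sigma> ` ?U I \<inter> H S)}"
  have finS: "finite S" using S finite_subset by blast
  have cS: "card S \<le> n" using card_mono[OF _ S] by simp
  have sub: "large_dependency S \<subseteq> (\<Union>I\<in>?Is. ?Ov I \<union> good_rows S I (J I))"
  proof
    fix \<sigma> assume "\<sigma> \<in> large_dependency S"
    then obtain x where s: "\<sigma> permutes N" "solves S {..<m'} \<sigma> x" by (auto simp: large_dependency_def)
    let ?a = "\<lambda>i j. if j \<in> nbrs \<sigma> i then 1 else 0 :: real"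
    have rs: "row_sum \<sigma> y i = (\<Sum>j\<in>S. ?a i j * y j)" if "\<forall>j. y j \<noteq> 0 \<longleftrightarrow> j \<in> S" for y i
    proof -
      have "(\<Sum>j\<in>S. ?a i j * y j) = (\<Sum>j\<in>S. if j \<in> nbrs \<sigma> i then y j else 0)" by (rule sum.cong) auto
      also have "\<dots> = sum y (S \<inter> nbrs \<sigma> i)" using finS by (rule sum.inter_restrict[symmetric])
      also have "\<dots> = sum y (nbrs \<sigma> i)" by (rule sum.mono_neutral_left) (use that in auto)
      finally show ?thesis by (simp add: row_sum_def)
    qed
    obtain I where I: "I \<subseteq> {..<m'}" "finite I" "card I \<le> card S"
      "\<And>y. \<forall>i\<in>I. (\<Sum>j\<in>S. ?a i j * y j) = 0 \<Longrightarrow> \<forall>i\<in>{..<m'}. (\<Sum>j\<in>S. ?a i j * y j) = 0"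
      using row_basis_exists[OF finS, of "{..<m'}" ?a] by blast
    have II: "I \<in> ?Is" using I cS by auto
    have ext: "solves S {..<m'} \<sigma> y" if "solves S I \<sigma> y" for y
      using that I(4)[of y] rs[of y] unfolding solves_def by simp
    have "solves S I \<sigma> x" using s(2) I(1) by (auto simp: solves_def)
    then have ex: "\<exists>x. solves S I \<sigma> x" by blast
    then have "solves S I \<sigma> (pick_solution S I \<sigma>)" unfolding pick_solution_def by (rule someI_ex)
    then have "solves S {..<m'} \<sigma> (pick_solution S I \<sigma>)" by (rule ext)
    then have "\<forall>i \<in> J I. row_sum \<sigma> (pick_solution S I \<sigma>) i = 0" using J(1)[OF II] by (auto simp: solves_def)
    then have "\<sigma> \<in> ?Ov I \<union> good_rows S I (J I)" using s(1) ex by (auto simp: good_rows_def)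
    then show "\<sigma> \<in> (\<Union>I\<in>?Is. ?Ov I \<union> good_rows S I (J I))" using II by blast
  qed
  have finIs: "finite ?Is" by simp
  have finEv: "finite (?Ov I \<union> good_rows S I (J I))" for I
    using finite_permutations[OF finite_N] by (simp add: good_rows_def)
  have each: "real (card (?Ov I \<union> good_rows S I (J I))) \<le>
      ((1 / 2) ^ (card S * D) + ((1 + \<rho>) / 2) ^ (m div 32)) * fact (n * D)" if I: "I \<in> ?Is" for I
  proof -
    have fin: "finite I" "finite (J I)" using I J(1)[OF I] finite_subset by blast+
    have cIJ: "16 * card (I \<union> J I) \<le> m"
    proof -
      have "card (I \<union> J I) \<le> card I + card (J I)" by (rule card_Un_le)
      moreover have "32 * card I \<le> m" using I mm by simp
      moreover have "32 * card (J I) \<le> m" using J(2)[OF I] by simp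
      ultimately show ?thesis by linarith
    qed
    have "card (?U I) \<le> card (I \<union> J I) * d" by (rule card_half_edges_of) (use fin in auto)
    moreover have "16 * card (I \<union> J I) * d \<le> m * d" using cIJ by (rule mult_le_mono1)
    ultimately have cU: "16 * card (?U I) \<le> n * D" using half_edges by linarith
    have "real (card (good_rows S I (J I))) \<le> ((1 + \<rho>) / 2) ^ card (J I) * fact (n * D)"
      unfolding \<rho>_def
    proof (rule card_good_rows[OF S \<epsilon> fin])
      show "I \<union> J I \<subseteq> {..<m}" using I J(1)[OF I] kept by fastforce
    qed (use J(1)[OF I] cIJ large in \<open>auto simp: \<rho>_def\<close>)
    moreover have "real (card (?Ov I)) \<le> (1 / 2) ^ (card S * D) * fact (n * D)"
      by (rule card_overloaded[OF S half_edges_of_subset cU])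
    moreover have "real (card (?Ov I \<union> good_rows S I (J I))) \<le> real (card (?Ov I)) + real (card (good_rows S I (J I)))"
      using of_nat_mono[OF card_Un_le, where 'a = real] by simp
    ultimately show ?thesis using J(2)[OF I] by (simp add: distrib_right)
  qed
  have "card (large_dependency S) \<le> card (\<Union>I\<in>?Is. ?Ov I \<union> good_rows S I (J I))"
    by (rule card_mono[OF finite_UN_I[OF finIs finEv] sub])
  also have "\<dots> \<le> (\<Sum>I\<in>?Is. card (?Ov I \<union> good_rows S I (J I)))" by (rule card_UN_le[OF finIs])
  finally have "real (card (large_dependency S)) \<le> (\<Sum>I\<in>?Is. real (card (?Ov I \<union> good_rows S I (J I))))"
    by (simp flip: of_nat_sum)
  also have "\<dots> \<le> (\<Sum>I\<in>?Is. ((1 / 2) ^ (card S * D) + ((1 + \<rho>) / 2) ^ (m div 32)) * fact (n * D))"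
    by (rule sum_mono) (rule each)
  finally show ?thesis by simp
qed

end

section \<open>From half-edges to the random matrix\<close>

lemma bij_betw_pick:
  assumes "finite S"
  shows "bij_betw (pick S) {..<card S} S"
  unfolding bij_betw_def
proof
  show "inj_on (pick S) {..<card S}"
  proof (rule inj_onI)
    fix a b assume "a \<in> {..<card S}" "b \<in> {..<card S}" "pick S a = pick S b"
    then show "a = b"
      using pick_mono_le[of a S b] pick_mono_le[of b S a] by (cases a b rule: linorder_cases) auto
  qed
  show "pick S ` {..<card S} = S"
  proof (intro equalityI subsetI)
    fix x assume x: "x \<in> S"
    have "card {a \<in> S. a < x} < card S"
      by (rule psubset_card_mono) (use assms x in auto)
    then show "x \<in> pick S ` {..<card S}"
      using pick_card_in_set[OF x] by (intro image_eqI[of _ _ "card {a \<in> S. a < x}"]) auto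
  qed (use pick_in_set_le in auto)
qed

context half_edge_pairing
begin

lemma dim_A [simp]: "dim_row (A \<sigma>) = m'" "dim_col (A \<sigma>) = n"
proof -
  have "{i. i < m \<and> i < m'} = {..<m'}" using kept by auto
  then show "dim_row (A \<sigma>) = m'" "dim_col (A \<sigma>) = n"
    by (simp_all add: A_def dim_submatrix pairing_matrix_def)
qed

lemma A_entry:
  assumes "i < m'" "j < n"
  shows "A \<sigma> $$ (i, j) = (if j \<in> nbrs \<sigma> i then 1 else 0)"
proof -
  let ?P = "pairing_matrix m n d D \<sigma>"
  have "submatrix ?P {..<m'} UNIV $$ (card {a \<in> {..<m'}. a < i}, card {a \<in> UNIV. a < j}) = ?P $$ (i, j)"
    by (rule submatrix_index_card) (use assms kept in \<open>auto simp: pairing_matrix_def\<close>)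
  moreover have "{a \<in> {..<m'}. a < i} = {..<i}" "{a \<in> UNIV. a < j} = {..<j}" using assms by auto
  ultimately have "A \<sigma> $$ (i, j) = ?P $$ (i, j)" by (simp add: A_def)
  also have "\<dots> = (if j \<in> nbrs \<sigma> i then 1 else 0)"
    using assms kept by (auto simp: pairing_matrix_def nbrs_def)
  finally show ?thesis .
qed

lemma A_row_sum:
  assumes "\<sigma> permutes N" "i < m'"
  shows "(\<Sum>j<n. A \<sigma> $$ (i, j) * y j) = row_sum \<sigma> y i"
proof -
  have "(\<Sum>j<n. A \<sigma> $$ (i, j) * y j) = (\<Sum>j<n. if j \<in> nbrs \<sigma> i then y j else 0)"
    by (rule sum.cong) (use assms A_entry in auto)
  also have "\<dots> = sum y ({..<n} \<inter> nbrs \<sigma> i)" by (rule sum.inter_restrict[symmetric]) simp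
  also have "{..<n} \<inter> nbrs \<sigma> i = nbrs \<sigma> i" using nbrs_subset[OF assms(1)] by blast
  finally show ?thesis by (simp add: row_sum_def)
qed

text \<open>Entries beyond the dimension of a vector are unspecified; the extension by 0 makes the
  support exact.\<close>

lemma kernel_vector_solves:
  assumes "\<sigma> permutes N" "v \<in> mat_kernel (A \<sigma>)"
  shows "solves (supp_vec v) {..<m'} \<sigma> (\<lambda>j. if j < n then v $ j else 0)"
proof -
  have v: "dim_vec v = n" "\<And>i. i < m' \<Longrightarrow> (\<Sum>j<n. A \<sigma> $$ (i, j) * v $ j) = 0"
    using assms(2) by (auto simp: mat_kernel_iff)
  have "row_sum \<sigma> (\<lambda>j. if j < n then v $ j else 0) i = 0" if "i < m'" for i
  proof -
    have "row_sum \<sigma> (\<lambda>j. if j < n then v $ j else 0) i = (\<Sum>j<n. A \<sigma> $$ (i, j) * (if j < n then v $ j else 0))"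
      by (rule A_row_sum[OF assms(1) that, symmetric])
    also have "\<dots> = (\<Sum>j<n. A \<sigma> $$ (i, j) * v $ j)" by (rule sum.cong) auto
    finally show ?thesis using v(2)[OF that] by simp
  qed
  then show ?thesis using v(1) by (auto simp: solves_def supp_vec_def)
qed

lemma solves_single_free:
  assumes "solves S {..<m'} \<sigma> y"
  shows "single_free \<sigma> S"
  unfolding single_free_def
proof (intro allI impI notI)
  fix i assume i: "i < m'" "card (nbrs \<sigma> i \<inter> S) = 1"
  then obtain j where j: "nbrs \<sigma> i \<inter> S = {j}" by (meson card_1_singletonE)
  have "row_sum \<sigma> y i = sum y (nbrs \<sigma> i \<inter> S)"
    unfolding row_sum_def
    by (rule sum.mono_neutral_right) (use assms in \<open>auto simp: solves_def\<close>)
  also have "\<dots> = y j" by (simp add: j)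
  finally show False using assms i(1) j by (auto simp: solves_def)
qed

text \<open>An entry of y + c z with z j non-zero cancels only for c = - y j / z j, and a real c can
  avoid finitely many values.\<close>

lemma solves_Un:
  assumes "solves S I \<sigma> y" "solves T I \<sigma> z" "finite S" "finite T"
  shows "\<exists>w. solves (S \<union> T) I \<sigma> w"
proof -
  have "finite ({0} \<union> (\<lambda>j. - y j / z j) ` (S \<union> T))" using assms by simp
  then obtain c where c: "c \<notin> {0} \<union> (\<lambda>j. - y j / z j) ` (S \<union> T)"
    using ex_new_if_finite[OF infinite_UNIV_char_0] by blast
  have "y j + c * z j \<noteq> 0 \<longleftrightarrow> j \<in> S \<union> T" for j
  proof (cases "j \<in> S \<union> T")
    case True
    show ?thesis
    proof (cases "j \<in> T")
      case jT: True
      then have "z j \<noteq> 0" using assms(2) by (auto simp: solves_def)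
      moreover have "c \<noteq> - y j / z j" using c True by blast
      ultimately show ?thesis using True by (auto simp: field_simps add_eq_0_iff)
    next
      case False
      then have "z j = 0" "y j \<noteq> 0" using assms(1,2) True by (auto simp: solves_def)
      then show ?thesis using True by simp
    qed
  next
    case False
    then have "z j = 0" "y j = 0" using assms(1,2) by (auto simp: solves_def)
    then show ?thesis using False by simp
  qed
  moreover have "row_sum \<sigma> (\<lambda>j. y j + c * z j) i = 0" if "i \<in> I" for i
    using assms(1,2) that by (simp add: solves_def row_sum_def sum.distrib flip: sum_distrib_left)
  ultimately have "solves (S \<union> T) I \<sigma> (\<lambda>j. y j + c * z j)" by (simp add: solves_def)
  then show ?thesis by blast
qed

text \<open>There are finitely many supports, so \<open>solves_Un\<close> can be iterated, starting
  with the zero vector.\<close>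

lemma kernel_support_solves:
  assumes "\<sigma> permutes N"
  shows "\<exists>w. solves (\<Union>v \<in> mat_kernel (A \<sigma>). supp_vec v) {..<m'} \<sigma> w"
proof -
  let ?F = "supp_vec ` mat_kernel (A \<sigma>)"
  have sub: "S \<subseteq> {..<n}" if "S \<in> ?F" for S
    using that by (auto simp: mat_kernel_iff supp_vec_def)
  have "finite ?F" by (rule finite_subset[of _ "Pow {..<n}"]) (use sub in auto)
  moreover have "\<exists>w. solves (\<Union>G) {..<m'} \<sigma> w" if "finite G" "G \<subseteq> ?F" for G
    using that
  proof (induction G rule: finite_induct)
    case empty
    have "solves (\<Union>{}) {..<m'} \<sigma> (\<lambda>_. 0)" by (simp add: solves_def row_sum_def)
    then show ?case by blast
  next
    case (insert S G)
    then obtain w where w: "solves (\<Union>G) {..<m'} \<sigma> w" by auto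
    obtain v where v: "v \<in> mat_kernel (A \<sigma>)" "S = supp_vec v" using insert.prems by auto
    have "finite S" using sub[of S] insert.prems finite_subset[of S "{..<n}"] by blast
    moreover have "\<Union>G \<subseteq> {..<n}"
    proof
      fix j assume "j \<in> \<Union>G"
      then obtain T where "T \<in> G" "j \<in> T" by blast
      then show "j \<in> {..<n}" using sub[of T] insert.prems by blast
    qed
    ultimately have "\<exists>w. solves (S \<union> \<Union>G) {..<m'} \<sigma> w"
      using solves_Un[OF kernel_vector_solves[OF assms v(1)] w] v(2) finite_subset[of "\<Union>G" "{..<n}"] by auto
    then show ?case by simp
  qed
  ultimately show ?thesis by blast
qed

lemma submatrix_facts:
  assumes s: "\<sigma> permutes N" and S: "S \<subseteq> {..<n}"
  defines "M \<equiv> submatrix (A \<sigma>) UNIV S"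
  shows "M \<in> zero_one_mats (card S)"
    and "card (nonzero_rows M) = card {i. i < m' \<and> nbrs \<sigma> i \<inter> S \<noteq> {}}"
    and "num_ones M \<le> card (W \<sigma> S)"
    and "minimal_dependency M \<Longrightarrow> S \<noteq> {} \<and> (\<exists>y. solves S {..<m'} \<sigma> y)"
proof -
  have finS: "finite S" using S finite_subset by blast
  have eqS: "{j. j < n \<and> j \<in> S} = S" using S by auto
  have dr: "dim_row M = m'" and dc: "dim_col M = card S"
    by (simp_all add: M_def dim_submatrix eqS)
  have pickS: "pick S j \<in> S" "pick S j < n" if "j < card S" for j
    using pick_in_set_le[OF that] S by auto
  have bij: "bij_betw (pick S) {..<card S} S" by (rule bij_betw_pick[OF finS])
  have entry: "M $$ (i, j) = (if pick S j \<in> nbrs \<sigma> i then 1 else 0)" if ij: "i < m'" "j < card S" for i j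
  proof -
    have "M $$ (i, j) = A \<sigma> $$ (pick UNIV i, pick S j)"
      unfolding M_def by (rule submatrix_index) (use ij eqS in auto)
    then show ?thesis using A_entry[OF ij(1) pickS(2)[OF ij(2)], of \<sigma>] by (simp add: pick_UNIV)
  qed
  show M01: "M \<in> zero_one_mats (card S)"
    unfolding zero_one_mats_def using dc entry dr by (auto simp: elements_mat_def)
  have rs: "pick S ` row_supp M i = nbrs \<sigma> i \<inter> S" if "i < m'" for i
  proof -
    have "row_supp M i = {j \<in> {..<card S}. pick S j \<in> nbrs \<sigma> i}"
      using entry[OF that] dc by (auto simp: row_supp_def split: if_splits)
    then have "pick S ` row_supp M i = nbrs \<sigma> i \<inter> pick S ` {..<card S}" by auto
    then show ?thesis using bij by (simp add: bij_betw_def)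
  qed
  have crs: "card (row_supp M i) = card (nbrs \<sigma> i \<inter> S)" if "i < m'" for i
    unfolding rs[OF that, symmetric]
    by (rule card_image[symmetric], rule inj_on_subset[OF bij_betw_imp_inj_on[OF bij]])
      (auto simp: row_supp_def dc)
  have nzr: "nonzero_rows M = {i. i < m' \<and> nbrs \<sigma> i \<inter> S \<noteq> {}}"
    using rs dr by (force simp: nonzero_rows_def)
  then show "card (nonzero_rows M) = card {i. i < m' \<and> nbrs \<sigma> i \<inter> S \<noteq> {}}" by simp
  have "num_ones M = (\<Sum>i\<in>nonzero_rows M. card (row_supp M i))" by (rule num_ones_eq_sum[OF M01])
  also have "\<dots> = (\<Sum>i\<in>nonzero_rows M. card (nbrs \<sigma> i \<inter> S))"
    by (rule sum.cong) (use crs nzr in auto)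
  also have "\<dots> \<le> (\<Sum>i<m'. card (nbrs \<sigma> i \<inter> S))" by (rule sum_mono2) (use nzr in auto)
  also have "\<dots> \<le> card (W \<sigma> S)" by (rule card_W_rows[OF s])
  finally show "num_ones M \<le> card (W \<sigma> S)" .
  show "S \<noteq> {} \<and> (\<exists>y. solves S {..<m'} \<sigma> y)" if md: "minimal_dependency M"
  proof
    have "card S > 0" using md unfolding minimal_dependency_def dc by linarith
    then show "S \<noteq> {}" by auto
    obtain x where x: "x \<in> mat_kernel M" "supp_vec x = {..<card S}"
      using md unfolding minimal_dependency_def dc by blast
    define y where "y j = (if j \<in> S then x $ the_inv_into {..<card S} (pick S) j else 0)" for j
    have inj: "inj_on (pick S) {..<card S}" using bij by (simp add: bij_betw_def)
    have yp: "y (pick S j) = x $ j" if "j < card S" for j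
      using that pickS(1) the_inv_into_f_f[OF inj, of j] by (simp add: y_def)
    have supp: "y j \<noteq> 0 \<longleftrightarrow> j \<in> S" for j
    proof
      assume "j \<in> S"
      then obtain l where l: "l < card S" "j = pick S l" using bij by (auto simp: bij_betw_def)
      then have "l \<in> supp_vec x" using x(2) by simp
      then show "y j \<noteq> 0" using yp[OF l(1)] l(2) by (simp add: supp_vec_def)
    qed (auto simp: y_def split: if_splits)
    have "row_sum \<sigma> y i = 0" if i: "i < m'" for i
    proof -
      have "row_sum \<sigma> y i = sum y (nbrs \<sigma> i \<inter> S)"
        unfolding row_sum_def by (rule sum.mono_neutral_right) (use supp in auto)
      also have "\<dots> = sum y (pick S ` row_supp M i)" by (simp add: rs[OF i])
      also have "\<dots> = (\<Sum>j\<in>row_supp M i. y (pick S j))"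
        by (rule sum.reindex[unfolded o_def], rule inj_on_subset[OF inj]) (auto simp: row_supp_def dc)
      also have "\<dots> = (\<Sum>j\<in>row_supp M i. x $ j)" by (rule sum.cong) (use yp in \<open>auto simp: row_supp_def dc\<close>)
      also have "\<dots> = (\<Sum>j<dim_col M. M $$ (i, j) * x $ j)"
        using row_sum_zero_one[OF M01, of i "\<lambda>j. x $ j"] i dr by simp
      also have "\<dots> = 0" using x(1) i dr by (simp add: mat_kernel_iff)
      finally show ?thesis .
    qed
    then show "\<exists>y. solves S {..<m'} \<sigma> y" using supp by (intro exI[of _ y]) (simp add: solves_def)
  qed
qed

definition well_behaved :: "real \<Rightarrow> (nat \<Rightarrow> nat) \<Rightarrow> bool" where
  "well_behaved T \<sigma> \<longleftrightarrow> \<sigma> permutes N \<and> (\<forall>S \<subseteq> {..<n}.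
     (n < 800 * card S * d \<longrightarrow> \<sigma> \<notin> large_dependency S) \<and>
     (800 * card S * d \<le> n \<and> T \<le> card S \<longrightarrow> \<not> single_free \<sigma> S) \<and>
     (800 * card S * d \<le> n \<and> S \<noteq> {} \<and> single_free \<sigma> S \<longrightarrow> card (Rep \<sigma> S) \<le> card S))"

text \<open>There are at most \<open>card (W \<sigma> S)\<close> ones and exactly
  \<open>card (W \<sigma> S) - card (Rep \<sigma> S)\<close> non-zero rows, so the bound on
  \<open>Rep\<close> is the hypothesis of \<open>minimal_dependency_few_ones\<close>. The clause on
  large dependencies comes in first: it makes every support sparse, which the other two clauses
  presuppose.\<close>

lemma well_behaved_conclusion:
  assumes "well_behaved T \<sigma>"
  shows "S \<subseteq> {..<n} \<Longrightarrow> card S = k \<Longrightarrow> minimal_dependency (submatrix (A \<sigma>) UNIV S) \<Longrightarrow>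
      submatrix (A \<sigma>) UNIV S \<in> T_tree k \<union> T_plus k \<union> T_cycle k"
    and "real (card (\<Union>v \<in> mat_kernel (A \<sigma>). supp_vec v)) \<le> T"
proof -
  have s: "\<sigma> permutes N" using assms by (simp add: well_behaved_def)
  have small: "800 * card S * d \<le> n" if "S \<subseteq> {..<n}" "solves S {..<m'} \<sigma> y" for S y
  proof (rule ccontr)
    assume "\<not> 800 * card S * d \<le> n"
    then have "\<sigma> \<notin> large_dependency S" using assms that(1) by (simp add: well_behaved_def)
    then show False using that(2) s by (auto simp: large_dependency_def)
  qed
  {
    assume S: "S \<subseteq> {..<n}" "card S = k" and md: "minimal_dependency (submatrix (A \<sigma>) UNIV S)"
    note facts = submatrix_facts[OF s S(1)]
    obtain y where y: "S \<noteq> {}" "solves S {..<m'} \<sigma> y" using facts(4)[OF md] by blast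
    have "card (Rep \<sigma> S) \<le> card S"
      using assms S(1) small[OF S(1) y(2)] y(1) solves_single_free[OF y(2)] by (simp add: well_behaved_def)
    then have "num_ones (submatrix (A \<sigma>) UNIV S) \<le> card (nonzero_rows (submatrix (A \<sigma>) UNIV S)) + card S"
      using facts(2,3) card_W_rows(1)[OF s, of S] by linarith
    then show "submatrix (A \<sigma>) UNIV S \<in> T_tree k \<union> T_plus k \<union> T_cycle k"
      using minimal_dependency_few_ones[OF facts(1) md] S(2) by simp
  }
  let ?U = "\<Union>v \<in> mat_kernel (A \<sigma>). supp_vec v"
  obtain w where w: "solves ?U {..<m'} \<sigma> w" using kernel_support_solves[OF s] by blast
  have U: "?U \<subseteq> {..<n}" by (auto simp: mat_kernel_iff supp_vec_def)
  show "real (card ?U) \<le> T"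
  proof (rule ccontr)
    assume "\<not> real (card ?U) \<le> T"
    then have "\<not> single_free \<sigma> ?U" using assms U small[OF U w] by (simp add: well_behaved_def)
    then show False using solves_single_free[OF w] by blast
  qed
qed

end

section \<open>Union bounds\<close>

text \<open>A set \<open>S\<close> gets the weight \<open>(k / a)\<close> to the power \<open>card S\<close>, which is at least \<open>(k / a)\<^sup>k\<close>.\<close>

lemma card_small_subsets_le:
  fixes a b k :: nat
  assumes "0 < k" "k \<le> a"
  shows "real (card {S. S \<subseteq> {..<b} \<and> card S \<le> k}) \<le> (a / k) ^ k * exp (real k * b / a)"
proof -
  define t where "t = real k / a"
  have t: "0 < t" "t \<le> 1" using assms by (auto simp: t_def)
  let ?F = "{S. S \<subseteq> {..<b} \<and> card S \<le> k}"
  have "real (card ?F) * t ^ k = (\<Sum>S\<in>?F. t ^ k)" by simp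
  also have "\<dots> \<le> (\<Sum>S\<in>?F. 1 ^ card ({..<b} - S) * t ^ card S)"
    using t by (intro sum_mono) (auto intro!: power_decreasing)
  also have "\<dots> \<le> (\<Sum>S\<in>Pow {..<b}. 1 ^ card ({..<b} - S) * t ^ card S)"
    by (rule sum_mono2) (use t in auto)
  also have "\<dots> = (1 + t) ^ b" by (subst sum_Pow_binomial) auto
  also have "\<dots> \<le> exp t ^ b" using t by (intro power_mono) auto
  also have "\<dots> = exp (real k * b / a)" by (simp add: t_def mult_ac flip: exp_of_nat_mult)
  finally have "real (card ?F) * t ^ k \<le> exp (real k * b / a)" .
  then have "real (card ?F) \<le> exp (real k * b / a) / t ^ k" using t by (simp add: field_simps)
  also have "\<dots> = (a / k) ^ k * exp (real k * b / a)" by (simp add: t_def power_divide)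
  finally show ?thesis .
qed

context half_edge_pairing
begin

section \<open>Union bounds for the three exceptional events\<close>

lemma finite_permutes_N [simp]: "finite {\<sigma>. \<sigma> permutes N \<and> P \<sigma>}"
  using finite_permutations[OF finite_N] by simp

lemma union_bound:
  fixes b :: "nat \<Rightarrow> real"
  assumes "finite K" "\<And>k. k \<in> K \<Longrightarrow> 0 < k \<and> k \<le> n"
    and Q: "\<And>k S. k \<in> K \<Longrightarrow> S \<subseteq> {..<n} \<Longrightarrow> card S = k \<Longrightarrow>
      real (card {\<sigma>. \<sigma> permutes N \<and> Q S \<sigma>}) \<le> b k * fact (n * D)"
    and b: "\<And>k. k \<in> K \<Longrightarrow> 0 \<le> b k"
  shows "real (card {\<sigma>. \<sigma> permutes N \<and> (\<exists>S \<subseteq> {..<n}. card S \<in> K \<and> Q S \<sigma>)}) \<le>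
    (\<Sum>k\<in>K. (exp 1 * n / k) ^ k * b k) * fact (n * D)"
proof -
  let ?F = "\<lambda>k. {S. S \<subseteq> {..<n} \<and> card S = k}"
  let ?E = "\<lambda>S. {\<sigma>. \<sigma> permutes N \<and> Q S \<sigma>}"
  have finF: "finite (?F k)" for k by simp
  have "card {\<sigma>. \<sigma> permutes N \<and> (\<exists>S \<subseteq> {..<n}. card S \<in> K \<and> Q S \<sigma>)} \<le> card (\<Union>k\<in>K. \<Union>S\<in>?F k. ?E S)"
    by (rule card_mono) (use assms(1) in auto)
  also have "\<dots> \<le> (\<Sum>k\<in>K. card (\<Union>S\<in>?F k. ?E S))" by (rule card_UN_le[OF assms(1)])
  also have "\<dots> \<le> (\<Sum>k\<in>K. \<Sum>S\<in>?F k. card (?E S))"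
    by (rule sum_mono) (rule card_UN_le[OF finF])
  finally have "real (card {\<sigma>. \<sigma> permutes N \<and> (\<exists>S \<subseteq> {..<n}. card S \<in> K \<and> Q S \<sigma>)}) \<le>
    (\<Sum>k\<in>K. \<Sum>S\<in>?F k. real (card (?E S)))" by (simp flip: of_nat_sum)
  also have "\<dots> \<le> (\<Sum>k\<in>K. \<Sum>S\<in>?F k. b k * fact (n * D))"
    by (intro sum_mono Q) auto
  also have "\<dots> = (\<Sum>k\<in>K. real (card (?F k)) * (b k * fact (n * D)))" by simp
  also have "\<dots> \<le> (\<Sum>k\<in>K. (exp 1 * n / k) ^ k * (b k * fact (n * D)))"
  proof (rule sum_mono)
    fix k assume k: "k \<in> K"
    have "card (?F k) \<le> card {S. S \<subseteq> {..<n} \<and> card S \<le> k}" by (rule card_mono) auto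
    also have "real \<dots> \<le> (n / k) ^ k * exp (real k * n / n)"
      by (rule card_small_subsets_le) (use assms(2)[OF k] in auto)
    finally have "real (card (?F k)) \<le> (n / k) ^ k * exp (real k * n / n)" by simp
    also have "\<dots> = (exp 1 * n / k) ^ k"
      using n_pos by (simp add: power_mult_distrib power_divide flip: exp_of_nat_mult)
    finally show "real (card (?F k)) * (b k * fact (n * D)) \<le> (exp 1 * n / k) ^ k * (b k * fact (n * D))"
      using b[OF k] by (intro mult_right_mono) auto
  qed
  also have "\<dots> = (\<Sum>k\<in>K. (exp 1 * n / k) ^ k * b k) * fact (n * D)"
    by (simp add: sum_distrib_right mult.assoc)
  finally show ?thesis .
qed

lemma sum_half_powers: "(\<Sum>k\<in>{1..n}. (1 / 2 :: real) ^ k) \<le> 1"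
proof -
  have "(\<Sum>k\<in>{1..n}. (1 / 2 :: real) ^ k) = 1 - (1 / 2) ^ n" by (induction n) auto
  then show ?thesis by simp
qed

lemma small_size_bounds:
  assumes "800 * k * d \<le> n"
  shows "2 * k \<le> n" "800 * (real k * real d) \<le> real n"
proof -
  have "k * 1 \<le> k * d" using d_pos by (intro mult_le_mono2) simp
  then show "2 * k \<le> n" using assms by linarith
  show "800 * (real k * real d) \<le> real n"
    using of_nat_mono[OF assms, where 'a = real] by simp
qed

text \<open>
  For \<open>800 k d \<le> n\<close> the quantity \<open>\<beta> = 2 k d / n\<close> is at most \<open>1 / 400\<close>, so that
  \<open>q + 2 sqrt \<beta> \<le> 3 / 5\<close> for \<open>q \<le> 1 / 2\<close>.
\<close>

lemma card_excess_event:
  fixes q :: real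
  assumes q: "0 \<le> q" "q \<le> 1 / 2" "real (m - m') * d \<le> q * (n * D)"
    and D: "800 * exp 1 * d * (3 / 5) ^ D \<le> (1 / 4 :: real)"
  shows "real (card {\<sigma>. \<sigma> permutes N \<and> (\<exists>S \<subseteq> {..<n}. card S \<in> {k. 0 < k \<and> 800 * k * d \<le> n} \<and>
      (single_free \<sigma> S \<and> card S + 1 \<le> card (Rep \<sigma> S)))}) \<le> (800 * d / n) * fact (n * D)"
proof -
  let ?K = "{k. 0 < k \<and> 800 * k * d \<le> n}"
  let ?b = "\<lambda>k. (800 * real k * d / n) ^ (k + 1) * (3 / 5) ^ (k * D)"
  have K: "?K \<subseteq> {1..n}" using small_size_bounds(1) by fastforce
  have finK: "finite ?K" by (rule finite_subset[OF K]) simp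
  have "real (card {\<sigma>. \<sigma> permutes N \<and> (\<exists>S \<subseteq> {..<n}. card S \<in> ?K \<and>
      (single_free \<sigma> S \<and> card S + 1 \<le> card (Rep \<sigma> S)))}) \<le>
     (\<Sum>k\<in>?K. (exp 1 * n / k) ^ k * ?b k) * fact (n * D)"
  proof (rule union_bound[OF finK])
    fix k S assume k: "k \<in> ?K" and S: "S \<subseteq> {..<n}" "card S = k"
    note kn = small_size_bounds[of k]
    let ?\<beta> = "2 * real (card S) * d / n"
    have s20: "2 * sqrt (1 / 400 :: real) = 1 / 10"
      by (simp add: real_sqrt_divide)
    \<comment> \<open>The constant \<beta>0 = 1/400 keeps the base below 3/5, and the ratio
      \<beta>/\<beta>0 = 800 k d / n supplies k + 1 powers of 1/n.\<close>
    have "real (card {\<sigma>. \<sigma> permutes N \<and> single_free \<sigma> S \<and> k + 1 \<le> card (Rep \<sigma> S)}) \<le>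
       (?\<beta> / (1 / 400)) ^ (k + 1) * (q + 2 * sqrt (1 / 400)) ^ (card S * D) * fact (n * D)"
    proof (rule card_single_free[OF S(1)])
      show "2 * real (card S) * d / n \<le> 1 / 400" using kn(2) k S n_pos by (simp add: field_simps)
    qed (use q k kn(1) S in auto)
    also have "?\<beta> / (1 / 400) = 800 * real k * d / n" using S by simp
    also have "(800 * real k * d / n) ^ (k + 1) * (q + 2 * sqrt (1 / 400)) ^ (card S * D) * fact (n * D) \<le>
       ?b k * fact (n * D)"
    proof (intro mult_right_mono mult_left_mono)
      show "(q + 2 * sqrt (1 / 400)) ^ (card S * D) \<le> (3 / 5) ^ (k * D)"
        unfolding s20 S(2) by (rule power_mono) (use q in simp_all)
    qed auto
    finally show "real (card {\<sigma>. \<sigma> permutes N \<and> (single_free \<sigma> S \<and> card S + 1 \<le> card (Rep \<sigma> S))}) \<le> ?b k * fact (n * D)"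
      using S(2) by simp
  qed (use K in auto)
  also have "\<dots> \<le> (800 * d / n) * fact (n * D)"
  proof (rule mult_right_mono)
    have "(\<Sum>k\<in>?K. (exp 1 * n / k) ^ k * ?b k) \<le> (\<Sum>k\<in>?K. (800 * d / n) * (1 / 2) ^ k)"
    proof (rule sum_mono)
      fix k assume "k \<in> ?K"
      then have k: "k > 0" by simp
      \<comment> \<open>The k-th power of n / k cancels against k of the k + 1 factors, so that one
        factor 800 k d / n survives for every k.\<close>
      have "a ^ k * (x ^ (k + 1) * c ^ (k * D)) = (a * x * c ^ D) ^ k * x" for a x c :: real
        by (simp add: power_mult_distrib mult.commute[of k D] power_mult)
      then have "(exp 1 * n / k) ^ k * ?b k =
        ((exp 1 * n / k) * (800 * real k * d / n) * (3 / 5) ^ D) ^ k * (800 * real k * d / n)"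
        by blast
      also have "(exp 1 * n / k) * (800 * real k * d / n) * (3 / 5) ^ D = 800 * exp 1 * d * (3 / 5 :: real) ^ D"
        using k n_pos by simp
      also have "(800 * exp 1 * d * (3 / 5 :: real) ^ D) ^ k * (800 * real k * d / n) \<le>
          (1 / 4) ^ k * (800 * real k * d / n)"
        using D by (intro mult_right_mono power_mono) auto
      also have "\<dots> = (800 * d / n) * (real k * (1 / 4) ^ k)" by simp
      also have "\<dots> \<le> (800 * d / n) * (1 / 2) ^ k"
      proof (rule mult_left_mono)
        have "real k \<le> 2 ^ k" using less_exp[of k] by (simp add: less_imp_le of_nat_less_iff flip: of_nat_power)
        then have "real k * (1 / 4) ^ k \<le> 2 ^ k * (1 / 4) ^ k" by (intro mult_right_mono) auto
        also have "\<dots> = (1 / 2 :: real) ^ k" by (simp flip: power_mult_distrib)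
        finally show "real k * (1 / 4) ^ k \<le> (1 / 2) ^ k" .
      qed simp
      finally show "(exp 1 * n / k) ^ k * ?b k \<le> (800 * d / n) * (1 / 2) ^ k" .
    qed
    also have "\<dots> = (800 * d / n) * (\<Sum>k\<in>?K. (1 / 2) ^ k)" by (simp add: sum_distrib_left)
    also have "\<dots> \<le> (800 * d / n) * 1"
    proof (rule mult_left_mono)
      have "(\<Sum>k\<in>?K. (1 / 2 :: real) ^ k) \<le> (\<Sum>k\<in>{1..n}. (1 / 2) ^ k)"
        by (rule sum_mono2) (use K in auto)
      also have "\<dots> \<le> 1" by (rule sum_half_powers)
      finally show "(\<Sum>k\<in>?K. (1 / 2 :: real) ^ k) \<le> 1" .
    qed simp
    finally show "(\<Sum>k\<in>?K. (exp 1 * n / k) ^ k * ?b k) \<le> 800 * d / n" by simp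
  qed simp
  finally show ?thesis .
qed

text \<open>With \<beta>0 = \<beta> and e = 0 only the cost of all half-edges of \<open>S\<close>
  counts. For \<kappa> = k / n, the union bound at size k is the k-th power of the quantity in
  \<open>base\<close>; the at most n sizes from \<open>T\<close> on contribute at most (1/2)^T
  each.\<close>

lemma card_medium_event:
  fixes q T :: real
  assumes q: "0 \<le> q" "q \<le> 1" "real (m - m') * d \<le> q * (n * D)"
    and T: "0 < T"
    and base: "\<And>\<kappa> :: real. T / n \<le> \<kappa> \<Longrightarrow> 800 * (\<kappa> * d) \<le> 1 \<Longrightarrow>
      exp 1 / \<kappa> * (q + 2 * sqrt (2 * \<kappa> * d)) ^ D \<le> 1 / 2"
  shows "real (card {\<sigma>. \<sigma> permutes N \<and> (\<exists>S \<subseteq> {..<n}. card S \<in> {k. T \<le> k \<and> 800 * k * d \<le> n} \<and>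
      single_free \<sigma> S)}) \<le> (n * (1 / 2) powr T) * fact (n * D)"
proof -
  let ?K = "{k. T \<le> real k \<and> 800 * k * d \<le> n}"
  let ?b = "\<lambda>k. (q + 2 * sqrt (2 * real k * d / n)) ^ (k * D)"
  have kpos: "k > 0" if "T \<le> real k" for k using that T by (cases k) auto
  have K: "?K \<subseteq> {1..n}" using small_size_bounds(1) kpos by fastforce
  have finK: "finite ?K" by (rule finite_subset[OF K]) simp
  have "real (card {\<sigma>. \<sigma> permutes N \<and> (\<exists>S \<subseteq> {..<n}. card S \<in> ?K \<and> single_free \<sigma> S)}) \<le>
     (\<Sum>k\<in>?K. (exp 1 * n / k) ^ k * ?b k) * fact (n * D)"
  proof (rule union_bound[OF finK])
    fix k S assume k: "k \<in> ?K" and S: "S \<subseteq> {..<n}" "card S = k"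
    note kn = small_size_bounds[of k]
    let ?\<beta> = "2 * real (card S) * d / n"
    have \<beta>: "0 < ?\<beta>" "?\<beta> \<le> 1" using kpos[of k] kn(2) k S n_pos d_pos by (auto simp: field_simps)
    have "real (card {\<sigma>. \<sigma> permutes N \<and> single_free \<sigma> S \<and> 0 \<le> card (Rep \<sigma> S)}) \<le>
       (?\<beta> / ?\<beta>) ^ 0 * (q + 2 * sqrt ?\<beta>) ^ (card S * D) * fact (n * D)"
      by (rule card_single_free[OF S(1)]) (use q k kn(1) S \<beta> in auto)
    then show "real (card {\<sigma>. \<sigma> permutes N \<and> single_free \<sigma> S}) \<le> ?b k * fact (n * D)"
      using S(2) by simp
  qed (use K q in auto)
  also have "\<dots> \<le> (n * (1 / 2) powr T) * fact (n * D)"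
  proof (rule mult_right_mono)
    have "(\<Sum>k\<in>?K. (exp 1 * n / k) ^ k * ?b k) \<le> (\<Sum>k\<in>?K. (1 / 2) powr T)"
    proof (rule sum_mono)
      fix k assume k: "k \<in> ?K"
      then have k0: "k > 0" using kpos by auto
      define \<kappa> where "\<kappa> = real k / n"
      have "a ^ k * c ^ (k * D) = (a * c ^ D) ^ k" for a c :: real
        by (simp add: power_mult_distrib mult.commute[of k D] power_mult)
      moreover have "exp 1 * real n / k = exp 1 / \<kappa>" "2 * real k * d / n = 2 * \<kappa> * d"
        by (simp_all add: \<kappa>_def)
      ultimately have "(exp 1 * n / k) ^ k * ?b k = (exp 1 / \<kappa> * (q + 2 * sqrt (2 * \<kappa> * d)) ^ D) ^ k"
        by simp
      also have "\<dots> \<le> (1 / 2) ^ k"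
      proof (rule power_mono)
        show "exp 1 / \<kappa> * (q + 2 * sqrt (2 * \<kappa> * d)) ^ D \<le> 1 / 2"
        proof (rule base)
          show "T / n \<le> \<kappa>" using k by (simp add: \<kappa>_def divide_right_mono)
          show "800 * (\<kappa> * d) \<le> 1" using small_size_bounds(2)[of k] k n_pos by (simp add: \<kappa>_def field_simps)
        qed
      qed (use q in \<open>auto simp: \<kappa>_def\<close>)
      also have "\<dots> = (1 / 2) powr k" by (simp add: powr_realpow)
      also have "\<dots> \<le> (1 / 2) powr T" using k by (intro powr_mono') auto
      finally show "(exp 1 * n / k) ^ k * ?b k \<le> (1 / 2) powr T" .
    qed
    also have "\<dots> = card ?K * (1 / 2) powr T" by simp
    also have "\<dots> \<le> n * (1 / 2) powr T"
      using card_mono[OF _ K] by (intro mult_right_mono) auto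
    finally show "(\<Sum>k\<in>?K. (exp 1 * n / k) ^ k * ?b k) \<le> n * (1 / 2) powr T" .
  qed simp
  finally show ?thesis .
qed

text \<open>With k = \<open>card S\<close>, the choice \<epsilon> = 1/1600 turns k d > n / 800 into
  2 \<epsilon> n <= k d, and \<open>m * d = n * D\<close> turns it into k D >= m / 800. There are at
  most 2^n sets \<open>S\<close> and (e m / n)^n generating sets of rows.\<close>

lemma card_large_event:
  fixes \<rho> :: real
  defines "\<rho> \<equiv> (1 + exp (- (1 / 1600))) / 2"
  assumes large: "8 * (real d)\<^sup>2 \<le> (1 - \<rho>) * n" and mm: "m \<le> 2 * m'" "32 * n \<le> m"
  shows "real (card {\<sigma>. \<sigma> permutes N \<and> (\<exists>S \<subseteq> {..<n}. n < 800 * card S * d \<and> \<sigma> \<in> large_dependency S)}) \<le>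
    2 ^ n * (exp 1 * (m / n)) ^ n * ((1 / 2) powr (m / 800) + ((1 + \<rho>) / 2) ^ (m div 32)) * fact (n * D)"
proof -
  let ?F = "{S. S \<subseteq> {..<n} \<and> n < 800 * card S * d}"
  let ?I = "real (card {I. I \<subseteq> {..<m'} \<and> card I \<le> n})"
  let ?B = "?I * (((1 / 2) powr (m / 800) + ((1 + \<rho>) / 2) ^ (m div 32)) * fact (n * D))"
  have \<rho>: "0 < \<rho>" by (simp add: \<rho>_def add_pos_pos)
  have each: "real (card (large_dependency S)) \<le> ?B" if S: "S \<in> ?F" for S
  proof -
    have "n < 800 * card S * d" using S by simp
    from of_nat_mono[OF less_imp_le[OF this], where 'a = real]
    have Sn: "real n \<le> 800 * (real (card S) * d)" by simp
    have "real (card (large_dependency S)) \<le>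
      ?I * (((1 / 2) ^ (card S * D) + ((1 + \<rho>) / 2) ^ (m div 32)) * fact (n * D))"
      unfolding \<rho>_def
      by (rule card_large_dependency) (use S Sn large mm in \<open>auto simp: \<rho>_def\<close>)
    also have "\<dots> \<le> ?B"
    proof (intro mult_left_mono mult_right_mono add_right_mono)
      have "real m * d = real n * D" using half_edges by (simp flip: of_nat_mult)
      also have "\<dots> \<le> 800 * (real (card S) * d) * D" using Sn by (rule mult_right_mono) simp
      finally have "real m * d \<le> (800 * (real (card S) * D)) * d" by (simp add: mult_ac)
      then have "real m \<le> 800 * (real (card S) * D)"
        using d_pos by (simp only: mult_le_cancel_right_pos of_nat_0_less_iff)
      then have "m / 800 \<le> real (card S * D)" by simp
      then have "(1 / 2 :: real) powr real (card S * D) \<le> (1 / 2) powr (m / 800)" by (intro powr_mono') auto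
      then show "(1 / 2 :: real) ^ (card S * D) \<le> (1 / 2) powr (m / 800)"
        using powr_realpow[of "1 / 2 :: real" "card S * D"] by simp
    qed auto
    finally show ?thesis .
  qed
  have "card {\<sigma>. \<sigma> permutes N \<and> (\<exists>S \<subseteq> {..<n}. n < 800 * card S * d \<and> \<sigma> \<in> large_dependency S)} \<le>
     card (\<Union>S\<in>?F. large_dependency S)"
    by (rule card_mono) (auto simp: large_dependency_def)
  also have "\<dots> \<le> (\<Sum>S\<in>?F. card (large_dependency S))" by (rule card_UN_le) simp
  finally have "real (card {\<sigma>. \<sigma> permutes N \<and> (\<exists>S \<subseteq> {..<n}. n < 800 * card S * d \<and> \<sigma> \<in> large_dependency S)}) \<le>
     (\<Sum>S\<in>?F. real (card (large_dependency S)))" by (simp flip: of_nat_sum)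
  also have "\<dots> \<le> (\<Sum>S\<in>?F. ?B)" by (rule sum_mono) (rule each)
  also have "\<dots> = real (card ?F) * ?B" by simp
  also have "\<dots> \<le> 2 ^ n * ((exp 1 * (m / n)) ^ n * (((1 / 2) powr (m / 800) + ((1 + \<rho>) / 2) ^ (m div 32)) * fact (n * D)))"
  proof (intro mult_mono)
    have "card ?F \<le> card (Pow {..<n})" by (rule card_mono) auto
    then show "real (card ?F) \<le> 2 ^ n" by (simp add: card_Pow flip: of_nat_le_iff)
    have "?I \<le> (m / n) ^ n * exp (real n * m' / m)"
      by (rule card_small_subsets_le) (use n_pos mm in auto)
    also have "\<dots> \<le> (m / n) ^ n * exp (real n)"
    proof (intro mult_left_mono)
      have "real n * m' / m \<le> real n * 1"
        using kept mm(2) n_pos unfolding times_divide_eq_right[symmetric] by (intro mult_left_mono) auto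
      then show "exp (real n * m' / m) \<le> exp (real n)" by simp
    qed simp
    also have "\<dots> = (exp 1 * (m / n)) ^ n"
      unfolding power_mult_distrib by (simp flip: exp_of_nat_mult)
    finally show "?I \<le> (exp 1 * (m / n)) ^ n" .
  qed (use \<rho> in auto)
  finally show ?thesis by (simp only: mult.assoc)
qed

lemma not_well_behaved_subset:
  fixes T :: real
  assumes "T > 0"
  shows "{\<sigma>. \<sigma> permutes N \<and> \<not> well_behaved T \<sigma>} \<subseteq>
    {\<sigma>. \<sigma> permutes N \<and> (\<exists>S \<subseteq> {..<n}. n < 800 * card S * d \<and> \<sigma> \<in> large_dependency S)} \<union>
    {\<sigma>. \<sigma> permutes N \<and> (\<exists>S \<subseteq> {..<n}. card S \<in> {k. T \<le> k \<and> 800 * k * d \<le> n} \<and> single_free \<sigma> S)} \<union>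
    {\<sigma>. \<sigma> permutes N \<and> (\<exists>S \<subseteq> {..<n}. card S \<in> {k. 0 < k \<and> 800 * k * d \<le> n} \<and>
      (single_free \<sigma> S \<and> card S + 1 \<le> card (Rep \<sigma> S)))}"
  (is "_ \<subseteq> ?L \<union> ?M \<union> ?E")
proof (rule subsetI, rule ccontr)
  fix \<sigma> assume "\<sigma> \<in> {\<sigma>. \<sigma> permutes N \<and> \<not> well_behaved T \<sigma>}" and nin: "\<sigma> \<notin> ?L \<union> ?M \<union> ?E"
  then have s: "\<sigma> permutes N" "\<not> well_behaved T \<sigma>" by simp_all
  have LME: "(\<sigma> \<notin> ?L \<and> \<sigma> \<notin> ?M) \<and> \<sigma> \<notin> ?E" using nin by (simp only: Un_iff de_Morgan_disj not_False_eq_True)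
  note L = LME[THEN conjunct1, THEN conjunct1] and M = LME[THEN conjunct1, THEN conjunct2]
    and E = LME[THEN conjunct2]
  have "well_behaved T \<sigma>"
    unfolding well_behaved_def
  proof (intro conjI allI impI)
    fix S assume S: "S \<subseteq> {..<n}"
    show "\<sigma> \<notin> large_dependency S" if "n < 800 * card S * d"
      using L s(1) S that by auto
    show "\<not> single_free \<sigma> S" if "800 * card S * d \<le> n \<and> T \<le> card S"
      using M s(1) S that by auto
    show "card (Rep \<sigma> S) \<le> card S" if "800 * card S * d \<le> n \<and> S \<noteq> {} \<and> single_free \<sigma> S"
    proof (rule ccontr)
      assume "\<not> card (Rep \<sigma> S) \<le> card S"
      moreover have "0 < card S" using finite_subset[OF S] that by (auto simp: card_gt_0_iff)
      ultimately show False using E s(1) S that by (auto simp: Suc_le_eq not_le)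
    qed
  qed (rule s(1))
  then show False using s(2) by contradiction
qed

end

section \<open>Asymptotics\<close>

text \<open>Let s be the square-root term. For s <= q / D the lower bound on \<kappa> does the work
  and leaves e^2 / D. For s > q / D two factors are at most (D + 1) s, so that s^2 = 8 \<kappa> d
  cancels \<kappa>, while the other D - 2 factors are at most 3/5.\<close>

lemma medium_base_bound:
  fixes q \<kappa> :: real and D d :: nat
  assumes q: "0 < q" "q \<le> 1 / 2" and D: "18 \<le> D" "0 < d" "d \<le> D"
    and small: "8 * exp 1 * D * (real D + 1)\<^sup>2 * (25 / 9) * (3 / 5) ^ D \<le> (1 / 2 :: real)"
    and \<kappa>: "q ^ D * D \<le> \<kappa>" "800 * (\<kappa> * d) \<le> 1"
  shows "exp 1 / \<kappa> * (q + 2 * sqrt (2 * \<kappa> * d)) ^ D \<le> 1 / 2"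
proof -
  define s where "s = 2 * sqrt (2 * \<kappa> * d)"
  have "0 < q ^ D * D" using q D by simp
  then have \<kappa>0: "0 < \<kappa>" using \<kappa>(1) by linarith
  have s0: "0 < s" using \<kappa>0 D by (simp add: s_def)
  have "(sqrt (2 * \<kappa> * d))\<^sup>2 = 2 * \<kappa> * d" by (rule real_sqrt_pow2) (use \<kappa>0 in simp)
  then have s2: "s\<^sup>2 = 8 * \<kappa> * d" by (simp add: s_def power_mult_distrib)
  have "s\<^sup>2 \<le> (1 / 10)\<^sup>2" unfolding s2 using \<kappa>(2) by (simp add: power2_eq_square)
  then have s1: "s \<le> 1 / 10" using power2_le_imp_le[of s "1 / 10"] by simp
  have "exp 1 / \<kappa> * (q + s) ^ D \<le> 1 / 2"
  proof (cases "s \<le> q / D")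
    case True
    have "(q + s) ^ D \<le> (q * (1 + 1 / D)) ^ D"
      using True q s0 by (intro power_mono) (auto simp: distrib_left)
    also have "\<dots> = q ^ D * (1 + 1 / D) ^ D" by (simp add: power_mult_distrib)
    also have "\<dots> \<le> q ^ D * exp (1 / D) ^ D"
      using q by (intro mult_left_mono power_mono) (auto simp: exp_ge_add_one_self)
    also have "exp (1 / real D) ^ D = exp 1" using D by (simp flip: exp_of_nat_mult)
    finally have "(q + s) ^ D \<le> q ^ D * exp 1" .
    also have "\<dots> \<le> (\<kappa> / D) * exp 1"
      using \<kappa>(1) D by (intro mult_right_mono) (auto simp: field_simps)
    finally have "exp 1 / \<kappa> * (q + s) ^ D \<le> exp 1 / \<kappa> * ((\<kappa> / D) * exp 1)"
      using \<kappa>0 by (intro mult_left_mono) auto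
    also have "\<dots> = exp 1 * exp 1 / D" using \<kappa>0 by simp
    also have "\<dots> \<le> 3 * 3 / 18"
      using exp_le D(1) by (intro frac_le mult_mono) auto
    finally show ?thesis by simp
  next
    case False
    then have "q < D * s" using D by (simp add: field_simps)
    then have 1: "q + s \<le> (real D + 1) * s" by (simp add: distrib_right)
    have 2: "q + s \<le> 3 / 5" using q s1 by simp
    have "D = 2 + (D - 2)" using D(1) by simp
    then have "(q + s) ^ D = (q + s) ^ (2 + (D - 2))" by (rule arg_cong)
    also have "\<dots> = (q + s)\<^sup>2 * (q + s) ^ (D - 2)" by (rule power_add)
    also have "\<dots> \<le> ((real D + 1) * s)\<^sup>2 * (3 / 5) ^ (D - 2)"
      using 1 2 q s0 by (intro mult_mono power_mono) auto
    also have "(3 / 5 :: real) ^ (D - 2) = (25 / 9) * (3 / 5) ^ D"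
      using D(1) by (simp add: power_diff power2_eq_square)
    also have "((real D + 1) * s)\<^sup>2 * ((25 / 9) * (3 / 5) ^ D) = \<kappa> * (8 * d * (real D + 1)\<^sup>2 * (25 / 9) * (3 / 5) ^ D)"
      unfolding power_mult_distrib s2 by simp
    finally have "exp 1 / \<kappa> * (q + s) ^ D \<le> exp 1 / \<kappa> * (\<kappa> * (8 * d * (real D + 1)\<^sup>2 * (25 / 9) * (3 / 5) ^ D))"
      using \<kappa>0 by (intro mult_left_mono) auto
    also have "\<dots> = d * (8 * exp 1 * (real D + 1)\<^sup>2 * (25 / 9) * (3 / 5) ^ D)" using \<kappa>0 by simp
    also have "\<dots> \<le> D * (8 * exp 1 * (real D + 1)\<^sup>2 * (25 / 9) * (3 / 5) ^ D)"
      using D by (intro mult_right_mono) auto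
    also have "\<dots> = 8 * exp 1 * D * (real D + 1)\<^sup>2 * (25 / 9) * (3 / 5) ^ D" by simp
    finally show ?thesis using small by linarith
  qed
  then show ?thesis by (simp add: s_def)
qed

section \<open>Choice of the thresholds\<close>

lemma linear_times_exp_small:
  fixes c :: real
  assumes "0 < c"
  shows "eventually (\<lambda>x :: real. 2 * exp 1 * x * exp (- c * x) \<le> 1 / 2) at_top"
proof -
  have "((\<lambda>x :: real. 2 * exp 1 * x * exp (- c * x)) \<longlongrightarrow> 0) at_top"
    using assms by real_asymp
  then have "eventually (\<lambda>x :: real. 2 * exp 1 * x * exp (- c * x) < 1 / 2) at_top"
    by (rule order_tendstoD) simp
  then show ?thesis by eventually_elim simp
qed

text \<open>The \<rho> of \<open>card_zero_row\<close> at \<epsilon> = 1/1600; a fresh row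
  annihilates the vector with probability at most \<open>(1 + row_rate) / 2\<close>.\<close>

definition row_rate :: real where "row_rate = (1 + exp (- (1 / 1600))) / 2"

lemma row_rate: "0 < row_rate" "row_rate < 1"
  by (auto simp: row_rate_def add_pos_pos)

text \<open>32 ensures 32 n <= m. The factor 2 e \<gamma> is the n-th root of the bound on the
  choices of \<open>S\<close> and of generating rows; the powers are the n-th roots of the bounds
  for overloading and, up to rounding, for m / 32 annihilating rows.\<close>

definition large_ratio :: "real \<Rightarrow> bool" where
  "large_ratio \<gamma> \<longleftrightarrow> 32 \<le> \<gamma> \<and> 2 * exp 1 * \<gamma> * (1 / 2) powr (\<gamma> / 800) \<le> 1 / 2 \<and>
       2 * exp 1 * \<gamma> * ((1 + row_rate) / 2) powr (\<gamma> / 32) \<le> 1 / 2"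

text \<open>18 is 2 * 3 * 3, with 3 as upper bound for e; the second condition serves
  \<open>card_excess_event\<close>, the third the case s > q / D of
  \<open>medium_base_bound\<close>.\<close>

definition large_degree :: "nat \<Rightarrow> bool" where
  "large_degree D \<longleftrightarrow> 18 \<le> D \<and> 800 * exp 1 * D * (3 / 5) ^ D \<le> (1 / 4 :: real) \<and>
       8 * exp 1 * D * (real D + 1)\<^sup>2 * (25 / 9) * (3 / 5) ^ D \<le> (1 / 2 :: real)"

lemma thresholds_exist:
  obtains \<gamma>\<^sub>0 :: real and D\<^sub>0 :: nat where
    "\<And>\<gamma>. \<gamma> > \<gamma>\<^sub>0 \<Longrightarrow> large_ratio \<gamma>"
    "\<And>D. D \<ge> D\<^sub>0 \<Longrightarrow> large_degree D"
proof -
  have powr_exp: "x powr (\<gamma> / a) = exp (- (- ln x / a) * \<gamma>)" if "0 < x" for x \<gamma> a :: real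
    using that by (simp add: powr_def)
  have "eventually (\<lambda>\<gamma>. 2 * exp 1 * \<gamma> * (1 / 2) powr (\<gamma> / 800) \<le> 1 / 2) (at_top :: real filter)"
    unfolding powr_exp[of "1 / 2", simplified] using linear_times_exp_small[of "- ln (1 / 2) / 800"]
    by (simp add: ln_div)
  moreover have "eventually (\<lambda>\<gamma>. 2 * exp 1 * \<gamma> * ((1 + row_rate) / 2) powr (\<gamma> / 32) \<le> 1 / 2) (at_top :: real filter)"
  proof -
    have r: "0 < (1 + row_rate) / 2" "(1 + row_rate) / 2 < 1" using row_rate by auto
    have "0 < - ln ((1 + row_rate) / 2) / 32" using r ln_less_zero[OF r] by simp
    then show ?thesis unfolding powr_exp[OF r(1)] by (rule linear_times_exp_small)
  qed
  ultimately have "eventually (\<lambda>\<gamma>. large_ratio \<gamma>) (at_top :: real filter)"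
    using eventually_ge_at_top[of "32 :: real"] unfolding large_ratio_def by eventually_elim blast
  then obtain \<gamma>\<^sub>0 where g: "\<And>\<gamma>. \<gamma> \<ge> \<gamma>\<^sub>0 \<Longrightarrow> large_ratio \<gamma>"
    unfolding eventually_at_top_linorder by blast
  have "(\<lambda>D :: nat. 800 * exp 1 * D * (3 / 5) ^ D :: real) \<longlonglongrightarrow> 0" by real_asymp
  then have "eventually (\<lambda>D :: nat. 800 * exp 1 * D * (3 / 5) ^ D < (1 / 4 :: real)) sequentially"
    by (rule order_tendstoD) simp
  moreover have "(\<lambda>D :: nat. 8 * exp 1 * D * (real D + 1)\<^sup>2 * (25 / 9) * (3 / 5) ^ D :: real) \<longlonglongrightarrow> 0" by real_asymp
  then have "eventually (\<lambda>D :: nat. 8 * exp 1 * D * (real D + 1)\<^sup>2 * (25 / 9) * (3 / 5) ^ D < (1 / 2 :: real)) sequentially"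
    by (rule order_tendstoD) simp
  ultimately have "eventually (\<lambda>D :: nat. large_degree D) sequentially"
    using eventually_ge_at_top[of "18 :: nat"] unfolding large_degree_def by eventually_elim simp
  then obtain D\<^sub>0 where "\<And>D. D \<ge> D\<^sub>0 \<Longrightarrow> large_degree D"
    unfolding eventually_sequentially by blast
  with g show ?thesis by (intro that[of \<gamma>\<^sub>0 D\<^sub>0]) auto
qed

text \<open>Both products are n-th powers of numbers that \<open>large_ratio\<close> bounds by 1/2,
  except that rounding down in m div 32 costs one power of the rate, whence its reciprocal.\<close>

lemma large_error_bound:
  fixes \<gamma> :: real
  assumes m: "real m = \<gamma> * n" and n: "n > 0"
    and large: "large_ratio \<gamma>"
  shows "2 ^ n * (exp 1 * (m / n)) ^ n * ((1 / 2) powr (m / 800) + ((1 + row_rate) / 2) ^ (m div 32)) \<le>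
    (1 / 2) ^ n * (1 + 1 / ((1 + row_rate) / 2))"
proof -
  let ?r = "(1 + row_rate) / 2"
  have r: "0 < ?r" "?r < 1" using row_rate by auto
  note \<gamma> = large[unfolded large_ratio_def]
  have mn: "m / n = \<gamma>" using m n by simp
  have base: "2 ^ n * (exp 1 * (m / n)) ^ n = (2 * exp 1 * \<gamma>) ^ n"
    unfolding mn by (simp add: power_mult_distrib mult.assoc)
  have powr_n: "x powr (\<gamma> * n / a) = (x powr (\<gamma> / a)) ^ n" if "0 < x" for x a :: real
    using that by (simp add: powr_powr flip: powr_realpow)
  have A: "(2 * exp 1 * \<gamma>) ^ n * (1 / 2) powr (m / 800) \<le> (1 / 2) ^ n"
  proof -
    have "(2 * exp 1 * \<gamma>) ^ n * (1 / 2) powr (m / 800) = (2 * exp 1 * \<gamma> * (1 / 2) powr (\<gamma> / 800)) ^ n"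
      unfolding m by (subst powr_n) (simp_all add: power_mult_distrib)
    also have "\<dots> \<le> (1 / 2) ^ n" using \<gamma> by (intro power_mono) auto
    finally show ?thesis .
  qed
  have B: "(2 * exp 1 * \<gamma>) ^ n * ?r ^ (m div 32) \<le> (1 / 2) ^ n * (1 / ?r)"
  proof -
    have "real m / 32 - 1 \<le> real (m div 32)"
    proof -
      have "m \<le> 32 * (m div 32) + 32" by linarith
      from of_nat_mono[OF this, where 'a = real] show ?thesis by simp
    qed
    then have "?r powr real (m div 32) \<le> ?r powr (m / 32 - 1)" using r by (intro powr_mono') auto
    then have "?r ^ (m div 32) \<le> ?r powr (m / 32) / ?r"
      using r powr_realpow[OF r(1), of "m div 32"] by (simp add: powr_diff)
    then have "(2 * exp 1 * \<gamma>) ^ n * ?r ^ (m div 32) \<le> (2 * exp 1 * \<gamma>) ^ n * (?r powr (m / 32) / ?r)"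
      using \<gamma> by (intro mult_left_mono) auto
    also have "\<dots> = (2 * exp 1 * \<gamma> * ?r powr (\<gamma> / 32)) ^ n * (1 / ?r)"
    proof -
      have "?r powr (m / 32) = (?r powr (\<gamma> / 32)) ^ n" unfolding m by (rule powr_n[OF r(1)])
      then show ?thesis by (simp only: power_mult_distrib times_divide_eq_right mult_1_right)
    qed
    also have "\<dots> \<le> (1 / 2) ^ n * (1 / ?r)"
      using \<gamma> r by (intro mult_right_mono power_mono) auto
    finally show ?thesis .
  qed
  show ?thesis unfolding base using A B by (simp only: distrib_left mult_1_right)
qed

text \<open>The errors belong to large dependencies, to sets beyond the threshold and to excess
  repetitions. For fixed parameters the first two decay exponentially in n, the last only like
  1/n.\<close>

lemma (in half_edge_pairing) card_not_well_behaved: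
  fixes q \<gamma> :: real
  assumes q: "0 < q" "q < 1 / 2" "real (m - m') * d = q * (n * D)"
    and D: "d \<le> D" "large_degree D" and \<gamma>: "real m = \<gamma> * n" "large_ratio \<gamma>"
    and n: "8 * (real d)\<^sup>2 \<le> (1 - row_rate) * n" and mm: "m \<le> 2 * m'"
  shows "real (card {\<sigma>. \<sigma> permutes N \<and> \<not> well_behaved (n * (q ^ D * D)) \<sigma>}) \<le>
    ((1 / 2) ^ n * (1 + 1 / ((1 + row_rate) / 2)) + n * (1 / 2) powr (n * (q ^ D * D)) + 800 * d / n) * fact (n * D)"
proof -
  let ?T = "n * (q ^ D * D)"
  have T: "0 < ?T" using n_pos q(1) D_pos by simp
  let ?L = "{\<sigma>. \<sigma> permutes N \<and> (\<exists>S \<subseteq> {..<n}. n < 800 * card S * d \<and> \<sigma> \<in> large_dependency S)}"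
  let ?M = "{\<sigma>. \<sigma> permutes N \<and> (\<exists>S \<subseteq> {..<n}. card S \<in> {k. ?T \<le> k \<and> 800 * k * d \<le> n} \<and> single_free \<sigma> S)}"
  let ?E = "{\<sigma>. \<sigma> permutes N \<and> (\<exists>S \<subseteq> {..<n}. card S \<in> {k. 0 < k \<and> 800 * k * d \<le> n} \<and>
      (single_free \<sigma> S \<and> card S + 1 \<le> card (Rep \<sigma> S)))}"
  have "32 * real n \<le> real m" using \<gamma>(1) \<gamma>(2)[unfolded large_ratio_def] mult_right_mono[of 32 \<gamma> "real n"] by simp
  then have mm2: "32 * n \<le> m" by simp
  have "real (card ?L) \<le> 2 ^ n * (exp 1 * (m / n)) ^ n *
      ((1 / 2) powr (m / 800) + ((1 + row_rate) / 2) ^ (m div 32)) * fact (n * D)"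
    unfolding row_rate_def by (rule card_large_event) (use n mm mm2 in \<open>auto simp: row_rate_def\<close>)
  also have "\<dots> \<le> (1 / 2) ^ n * (1 + 1 / ((1 + row_rate) / 2)) * fact (n * D)"
    by (rule mult_right_mono[OF large_error_bound[OF \<gamma>(1) n_pos \<gamma>(2)]]) simp
  finally have L: "real (card ?L) \<le> (1 / 2) ^ n * (1 + 1 / ((1 + row_rate) / 2)) * fact (n * D)" .
  have M: "real (card ?M) \<le> (n * (1 / 2) powr ?T) * fact (n * D)"
  proof (rule card_medium_event)
    fix \<kappa> :: real assume \<kappa>: "?T / n \<le> \<kappa>" "800 * (\<kappa> * d) \<le> 1"
    have "q ^ D * D \<le> \<kappa>" using \<kappa>(1) n_pos by simp
    then show "exp 1 / \<kappa> * (q + 2 * sqrt (2 * \<kappa> * d)) ^ D \<le> 1 / 2"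
      using q(2) D(2)[unfolded large_degree_def]
      by (intro medium_base_bound[OF q(1) _ _ d_pos D(1) _ _ \<kappa>(2)]) auto
  qed (use q T in auto)
  have E: "real (card ?E) \<le> (800 * d / n) * fact (n * D)"
  proof (rule card_excess_event[of q])
    have "800 * exp 1 * real d * (3 / 5) ^ D \<le> 800 * exp 1 * real D * (3 / 5) ^ D"
      using D(1) by (intro mult_right_mono mult_left_mono) auto
    then show "800 * exp 1 * real d * (3 / 5) ^ D \<le> 1 / 4" using D(2)[unfolded large_degree_def] by linarith
  qed (use q in auto)
  have "card {\<sigma>. \<sigma> permutes N \<and> \<not> well_behaved ?T \<sigma>} \<le> card (?L \<union> ?M \<union> ?E)"
    by (rule card_mono[OF _ not_well_behaved_subset[OF T]]) (simp only: finite_Un finite_permutes_N)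
  also have "\<dots> \<le> card (?L \<union> ?M) + card ?E" by (rule card_Un_le)
  also have "\<dots> \<le> card ?L + card ?M + card ?E" by (rule add_right_mono[OF card_Un_le])
  finally have "card {\<sigma>. \<sigma> permutes N \<and> \<not> well_behaved ?T \<sigma>} \<le> card ?L + card ?M + card ?E" .
  from of_nat_mono[OF this, where 'a = real]
  have "real (card {\<sigma>. \<sigma> permutes N \<and> \<not> well_behaved ?T \<sigma>}) \<le> real (card ?L) + real (card ?M) + real (card ?E)"
    by (simp only: of_nat_add)
  also have "\<dots> \<le> (1 / 2) ^ n * (1 + 1 / ((1 + row_rate) / 2)) * fact (n * D) + (n * (1 / 2) powr ?T) * fact (n * D) +
      (800 * d / n) * fact (n * D)" using L M E by (intro add_mono)
  finally show ?thesis by (simp only: distrib_right)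
qed

lemma (in half_edge_pairing) prob_ge:
  assumes G: "\<And>\<sigma>. well_behaved T \<sigma> \<Longrightarrow> A \<sigma> \<in> G"
    and bad: "real (card {\<sigma>. \<sigma> permutes N \<and> \<not> well_behaved T \<sigma>}) \<le> \<epsilon> * fact (n * D)"
  shows "1 - \<epsilon> \<le> measure_pmf.prob (map_pmf A (pmf_of_set {\<sigma>. \<sigma> permutes N})) G"
proof -
  let ?\<Omega> = "{\<sigma>. \<sigma> permutes N}"
  have fin: "finite ?\<Omega>" "?\<Omega> \<noteq> {}" using finite_permutations[OF finite_N] permutes_id[of N] by blast+
  have c\<Omega>: "card ?\<Omega> = fact (n * D)" by (simp add: card_permutations card_N)
  let ?B = "{\<sigma>. \<sigma> permutes N \<and> \<not> well_behaved T \<sigma>}"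
  have "card ?\<Omega> \<le> card ((?\<Omega> \<inter> A -` G) \<union> ?B)" by (rule card_mono) (use G fin in auto)
  also have "\<dots> \<le> card (?\<Omega> \<inter> A -` G) + card ?B" by (rule card_Un_le)
  finally have "fact (n * D) \<le> card (?\<Omega> \<inter> A -` G) + card ?B" by (simp only: c\<Omega>)
  from of_nat_mono[OF this, where 'a = real]
  have "fact (n * D) \<le> real (card (?\<Omega> \<inter> A -` G)) + \<epsilon> * fact (n * D)" using bad by simp
  then have "(1 - \<epsilon>) * fact (n * D) \<le> real (card (?\<Omega> \<inter> A -` G))" by (simp add: left_diff_distrib)
  moreover have "measure_pmf.prob (map_pmf A (pmf_of_set ?\<Omega>)) G = card (?\<Omega> \<inter> A -` G) / fact (n * D)"
    using fin c\<Omega> by (simp add: measure_pmf_of_set)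
  ultimately show ?thesis by (simp add: pos_le_divide_eq)
qed

theorem theorem8p5:
  shows "\<exists>(c :: real) (\<gamma>\<^sub>0 :: real) (d\<^sub>0 :: real \<Rightarrow> nat).
    \<forall>(p :: real) (\<gamma> :: real) (d :: nat).
      0 < p \<and> p < 1 / 2 \<and> \<gamma> > \<gamma>\<^sub>0 \<and> d \<ge> d\<^sub>0 \<gamma> \<and> \<gamma> * real d \<in> \<nat> \<longrightarrow>
      ((\<lambda>n. measure_pmf.prob (ABC p n \<gamma> d)
         {A. (\<forall>k S. S \<subseteq> {..<n} \<and> card S = k \<and> minimal_dependency (submatrix A UNIV S) \<longrightarrow>
                submatrix A UNIV S \<in> T_tree k \<union> T_plus k \<union> T_cycle k) \<and>
             real (card (\<Union>x \<in> mat_kernel A. supp_vec x)) \<le>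
               real n * p powr (\<gamma> * real d + c * log p (\<gamma> * real d))})
       \<longlongrightarrow> 1)
      (inf sequentially (principal {n. \<gamma> * real n \<in> \<nat> \<and> \<gamma> * real n * (1 - p) \<in> \<nat>}))"
proof -
  obtain \<gamma>\<^sub>0 :: real and D\<^sub>0 :: nat where
    \<gamma>\<^sub>0: "\<And>\<gamma>. \<gamma> > \<gamma>\<^sub>0 \<Longrightarrow> large_ratio \<gamma>" and
    D\<^sub>0: "\<And>D. D \<ge> D\<^sub>0 \<Longrightarrow> large_degree D"
    using thresholds_exist by blast
  define good :: "real \<Rightarrow> real \<Rightarrow> nat \<Rightarrow> nat \<Rightarrow> real mat set" where
    "good p \<gamma> d n = {A. (\<forall>k S. S \<subseteq> {..<n} \<and> card S = k \<and> minimal_dependency (submatrix A UNIV S) \<longrightarrow>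
                submatrix A UNIV S \<in> T_tree k \<union> T_plus k \<union> T_cycle k) \<and>
             real (card (\<Union>x \<in> mat_kernel A. supp_vec x)) \<le>
               real n * p powr (\<gamma> * real d + 1 * log p (\<gamma> * real d))}" for p \<gamma> d n
  have lim: "((\<lambda>n. measure_pmf.prob (ABC p n \<gamma> d) (good p \<gamma> d n)) \<longlongrightarrow> 1)
      (inf sequentially (principal {n. \<gamma> * real n \<in> \<nat> \<and> \<gamma> * real n * (1 - p) \<in> \<nat>}))"
    if p: "0 < p" "p < 1 / 2" and \<gamma>: "\<gamma> > \<gamma>\<^sub>0" and d: "d \<ge> max 1 D\<^sub>0" and dN: "\<gamma> * real d \<in> \<nat>" for p \<gamma> d
  proof -
    have \<gamma>32: "32 \<le> \<gamma>" using \<gamma>\<^sub>0[OF \<gamma>] by (simp add: large_ratio_def)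
    obtain D where D: "\<gamma> * real d = real D" using dN by (auto elim: Nats_cases)
    have "1 * real d \<le> \<gamma> * real d" using \<gamma>32 by (intro mult_right_mono) auto
    then have dD: "d \<le> D" by (simp add: D)
    then have DD: "D \<ge> D\<^sub>0" using d by simp
    define err where "err n = (1 / 2) ^ n * (1 + 1 / ((1 + row_rate) / 2)) +
      n * (1 / 2) powr (n * (p ^ D * D)) + 800 * d / n" for n :: nat
    define t where "t = p ^ D * D"
    have t: "0 < t" using p(1) dD d by (simp add: t_def)
    have "(\<lambda>n :: nat. (1 / 2) ^ n * (1 + 1 / ((1 + row_rate) / 2)) + real n * (1 / 2) powr (n * t) + 800 * real d / n)
       \<longlonglongrightarrow> 0"
    proof -
      have "(\<lambda>n :: nat. (1 / 2) ^ n * (1 + 1 / ((1 + row_rate) / 2)) :: real) \<longlonglongrightarrow> 0"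
        by (intro tendsto_mult_left_zero LIMSEQ_realpow_zero) auto
      moreover have "(\<lambda>n :: nat. real n * (1 / 2) powr (real n * t)) \<longlonglongrightarrow> 0"
      proof -
        have "(\<lambda>n :: nat. real n * exp (- c * real n)) \<longlonglongrightarrow> 0" if "0 < c" for c :: real
          using that by real_asymp
        from this[of "t * ln 2"] show ?thesis using t by (simp add: powr_def ln_div mult_ac)
      qed
      moreover have "(\<lambda>n :: nat. 800 * real d / n) \<longlonglongrightarrow> 0" by real_asymp
      ultimately show ?thesis using tendsto_add[OF tendsto_add] by fastforce
    qed
    then have err0: "err \<longlonglongrightarrow> 0" by (simp add: err_def[abs_def] t_def)
    \<comment> \<open>For admissible n the numbers \<gamma> n and \<gamma> n (1 - p) are natural, so
      the floors are exact and the proportion of deleted half-edges is exactly p.\<close>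
    have ge: "1 - err n \<le> measure_pmf.prob (ABC p n \<gamma> d) (good p \<gamma> d n)"
      if n: "n \<ge> 1" "8 * (real d)\<^sup>2 \<le> (1 - row_rate) * n"
        and nN: "\<gamma> * real n \<in> \<nat>" "\<gamma> * real n * (1 - p) \<in> \<nat>" for n
    proof -
      obtain m where m: "\<gamma> * real n = real m" using nN(1) by (auto elim: Nats_cases)
      obtain m' where m': "\<gamma> * real n * (1 - p) = real m'" using nN(2) by (auto elim: Nats_cases)
      have "real m * real d = real n * real D" by (simp add: m[symmetric] D[symmetric])
      then have mdnD: "m * d = n * D" by (simp flip: of_nat_mult)
      have m'_eq: "real m' = real m * (1 - p)" using m m' by simp
      have "real m' \<le> real m" unfolding m'_eq using p mult_left_mono[of "1 - p" 1 "real m"] by simp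
      then have m'm: "m' \<le> m" by simp
      interpret half_edge_pairing n d D m m'
        by unfold_locales (use mdnD d dD n(1) m'm in auto)
      have "real m * (1 / 2) \<le> real m'" unfolding m'_eq using p by (intro mult_left_mono) auto
      then have mm: "m \<le> 2 * m'" by linarith
      have "real (m - m') = real m * p" using m'm m'_eq by (simp add: of_nat_diff algebra_simps)
      then have "real (m - m') * d = (real m * p) * d" by (rule arg_cong)
      also have "\<dots> = p * (real m * d)" by simp
      also have "real m * d = real (n * D)" by (simp flip: mdnD)
      finally have q: "real (m - m') * d = p * (n * D)" .
      have bad: "real (card {\<sigma>. \<sigma> permutes N \<and> \<not> well_behaved (n * (p ^ D * D)) \<sigma>}) \<le> err n * fact (n * D)"
        unfolding err_def
        by (rule card_not_well_behaved[OF p q dD]) (use D\<^sub>0[OF DD] \<gamma>\<^sub>0[OF \<gamma>] m n mm in auto)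
      have D1: "0 < D" using dD d by simp
      \<comment> \<open>p to the power log_p D is D, so that c = 1 turns the claimed bound into the
        threshold n p^D D.\<close>
      have T: "real n * p powr (\<gamma> * real d + 1 * log p (\<gamma> * real d)) = n * (p ^ D * D)"
        using p D1 by (simp add: D powr_add powr_realpow)
      have G: "A \<sigma> \<in> good p \<gamma> d n" if w: "well_behaved (n * (p ^ D * D)) \<sigma>" for \<sigma>
        unfolding good_def mem_Collect_eq T using well_behaved_conclusion[OF w] by blast
      have "ABC p n \<gamma> d = map_pmf A (pmf_of_set {\<sigma>. \<sigma> permutes N})"
        unfolding ABC_def ABC0_def Let_def D m m'_eq[symmetric] A_def[abs_def] N_def
        by (simp add: map_pmf_comp)
      then show ?thesis using prob_ge[OF G bad] by simp
    qed
    have "eventually (\<lambda>n :: nat. 8 * (real d)\<^sup>2 \<le> (1 - row_rate) * n) sequentially"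
    proof -
      have "filterlim (\<lambda>n :: nat. (1 - row_rate) * n) at_top sequentially"
        using row_rate(2) by real_asymp
      then show ?thesis by (simp add: filterlim_at_top)
    qed
    then have "eventually (\<lambda>n. n \<ge> 1 \<and> 8 * (real d)\<^sup>2 \<le> (1 - row_rate) * n) sequentially"
      using eventually_ge_at_top[of "1 :: nat"] by eventually_elim simp
    then have ev: "eventually (\<lambda>n. 1 - err n \<le> measure_pmf.prob (ABC p n \<gamma> d) (good p \<gamma> d n))
      (inf sequentially (principal {n. \<gamma> * real n \<in> \<nat> \<and> \<gamma> * real n * (1 - p) \<in> \<nat>}))"
      unfolding eventually_inf_principal by eventually_elim (use ge in auto)
    have "((\<lambda>n. 1 - err n) \<longlongrightarrow> 1 - 0) sequentially" by (intro tendsto_diff tendsto_const err0)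
    then have lower: "((\<lambda>n. 1 - err n) \<longlongrightarrow> 1) (inf sequentially (principal {n. \<gamma> * real n \<in> \<nat> \<and> \<gamma> * real n * (1 - p) \<in> \<nat>}))"
      by (simp add: tendsto_mono[OF inf_le1])
    show ?thesis by (rule tendsto_sandwich[OF ev _ lower tendsto_const]) simp
  qed
  \<comment> \<open>The degree threshold can be constant in \<gamma>: as D = \<gamma> d >= d, a
    large d makes D large. The 1 in the maximum keeps d and D positive.\<close>
  show ?thesis
    by (rule exI[of _ 1], rule exI[of _ \<gamma>\<^sub>0], rule exI[of _ "\<lambda>_. max 1 D\<^sub>0"], intro allI impI, elim conjE)
      (rule lim[unfolded good_def])
qed

end
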